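(* Let $(\mathcal{C},\otimes,I,\sigma)$ be a symmetric monoidal category that has equalizers. Then the category $\mathsf{BiAlg}_{\mathcal{C},coc}$ of cocommutative bialgebras in $\mathcal{C}$ is an $S_{coc}$-protomodular category, where $S_{coc}$ is the class of split extensions of cocommutative bialgebras. Explicitly: the class $S_{coc}$ is stable under pullbacks, $S_{coc}$ is closed under finite limits, and every point in $S_{coc}$ is a strong point.
   Context: Setting. $(\mathcal{C},\otimes,I,\sigma)$ is a symmetric monoidal category with equalizers (associativity and unit isomorphisms are suppressed); $f\cdot g$ denotes the composite "first $g$, then $f$". Algebras $(A,m,u_A)$ in $\mathcal{C}$ are associative and unital, coalgebras $(C,\Delta,\epsilon_C)$ are coassociative and counital. A bialgebra is an object with an algebra and a coalgebra structure such that $\Delta$ and $\epsilon$ are algebra morphisms; it is cocommutative if $\sigma\cdot\Delta=\Delta$. Morphisms of bialgebras are morphisms in $\mathcal{C}$ that are both algebra and coalgebra morphisms. $\mathsf{BiAlg}_{\mathcal{C},coc}$ (resp. $\mathsf{CoAlg}_{\mathcal{C},coc}$) is the category of cocommutative bialgebras (resp. coalgebras) in $\mathcal{C}$. $\mathsf{BiAlg}_{\mathcal{C},coc}$ is pointed with zero object $I$; the zero morphism $A\to B$ is $u_B\cdot\epsilon_A$. Standing facts on limits. $\mathsf{BiAlg}_{\mathcal{C},coc}$ is finitely complete: the product of $A$ and $B$ is $A\otimes B$ with projections $1_A\otimes\epsilon_B$ and $\epsilon_A\otimes 1_B$; the equalizer of $f,g\colon A\to B$ is carried by the equalizer in $\mathcal{C}$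 of $(f\otimes 1_A)\cdot\Delta$ and $(g\otimes 1_A)\cdot\Delta\colon A\to B\otimes A$; pullbacks are built from these. The forgetful functor $U\colon\mathsf{BiAlg}_{\mathcal{C},coc}\to\mathsf{CoAlg}_{\mathcal{C},coc}$ has a left adjoint (free algebra functor), so it preserves limits and monomorphisms. Split extensions. A split extension of cocommutative bialgebras consists of cocommutative bialgebras $X,A,B$, bialgebra morphisms $\kappa\colon X\to A$, $\alpha\colon A\to B$, $e\colon B\to A$, and a morphism $\lambda\colon A\to X$ in $\mathcal{C}$ such that: (1) $\lambda\cdot\kappa=1_X$, $\alpha\cdot e=1_B$; (2) $\lambda\cdot e=u_X\cdot\epsilon_B$, $\alpha\cdot\kappa=u_B\cdot\epsilon_X$; (3) $m\cdot((\kappa\cdot\lambda)\otimes(e\cdot\alpha))\cdot\Delta=1_A$; (4) $\lambda\cdot m\cdot(\kappa\otimes e)=1_X\otimes\epsilon_B$; (5) $\lambda$ is a morphism of coalgebras preserving the unit. $S_{coc}$ is the class of split extensions of cocommutative bialgebras; a point $(\alpha,e)$ belongs to $S_{coc}$ if it can be completed by some $X,\kappa,\lambda$ to a split extension (then $\kappa$ is a kernel of $\alpha$ in $\mathsf{BiAlg}_{\mathcal{C},coc}$). $S$-protomodularity. In a pointed finitely complete category $\mathcal{D}$, a point is a split epimorphism $\alpha\colon A\to B$ with a chosen section $e\colon B\to A$; a morphism of points $(\alpha,e)\to(\alpha',e')$ is a pair $p\colon A\to A'$, $g\colon B\to B'$ with $\alpha' p=g\alpha$ and $pe=e'g$; finite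 limits of points are computed componentwise. Morphisms $v\colon X\to A$ and $w\colon B\to A$ are jointly strongly epimorphic if every monomorphism $\mu\colon M\to A$ through which both $v$ and $w$ factor is an isomorphism. A point $(\alpha,e)$ with kernel $\kappa\colon X\to A$ of $\alpha$ is a strong point if $\kappa$ and $e$ are jointly strongly epimorphic. Let $S$ be a class of points stable under pullbacks, i.e. for $(\alpha,e)\in S$ with $\alpha\colon A\to B$ and any $g\colon C\to B$, the pullback $p_C\colon A\times_B C\to C$ with the induced section $(e\cdot g,1_C)$ is in $S$. $\mathcal{D}$ is $S$-protomodular if $S$ is closed under finite limits in the category of points and every point in $S$ is a strong point.
   Formalization: Two standing facts are added as hypotheses, since they do not follow from equalizers in C: the category of cocommutative bialgebras has equalizers, and the forgetful functor to cocommutative coalgebras preserves them. *)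

theory Defs
  imports Main
begin

section \<open>Categories\<close>

text \<open>
  Categories have explicit carriers for objects and arrows, so that algebraic structures can
  themselves be the objects of a category. Composition is in functional order: in
  \<open>g \<cdot> f\<close> the arrow \<open>f\<close> comes first. Values of the operations outside the carriers are
  irrelevant.
\<close>

record ('o, 'a) cat =
  Ob :: "'o set"
  Arr :: "'a set"
  Dom :: "'a \<Rightarrow> 'o"
  Cod :: "'a \<Rightarrow> 'o"
  Id :: "'o \<Rightarrow> 'a" ("\<one>\<index>")
  Comp :: "'a \<Rightarrow> 'a \<Rightarrow> 'a" (infixl "\<cdot>\<index>" 70)

definition hom :: "('o, 'a, 'z) cat_scheme \<Rightarrow> 'o \<Rightarrow> 'o \<Rightarrow> 'a set" where
  "hom C a b = {f \<in> Arr C. Dom C f = a \<and> Cod C f = b}"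

locale category =
  fixes C :: "('o, 'a, 'z) cat_scheme" (structure)
  assumes Dom_Ob: "f \<in> Arr C \<Longrightarrow> Dom C f \<in> Ob C"
    and Cod_Ob: "f \<in> Arr C \<Longrightarrow> Cod C f \<in> Ob C"
    and Id_hom: "a \<in> Ob C \<Longrightarrow> \<one> a \<in> hom C a a"
    and Comp_hom: "\<lbrakk>f \<in> hom C a b; g \<in> hom C b c\<rbrakk> \<Longrightarrow> g \<cdot> f \<in> hom C a c"
    and Id_left: "f \<in> hom C a b \<Longrightarrow> \<one> b \<cdot> f = f"
    and Id_right: "f \<in> hom C a b \<Longrightarrow> f \<cdot> \<one> a = f"
    and Comp_assoc: "\<lbrakk>f \<in> hom C a b; g \<in> hom C b c; h \<in> hom C c d\<rbrakk> \<Longrightarrow> (h \<cdot> g) \<cdot> f = h \<cdot> (g \<cdot> f)"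

definition inverse_arrows :: "('o, 'a, 'z) cat_scheme \<Rightarrow> 'a \<Rightarrow> 'a \<Rightarrow> bool" where
  "inverse_arrows C f g \<longleftrightarrow>
     f \<in> Arr C \<and> g \<in> hom C (Cod C f) (Dom C f) \<and>
     g \<cdot>\<^bsub>C\<^esub> f = \<one>\<^bsub>C\<^esub> (Dom C f) \<and> f \<cdot>\<^bsub>C\<^esub> g = \<one>\<^bsub>C\<^esub> (Cod C f)"

definition is_iso :: "('o, 'a, 'z) cat_scheme \<Rightarrow> 'a \<Rightarrow> bool" where
  "is_iso C f \<longleftrightarrow> (\<exists>g. inverse_arrows C f g)"

definition inv_arr :: "('o, 'a, 'z) cat_scheme \<Rightarrow> 'a \<Rightarrow> 'a" where
  "inv_arr C f = (THE g. inverse_arrows C f g)"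

definition is_mono :: "('o, 'a, 'z) cat_scheme \<Rightarrow> 'a \<Rightarrow> bool" where
  "is_mono C m \<longleftrightarrow>
     m \<in> Arr C \<and>
     (\<forall>a. \<forall>f \<in> hom C a (Dom C m). \<forall>g \<in> hom C a (Dom C m). m \<cdot>\<^bsub>C\<^esub> f = m \<cdot>\<^bsub>C\<^esub> g \<longrightarrow> f = g)"

definition is_equalizer :: "('o, 'a, 'z) cat_scheme \<Rightarrow> 'a \<Rightarrow> 'a \<Rightarrow> 'a \<Rightarrow> bool" where
  "is_equalizer C f g i \<longleftrightarrow>
     f \<in> Arr C \<and> g \<in> hom C (Dom C f) (Cod C f) \<and>
     i \<in> Arr C \<and> Cod C i = Dom C f \<and> f \<cdot>\<^bsub>C\<^esub> i = g \<cdot>\<^bsub>C\<^esub> i \<and>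
     (\<forall>t. \<forall>h \<in> hom C t (Dom C f). f \<cdot>\<^bsub>C\<^esub> h = g \<cdot>\<^bsub>C\<^esub> h \<longrightarrow>
        (\<exists>!k. k \<in> hom C t (Dom C i) \<and> i \<cdot>\<^bsub>C\<^esub> k = h))"

definition has_equalizers :: "('o, 'a, 'z) cat_scheme \<Rightarrow> bool" where
  "has_equalizers C \<longleftrightarrow> (\<forall>f \<in> Arr C. \<forall>g \<in> hom C (Dom C f) (Cod C f). \<exists>i. is_equalizer C f g i)"

definition is_pullback :: "('o, 'a, 'z) cat_scheme \<Rightarrow> 'a \<Rightarrow> 'a \<Rightarrow> 'a \<Rightarrow> 'a \<Rightarrow> bool" where
  "is_pullback C f g p q \<longleftrightarrow>
     f \<in> Arr C \<and> g \<in> Arr C \<and> Cod C f = Cod C g \<and>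
     p \<in> Arr C \<and> q \<in> Arr C \<and> Dom C p = Dom C q \<and> Cod C p = Dom C f \<and> Cod C q = Dom C g \<and>
     f \<cdot>\<^bsub>C\<^esub> p = g \<cdot>\<^bsub>C\<^esub> q \<and>
     (\<forall>t. \<forall>h \<in> hom C t (Dom C f). \<forall>k \<in> hom C t (Dom C g). f \<cdot>\<^bsub>C\<^esub> h = g \<cdot>\<^bsub>C\<^esub> k \<longrightarrow>
        (\<exists>!l. l \<in> hom C t (Dom C p) \<and> p \<cdot>\<^bsub>C\<^esub> l = h \<and> q \<cdot>\<^bsub>C\<^esub> l = k))"

definition zero_object :: "('o, 'a, 'z) cat_scheme \<Rightarrow> 'o \<Rightarrow> bool" where
  "zero_object C z \<longleftrightarrow>
     z \<in> Ob C \<and> (\<forall>a \<in> Ob C. (\<exists>!f. f \<in> hom C a z) \<and> (\<exists>!f. f \<in> hom C z a))"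

definition pointed :: "('o, 'a, 'z) cat_scheme \<Rightarrow> bool" where
  "pointed C \<longleftrightarrow> (\<exists>z. zero_object C z)"

definition zero_arrow :: "('o, 'a, 'z) cat_scheme \<Rightarrow> 'a \<Rightarrow> bool" where
  "zero_arrow C f \<longleftrightarrow>
     f \<in> Arr C \<and>
     (\<exists>z. zero_object C z \<and> (\<exists>h \<in> hom C (Dom C f) z. \<exists>g \<in> hom C z (Cod C f). f = g \<cdot>\<^bsub>C\<^esub> h))"

definition is_kernel :: "('o, 'a, 'z) cat_scheme \<Rightarrow> 'a \<Rightarrow> 'a \<Rightarrow> bool" where
  "is_kernel C k f \<longleftrightarrow>
     f \<in> Arr C \<and> k \<in> Arr C \<and> Cod C k = Dom C f \<and> zero_arrow C (f \<cdot>\<^bsub>C\<^esub> k) \<and>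
     (\<forall>t. \<forall>h \<in> hom C t (Dom C f). zero_arrow C (f \<cdot>\<^bsub>C\<^esub> h) \<longrightarrow>
        (\<exists>!l. l \<in> hom C t (Dom C k) \<and> k \<cdot>\<^bsub>C\<^esub> l = h))"


section \<open>Functors and finite limits\<close>

record ('o, 'a, 'p, 'b) cfunctor =
  FOb :: "'o \<Rightarrow> 'p"
  FArr :: "'a \<Rightarrow> 'b"

definition is_functor ::
  "('o, 'a, 'z) cat_scheme \<Rightarrow> ('p, 'b, 'y) cat_scheme \<Rightarrow> ('o, 'a, 'p, 'b) cfunctor \<Rightarrow> bool" where
  "is_functor C D F \<longleftrightarrow>
     (\<forall>a \<in> Ob C. FOb F a \<in> Ob D \<and> FArr F (\<one>\<^bsub>C\<^esub> a) = \<one>\<^bsub>D\<^esub> (FOb F a)) \<and>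
     (\<forall>f \<in> Arr C. FArr F f \<in> hom D (FOb F (Dom C f)) (FOb F (Cod C f))) \<and>
     (\<forall>f \<in> Arr C. \<forall>g \<in> Arr C. Cod C f = Dom C g \<longrightarrow>
        FArr F (g \<cdot>\<^bsub>C\<^esub> f) = FArr F g \<cdot>\<^bsub>D\<^esub> FArr F f)"

definition preserves_equalizers ::
  "('o, 'a, 'z) cat_scheme \<Rightarrow> ('p, 'b, 'y) cat_scheme \<Rightarrow> ('o, 'a, 'p, 'b) cfunctor \<Rightarrow> bool" where
  "preserves_equalizers C D F \<longleftrightarrow>
     (\<forall>f g i. is_equalizer C f g i \<longrightarrow> is_equalizer D (FArr F f) (FArr F g) (FArr F i))"

definition is_cone ::
  "('j, 'u, 'z) cat_scheme \<Rightarrow> ('o, 'a, 'y) cat_scheme \<Rightarrow> ('j, 'u, 'o, 'a) cfunctor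
     \<Rightarrow> 'o \<Rightarrow> ('j \<Rightarrow> 'a) \<Rightarrow> bool" where
  "is_cone J C F v p \<longleftrightarrow>
     v \<in> Ob C \<and> (\<forall>j \<in> Ob J. p j \<in> hom C v (FOb F j)) \<and>
     (\<forall>u \<in> Arr J. FArr F u \<cdot>\<^bsub>C\<^esub> p (Dom J u) = p (Cod J u))"

definition is_limit ::
  "('j, 'u, 'z) cat_scheme \<Rightarrow> ('o, 'a, 'y) cat_scheme \<Rightarrow> ('j, 'u, 'o, 'a) cfunctor
     \<Rightarrow> 'o \<Rightarrow> ('j \<Rightarrow> 'a) \<Rightarrow> bool" where
  "is_limit J C F v p \<longleftrightarrow>
     is_cone J C F v p \<and>
     (\<forall>w q. is_cone J C F w q \<longrightarrow>
        (\<exists>!h. h \<in> hom C w v \<and> (\<forall>j \<in> Ob J. p j \<cdot>\<^bsub>C\<^esub> h = q j)))"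

text \<open>
  Every finite category is isomorphic to one whose objects and arrows are natural numbers, so
  these suffice as shapes of finite diagrams.
\<close>

definition finite_shape :: "(nat, nat) cat \<Rightarrow> bool" where
  "finite_shape J \<longleftrightarrow> category J \<and> finite (Ob J) \<and> finite (Arr J)"

definition finitely_complete :: "('o, 'a, 'z) cat_scheme \<Rightarrow> bool" where
  "finitely_complete C \<longleftrightarrow>
     (\<forall>J F. finite_shape J \<and> is_functor J C F \<longrightarrow> (\<exists>v p. is_limit J C F v p))"


section \<open>Points and S-protomodularity\<close>

definition points :: "('o, 'a, 'z) cat_scheme \<Rightarrow> ('a \<times> 'a) set" where
  "points C = {(\<alpha>, e). \<alpha> \<in> Arr C \<and> e \<in> hom C (Cod C \<alpha>) (Dom C \<alpha>) \<and> \<alpha> \<cdot>\<^bsub>C\<^esub> e = \<one>\<^bsub>C\<^esub> (Cod C \<alpha>)}"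

type_synonym 'a point_arrow = "('a \<times> 'a) \<times> ('a \<times> 'a) \<times> ('a \<times> 'a)"

text \<open>An arrow of points is recorded as source point, pair of arrows, target point.\<close>

definition point_cat :: "('o, 'a, 'z) cat_scheme \<Rightarrow> ('a \<times> 'a, 'a point_arrow) cat" where
  "point_cat C = \<lparr>
     Ob = points C,
     Arr = {((\<alpha>, e), (p, g), (\<alpha>', e')) | \<alpha> e p g \<alpha>' e'.
              (\<alpha>, e) \<in> points C \<and> (\<alpha>', e') \<in> points C \<and>
              p \<in> hom C (Dom C \<alpha>) (Dom C \<alpha>') \<and> g \<in> hom C (Cod C \<alpha>) (Cod C \<alpha>') \<and>
              \<alpha>' \<cdot>\<^bsub>C\<^esub> p = g \<cdot>\<^bsub>C\<^esub> \<alpha> \<and> p \<cdot>\<^bsub>C\<^esub> e = e' \<cdot>\<^bsub>C\<^esub> g},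
     Dom = (\<lambda>(P, _, _). P),
     Cod = (\<lambda>(_, _, Q). Q),
     Id = (\<lambda>(\<alpha>, e). ((\<alpha>, e), (\<one>\<^bsub>C\<^esub> (Dom C \<alpha>), \<one>\<^bsub>C\<^esub> (Cod C \<alpha>)), (\<alpha>, e))),
     Comp = (\<lambda>(_, (p', g'), R) (P, (p, g), _). (P, (p' \<cdot>\<^bsub>C\<^esub> p, g' \<cdot>\<^bsub>C\<^esub> g), R))\<rparr>"

definition jointly_strongly_epic :: "('o, 'a, 'z) cat_scheme \<Rightarrow> 'a \<Rightarrow> 'a \<Rightarrow> bool" where
  "jointly_strongly_epic C v w \<longleftrightarrow>
     v \<in> Arr C \<and> w \<in> Arr C \<and> Cod C v = Cod C w \<and>
     (\<forall>\<mu>. is_mono C \<mu> \<and> Cod C \<mu> = Cod C v \<and>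
          (\<exists>v' \<in> hom C (Dom C v) (Dom C \<mu>). \<mu> \<cdot>\<^bsub>C\<^esub> v' = v) \<and>
          (\<exists>w' \<in> hom C (Dom C w) (Dom C \<mu>). \<mu> \<cdot>\<^bsub>C\<^esub> w' = w) \<longrightarrow>
        is_iso C \<mu>)"

definition strong_point :: "('o, 'a, 'z) cat_scheme \<Rightarrow> 'a \<times> 'a \<Rightarrow> bool" where
  "strong_point C P \<longleftrightarrow>
     P \<in> points C \<and> (\<exists>\<kappa>. is_kernel C \<kappa> (fst P)) \<and>
     (\<forall>\<kappa>. is_kernel C \<kappa> (fst P) \<longrightarrow> jointly_strongly_epic C \<kappa> (snd P))"

definition pullback_stable :: "('o, 'a, 'z) cat_scheme \<Rightarrow> ('a \<times> 'a) set \<Rightarrow> bool" where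
  "pullback_stable C S \<longleftrightarrow>
     (\<forall>\<alpha> e g pA pC s.
        (\<alpha>, e) \<in> S \<and> is_pullback C \<alpha> g pA pC \<and>
        s \<in> hom C (Dom C g) (Dom C pC) \<and>
        pA \<cdot>\<^bsub>C\<^esub> s = e \<cdot>\<^bsub>C\<^esub> g \<and> pC \<cdot>\<^bsub>C\<^esub> s = \<one>\<^bsub>C\<^esub> (Dom C g) \<longrightarrow>
        (pC, s) \<in> S)"

definition closed_under_finite_limits :: "('o, 'a, 'z) cat_scheme \<Rightarrow> ('a \<times> 'a) set \<Rightarrow> bool" where
  "closed_under_finite_limits C S \<longleftrightarrow>
     (\<forall>J F P p.
        finite_shape J \<and> is_functor J (point_cat C) F \<and> (\<forall>j \<in> Ob J. FOb F j \<in> S) \<and>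
        is_limit J (point_cat C) F P p \<longrightarrow> P \<in> S)"

definition S_protomodular :: "('o, 'a, 'z) cat_scheme \<Rightarrow> ('a \<times> 'a) set \<Rightarrow> bool" where
  "S_protomodular C S \<longleftrightarrow>
     category C \<and> pointed C \<and> finitely_complete C \<and> S \<subseteq> points C \<and>
     pullback_stable C S \<and> closed_under_finite_limits C S \<and> (\<forall>P \<in> S. strong_point C P)"


section \<open>Symmetric monoidal categories\<close>

text \<open>The tensor product is written \<open>\<otimes>\<close> on objects and \<open>\<odot>\<close> on arrows.\<close>

record ('o, 'a) smc = "('o, 'a) cat" +
  tensO :: "'o \<Rightarrow> 'o \<Rightarrow> 'o" (infixr "\<otimes>\<index>" 75)
  tensA :: "'a \<Rightarrow> 'a \<Rightarrow> 'a" (infixr "\<odot>\<index>" 75)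
  unitO :: "'o" ("I\<index>")
  assoc :: "'o \<Rightarrow> 'o \<Rightarrow> 'o \<Rightarrow> 'a"
  lunit :: "'o \<Rightarrow> 'a"
  runit :: "'o \<Rightarrow> 'a"
  braid :: "'o \<Rightarrow> 'o \<Rightarrow> 'a"

locale symmetric_monoidal_category = category C
  for C :: "('o, 'a, 'z) smc_scheme" (structure) +
  assumes tensO_Ob: "\<lbrakk>a \<in> Ob C; b \<in> Ob C\<rbrakk> \<Longrightarrow> a \<otimes> b \<in> Ob C"
    and unitO_Ob: "I \<in> Ob C"
    and tensA_hom: "\<lbrakk>f \<in> hom C a b; g \<in> hom C c d\<rbrakk> \<Longrightarrow> f \<odot> g \<in> hom C (a \<otimes> c) (b \<otimes> d)"
    and tensA_Id: "\<lbrakk>a \<in> Ob C; b \<in> Ob C\<rbrakk> \<Longrightarrow> \<one> a \<odot> \<one> b = \<one> (a \<otimes> b)"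
    and tensA_Comp: "\<lbrakk>f \<in> hom C a b; f' \<in> hom C b c; g \<in> hom C a' b'; g' \<in> hom C b' c'\<rbrakk> \<Longrightarrow>
      (f' \<cdot> f) \<odot> (g' \<cdot> g) = (f' \<odot> g') \<cdot> (f \<odot> g)"
    and assoc_hom: "\<lbrakk>a \<in> Ob C; b \<in> Ob C; c \<in> Ob C\<rbrakk> \<Longrightarrow>
      assoc C a b c \<in> hom C ((a \<otimes> b) \<otimes> c) (a \<otimes> (b \<otimes> c))"
    and assoc_iso: "\<lbrakk>a \<in> Ob C; b \<in> Ob C; c \<in> Ob C\<rbrakk> \<Longrightarrow> is_iso C (assoc C a b c)"
    and assoc_natural: "\<lbrakk>f \<in> hom C a a'; g \<in> hom C b b'; h \<in> hom C c c'\<rbrakk> \<Longrightarrow>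
      assoc C a' b' c' \<cdot> ((f \<odot> g) \<odot> h) = (f \<odot> (g \<odot> h)) \<cdot> assoc C a b c"
    and lunit_hom: "a \<in> Ob C \<Longrightarrow> lunit C a \<in> hom C (I \<otimes> a) a"
    and lunit_iso: "a \<in> Ob C \<Longrightarrow> is_iso C (lunit C a)"
    and lunit_natural: "f \<in> hom C a b \<Longrightarrow> lunit C b \<cdot> (\<one> I \<odot> f) = f \<cdot> lunit C a"
    and runit_hom: "a \<in> Ob C \<Longrightarrow> runit C a \<in> hom C (a \<otimes> I) a"
    and runit_iso: "a \<in> Ob C \<Longrightarrow> is_iso C (runit C a)"
    and runit_natural: "f \<in> hom C a b \<Longrightarrow> runit C b \<cdot> (f \<odot> \<one> I) = f \<cdot> runit C a"
    and pentagon: "\<lbrakk>a \<in> Ob C; b \<in> Ob C; c \<in> Ob C; d \<in> Ob C\<rbrakk> \<Longrightarrow>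
      assoc C a b (c \<otimes> d) \<cdot> assoc C (a \<otimes> b) c d =
      (\<one> a \<odot> assoc C b c d) \<cdot> assoc C a (b \<otimes> c) d \<cdot> (assoc C a b c \<odot> \<one> d)"
    and triangle: "\<lbrakk>a \<in> Ob C; b \<in> Ob C\<rbrakk> \<Longrightarrow>
      (\<one> a \<odot> lunit C b) \<cdot> assoc C a I b = runit C a \<odot> \<one> b"
    and braid_hom: "\<lbrakk>a \<in> Ob C; b \<in> Ob C\<rbrakk> \<Longrightarrow> braid C a b \<in> hom C (a \<otimes> b) (b \<otimes> a)"
    and braid_natural: "\<lbrakk>f \<in> hom C a a'; g \<in> hom C b b'\<rbrakk> \<Longrightarrow>
      braid C a' b' \<cdot> (f \<odot> g) = (g \<odot> f) \<cdot> braid C a b"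
    and braid_braid: "\<lbrakk>a \<in> Ob C; b \<in> Ob C\<rbrakk> \<Longrightarrow> braid C b a \<cdot> braid C a b = \<one> (a \<otimes> b)"
    and hexagon: "\<lbrakk>a \<in> Ob C; b \<in> Ob C; c \<in> Ob C\<rbrakk> \<Longrightarrow>
      assoc C b c a \<cdot> braid C a (b \<otimes> c) \<cdot> assoc C a b c =
      (\<one> b \<odot> braid C a c) \<cdot> assoc C b a c \<cdot> (braid C a b \<odot> \<one> c)"

text \<open>The interchange of the two middle factors, \<open>(a \<otimes> b) \<otimes> (c \<otimes> d) \<rightarrow> (a \<otimes> c) \<otimes> (b \<otimes> d)\<close>.\<close>

definition interchange :: "('o, 'a, 'z) smc_scheme \<Rightarrow> 'o \<Rightarrow> 'o \<Rightarrow> 'o \<Rightarrow> 'o \<Rightarrow> 'a" where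
  "interchange C a b c d =
     inv_arr C (assoc C a c (b \<otimes>\<^bsub>C\<^esub> d)) \<cdot>\<^bsub>C\<^esub>
     (\<one>\<^bsub>C\<^esub> a \<odot>\<^bsub>C\<^esub>
        (assoc C c b d \<cdot>\<^bsub>C\<^esub> (braid C b c \<odot>\<^bsub>C\<^esub> \<one>\<^bsub>C\<^esub> d) \<cdot>\<^bsub>C\<^esub> inv_arr C (assoc C b c d))) \<cdot>\<^bsub>C\<^esub>
     assoc C a b (c \<otimes>\<^bsub>C\<^esub> d)"


section \<open>Algebras, coalgebras and bialgebras\<close>

record ('o, 'a) alg =
  algO :: 'o
  algMult :: 'a
  algUnit :: 'a

record ('o, 'a) coalg =
  coalgO :: 'o
  coalgComult :: 'a
  coalgCounit :: 'a

record ('o, 'a) bialg =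
  obj :: 'o
  mult :: 'a
  unit :: 'a
  comult :: 'a
  counit :: 'a

definition alg_of :: "('o, 'a) bialg \<Rightarrow> ('o, 'a) alg" where
  "alg_of A = \<lparr>algO = obj A, algMult = mult A, algUnit = unit A\<rparr>"

definition coalg_of :: "('o, 'a) bialg \<Rightarrow> ('o, 'a) coalg" where
  "coalg_of A = \<lparr>coalgO = obj A, coalgComult = comult A, coalgCounit = counit A\<rparr>"

definition algebra :: "('o, 'a, 'z) smc_scheme \<Rightarrow> ('o, 'a) alg \<Rightarrow> bool" where
  "algebra C A \<longleftrightarrow> (let a = algO A; m = algMult A; u = algUnit A in
     a \<in> Ob C \<and> m \<in> hom C (a \<otimes>\<^bsub>C\<^esub> a) a \<and> u \<in> hom C I\<^bsub>C\<^esub> a \<and>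
     m \<cdot>\<^bsub>C\<^esub> (m \<odot>\<^bsub>C\<^esub> \<one>\<^bsub>C\<^esub> a) = m \<cdot>\<^bsub>C\<^esub> (\<one>\<^bsub>C\<^esub> a \<odot>\<^bsub>C\<^esub> m) \<cdot>\<^bsub>C\<^esub> assoc C a a a \<and>
     m \<cdot>\<^bsub>C\<^esub> (u \<odot>\<^bsub>C\<^esub> \<one>\<^bsub>C\<^esub> a) = lunit C a \<and>
     m \<cdot>\<^bsub>C\<^esub> (\<one>\<^bsub>C\<^esub> a \<odot>\<^bsub>C\<^esub> u) = runit C a)"

definition coalgebra :: "('o, 'a, 'z) smc_scheme \<Rightarrow> ('o, 'a) coalg \<Rightarrow> bool" where
  "coalgebra C A \<longleftrightarrow> (let a = coalgO A; d = coalgComult A; e = coalgCounit A in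
     a \<in> Ob C \<and> d \<in> hom C a (a \<otimes>\<^bsub>C\<^esub> a) \<and> e \<in> hom C a I\<^bsub>C\<^esub> \<and>
     assoc C a a a \<cdot>\<^bsub>C\<^esub> (d \<odot>\<^bsub>C\<^esub> \<one>\<^bsub>C\<^esub> a) \<cdot>\<^bsub>C\<^esub> d = (\<one>\<^bsub>C\<^esub> a \<odot>\<^bsub>C\<^esub> d) \<cdot>\<^bsub>C\<^esub> d \<and>
     lunit C a \<cdot>\<^bsub>C\<^esub> (e \<odot>\<^bsub>C\<^esub> \<one>\<^bsub>C\<^esub> a) \<cdot>\<^bsub>C\<^esub> d = \<one>\<^bsub>C\<^esub> a \<and>
     runit C a \<cdot>\<^bsub>C\<^esub> (\<one>\<^bsub>C\<^esub> a \<odot>\<^bsub>C\<^esub> e) \<cdot>\<^bsub>C\<^esub> d = \<one>\<^bsub>C\<^esub> a)"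

definition cocommutative :: "('o, 'a, 'z) smc_scheme \<Rightarrow> ('o, 'a) coalg \<Rightarrow> bool" where
  "cocommutative C A \<longleftrightarrow> braid C (coalgO A) (coalgO A) \<cdot>\<^bsub>C\<^esub> coalgComult A = coalgComult A"

definition alg_hom :: "('o, 'a, 'z) smc_scheme \<Rightarrow> ('o, 'a) alg \<Rightarrow> ('o, 'a) alg \<Rightarrow> 'a \<Rightarrow> bool" where
  "alg_hom C A B f \<longleftrightarrow>
     f \<in> hom C (algO A) (algO B) \<and>
     f \<cdot>\<^bsub>C\<^esub> algMult A = algMult B \<cdot>\<^bsub>C\<^esub> (f \<odot>\<^bsub>C\<^esub> f) \<and>
     f \<cdot>\<^bsub>C\<^esub> algUnit A = algUnit B"

definition coalg_hom :: "('o, 'a, 'z) smc_scheme \<Rightarrow> ('o, 'a) coalg \<Rightarrow> ('o, 'a) coalg \<Rightarrow> 'a \<Rightarrow> bool" where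
  "coalg_hom C A B f \<longleftrightarrow>
     f \<in> hom C (coalgO A) (coalgO B) \<and>
     coalgComult B \<cdot>\<^bsub>C\<^esub> f = (f \<odot>\<^bsub>C\<^esub> f) \<cdot>\<^bsub>C\<^esub> coalgComult A \<and>
     coalgCounit B \<cdot>\<^bsub>C\<^esub> f = coalgCounit A"

definition unit_alg :: "('o, 'a, 'z) smc_scheme \<Rightarrow> ('o, 'a) alg" where
  "unit_alg C = \<lparr>algO = I\<^bsub>C\<^esub>, algMult = lunit C I\<^bsub>C\<^esub>, algUnit = \<one>\<^bsub>C\<^esub> I\<^bsub>C\<^esub>\<rparr>"

definition tensor_alg :: "('o, 'a, 'z) smc_scheme \<Rightarrow> ('o, 'a) alg \<Rightarrow> ('o, 'a) alg \<Rightarrow> ('o, 'a) alg" where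
  "tensor_alg C A B = \<lparr>
     algO = algO A \<otimes>\<^bsub>C\<^esub> algO B,
     algMult = (algMult A \<odot>\<^bsub>C\<^esub> algMult B) \<cdot>\<^bsub>C\<^esub> interchange C (algO A) (algO B) (algO A) (algO B),
     algUnit = (algUnit A \<odot>\<^bsub>C\<^esub> algUnit B) \<cdot>\<^bsub>C\<^esub> inv_arr C (lunit C I\<^bsub>C\<^esub>)\<rparr>"

definition bialgebra :: "('o, 'a, 'z) smc_scheme \<Rightarrow> ('o, 'a) bialg \<Rightarrow> bool" where
  "bialgebra C A \<longleftrightarrow>
     algebra C (alg_of A) \<and> coalgebra C (coalg_of A) \<and>
     alg_hom C (alg_of A) (tensor_alg C (alg_of A) (alg_of A)) (comult A) \<and>
     alg_hom C (alg_of A) (unit_alg C) (counit A)"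

definition coc_bialgebra :: "('o, 'a, 'z) smc_scheme \<Rightarrow> ('o, 'a) bialg \<Rightarrow> bool" where
  "coc_bialgebra C A \<longleftrightarrow> bialgebra C A \<and> cocommutative C (coalg_of A)"

definition bialg_hom :: "('o, 'a, 'z) smc_scheme \<Rightarrow> ('o, 'a) bialg \<Rightarrow> ('o, 'a) bialg \<Rightarrow> 'a \<Rightarrow> bool" where
  "bialg_hom C A B f \<longleftrightarrow>
     alg_hom C (alg_of A) (alg_of B) f \<and> coalg_hom C (coalg_of A) (coalg_of B) f"

text \<open>Arrows of the following categories are triples \<open>(source, underlying arrow of C, target)\<close>.\<close>

definition CoAlg_coc ::
  "('o, 'a, 'z) smc_scheme \<Rightarrow> (('o, 'a) coalg, ('o, 'a) coalg \<times> 'a \<times> ('o, 'a) coalg) cat" where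
  "CoAlg_coc C = \<lparr>
     Ob = {A. coalgebra C A \<and> cocommutative C A},
     Arr = {(A, f, B) | A f B. coalgebra C A \<and> cocommutative C A \<and>
              coalgebra C B \<and> cocommutative C B \<and> coalg_hom C A B f},
     Dom = (\<lambda>(A, _, _). A),
     Cod = (\<lambda>(_, _, B). B),
     Id = (\<lambda>A. (A, \<one>\<^bsub>C\<^esub> (coalgO A), A)),
     Comp = (\<lambda>(_, g, D) (A, f, _). (A, g \<cdot>\<^bsub>C\<^esub> f, D))\<rparr>"

definition BiAlg_coc ::
  "('o, 'a, 'z) smc_scheme \<Rightarrow> (('o, 'a) bialg, ('o, 'a) bialg \<times> 'a \<times> ('o, 'a) bialg) cat" where
  "BiAlg_coc C = \<lparr>
     Ob = {A. coc_bialgebra C A},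
     Arr = {(A, f, B) | A f B. coc_bialgebra C A \<and> coc_bialgebra C B \<and> bialg_hom C A B f},
     Dom = (\<lambda>(A, _, _). A),
     Cod = (\<lambda>(_, _, B). B),
     Id = (\<lambda>A. (A, \<one>\<^bsub>C\<^esub> (obj A), A)),
     Comp = (\<lambda>(_, g, D) (A, f, _). (A, g \<cdot>\<^bsub>C\<^esub> f, D))\<rparr>"

text \<open>
  Equalizers in \<open>C\<close> alone do not give \<open>BiAlg_coc C\<close> equalizers. Let \<open>C\<close> be the finitely
  generated modules over \<open>R = k[x]/(x^2)\<close> with \<open>char k = 2\<close>, and let \<open>A = R[t]/(t^2)\<close> with \<open>t\<close>
  primitive: the endomorphisms \<open>t \<mapsto> x t\<close> and \<open>t \<mapsto> 0\<close> of \<open>A\<close> have no equalizer. So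
  equalizers of cocommutative bialgebras, and their preservation by the functor \<open>forget_alg\<close> to
  cocommutative coalgebras, have to be assumed separately.
\<close>

definition forget_alg ::
  "(('o, 'a) bialg, ('o, 'a) bialg \<times> 'a \<times> ('o, 'a) bialg,
    ('o, 'a) coalg, ('o, 'a) coalg \<times> 'a \<times> ('o, 'a) coalg) cfunctor" where
  "forget_alg = \<lparr>FOb = coalg_of, FArr = (\<lambda>(A, f, B). (coalg_of A, f, coalg_of B))\<rparr>"


section \<open>Split extensions of cocommutative bialgebras\<close>

text \<open>
  The arrow \<open>l\<close> is the retraction \<open>\<lambda> : A \<rightarrow> X\<close>; it is a morphism of coalgebras but in general
  not of algebras. In the fourth equation \<open>runit\<close> is the unit isomorphism identifying
  \<open>X \<otimes> I\<close> with \<open>X\<close>.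
\<close>

definition split_extension ::
  "('o, 'a, 'z) smc_scheme \<Rightarrow> ('o, 'a) bialg \<Rightarrow> ('o, 'a) bialg \<Rightarrow> ('o, 'a) bialg
     \<Rightarrow> 'a \<Rightarrow> 'a \<Rightarrow> 'a \<Rightarrow> 'a \<Rightarrow> bool" where
  "split_extension C X A B \<kappa> \<alpha> e l \<longleftrightarrow>
     coc_bialgebra C X \<and> coc_bialgebra C A \<and> coc_bialgebra C B \<and>
     bialg_hom C X A \<kappa> \<and> bialg_hom C A B \<alpha> \<and> bialg_hom C B A e \<and>
     l \<in> hom C (obj A) (obj X) \<and>
     l \<cdot>\<^bsub>C\<^esub> \<kappa> = \<one>\<^bsub>C\<^esub> (obj X) \<and> \<alpha> \<cdot>\<^bsub>C\<^esub> e = \<one>\<^bsub>C\<^esub> (obj B) \<and>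
     l \<cdot>\<^bsub>C\<^esub> e = unit X \<cdot>\<^bsub>C\<^esub> counit B \<and> \<alpha> \<cdot>\<^bsub>C\<^esub> \<kappa> = unit B \<cdot>\<^bsub>C\<^esub> counit X \<and>
     mult A \<cdot>\<^bsub>C\<^esub> ((\<kappa> \<cdot>\<^bsub>C\<^esub> l) \<odot>\<^bsub>C\<^esub> (e \<cdot>\<^bsub>C\<^esub> \<alpha>)) \<cdot>\<^bsub>C\<^esub> comult A = \<one>\<^bsub>C\<^esub> (obj A) \<and>
     l \<cdot>\<^bsub>C\<^esub> mult A \<cdot>\<^bsub>C\<^esub> (\<kappa> \<odot>\<^bsub>C\<^esub> e) = runit C (obj X) \<cdot>\<^bsub>C\<^esub> (\<one>\<^bsub>C\<^esub> (obj X) \<odot>\<^bsub>C\<^esub> counit B) \<and>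
     coalg_hom C (coalg_of A) (coalg_of X) l \<and> l \<cdot>\<^bsub>C\<^esub> unit A = unit X"

definition S_coc ::
  "('o, 'a, 'z) smc_scheme
     \<Rightarrow> ((('o, 'a) bialg \<times> 'a \<times> ('o, 'a) bialg) \<times> (('o, 'a) bialg \<times> 'a \<times> ('o, 'a) bialg)) set" where
  "S_coc C = {((A, \<alpha>, B), (B, e, A)) | A B \<alpha> e. \<exists>X \<kappa> l. split_extension C X A B \<kappa> \<alpha> e l}"

end

(*
  Cocommutative coalgebras form a cartesian category whose product is the tensor product, and a
  cocommutative bialgebra is a monoid in it. Writing morphisms of coalgebras as generalized elements, a
  split extension says that every element a of A is the product of q(a) and e(alpha(a)), where
  q = kappa lambda, and that q(x * e(b)) = x whenever alpha(x) = 1. Such a q is unique and natural in the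
  point. Limits of bialgebras are also limits of coalgebras, so the maps q of the points of a diagram (or
  of the given point and the trivial one, for a pullback) induce the map q of the limit point. If
  mu : N -> A is a monomorphism through which the kernel and the section factor as mu v and mu w, then
  a |-> v(lambda a) * w(alpha a) is a section of mu; as mu is monic on coalgebras, it is invertible.
*)
theory Submission
  imports Defs
begin

section \<open>Coherence in symmetric monoidal categories\<close>

text \<open>The retraction \<open>q\<close> and the section of \<open>mu\<close> are at first only
  coalgebra morphisms, so the universal property of a limit of bialgebras does not apply to them as
  it stands. Cancellation and factorization are therefore tested against every cocommutative
  coalgebra: the tensor product is already the product there, and equalizers are carried over by the
  assumption on \<open>forget_alg\<close>. A coalgebra morphism obtained in this way is a bialgebra
  morphism as soon as its composites with a jointly monic family are. The same assumption makes a
  monomorphism of bialgebras monic on coalgebra morphisms, through its kernel pair. A further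
  obstacle is that a limit of points is given by its universal property among points alone. Its
  total object is shown to be a retract of the limit computed componentwise, which is enough to
  transport \<open>q\<close>. Associativity and unit isomorphisms are explicit, so the coherence
  needed for tensor products of coalgebras is derived from the axioms; later arguments mostly run on
  generalized elements.\<close>

context category
begin

lemma hom_iff: "f \<in> hom C a b \<longleftrightarrow> f \<in> Arr C \<and> Dom C f = a \<and> Cod C f = b"
  by (simp add: hom_def)

lemma comp_simps [simp]:
  assumes "f \<in> Arr C" "g \<in> Arr C" "Dom C g = Cod C f"
  shows "g \<cdot> f \<in> Arr C" "Dom C (g \<cdot> f) = Dom C f" "Cod C (g \<cdot> f) = Cod C g"
  using Comp_hom[of f "Dom C f" "Cod C f" g "Cod C g"] assms by (auto simp: hom_iff)

lemma id_simps [simp]: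
  assumes "a \<in> Ob C"
  shows "\<one> a \<in> Arr C" "Dom C (\<one> a) = a" "Cod C (\<one> a) = a"
  using Id_hom[OF assms] by (auto simp: hom_iff)

lemma id_left [simp]: "\<lbrakk>f \<in> Arr C; Cod C f = b\<rbrakk> \<Longrightarrow> \<one> b \<cdot> f = f"
  by (rule Id_left) (auto simp: hom_iff)

lemma id_right [simp]: "\<lbrakk>f \<in> Arr C; Dom C f = a\<rbrakk> \<Longrightarrow> f \<cdot> \<one> a = f"
  by (rule Id_right) (auto simp: hom_iff)

lemma comp_assoc:
  "\<lbrakk>f \<in> Arr C; g \<in> Arr C; h \<in> Arr C; Dom C g = Cod C f; Dom C h = Cod C g\<rbrakk>
    \<Longrightarrow> (h \<cdot> g) \<cdot> f = h \<cdot> (g \<cdot> f)"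
  by (rule Comp_assoc) (auto simp: hom_iff)

lemma inverse_unique:
  assumes "inverse_arrows C f g" "inverse_arrows C f h"
  shows "g = h"
proof -
  note a = assms[unfolded inverse_arrows_def hom_iff]
  have "g = g \<cdot> (f \<cdot> h)" using a by simp
  also have "\<dots> = (g \<cdot> f) \<cdot> h" by (rule comp_assoc[symmetric]) (use a in auto)
  also have "\<dots> = h" using a by simp
  finally show ?thesis .
qed

lemma inv_arr_inverse:
  assumes "is_iso C f"
  shows "inverse_arrows C f (inv_arr C f)"
  using assms inverse_unique unfolding is_iso_def inv_arr_def by (metis the_equality)

lemma inv_simps [simp]:
  assumes "is_iso C f"
  shows "inv_arr C f \<in> Arr C" "Dom C (inv_arr C f) = Cod C f" "Cod C (inv_arr C f) = Dom C f"
    "inv_arr C f \<cdot> f = \<one> (Dom C f)" "f \<cdot> inv_arr C f = \<one> (Cod C f)"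
  using inv_arr_inverse[OF assms] by (auto simp: inverse_arrows_def hom_iff)

lemma iso_arr: "is_iso C f \<Longrightarrow> f \<in> Arr C"
  by (auto simp: is_iso_def inverse_arrows_def)

lemma inv_cancel [simp]:
  assumes "is_iso C f" "h \<in> Arr C"
  shows "Cod C h = Dom C f \<Longrightarrow> inv_arr C f \<cdot> (f \<cdot> h) = h"
    "Cod C h = Cod C f \<Longrightarrow> f \<cdot> (inv_arr C f \<cdot> h) = h"
  using assms iso_arr[of f] by (simp_all flip: comp_assoc)

lemma iso_epi:
  assumes "is_iso C f" "g \<cdot> f = h \<cdot> f" "g \<in> Arr C" "h \<in> Arr C" "Dom C g = Cod C f" "Dom C h = Cod C f"
  shows "g = h"
proof -
  have "(k \<cdot> f) \<cdot> inv_arr C f = k" if "k \<in> Arr C" "Dom C k = Cod C f" for k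
    using that assms(1) iso_arr[of f] by (simp add: comp_assoc)
  then show ?thesis using assms(2-) by metis
qed

lemma iso_mono:
  assumes "is_iso C f" "f \<cdot> g = f \<cdot> h" "g \<in> Arr C" "h \<in> Arr C" "Cod C g = Dom C f" "Cod C h = Dom C f"
  shows "g = h"
proof -
  have "inv_arr C f \<cdot> (f \<cdot> k) = k" if "k \<in> Arr C" "Cod C k = Dom C f" for k
    using that assms(1) iso_arr[of f] by simp
  then show ?thesis using assms(2-) by metis
qed

lemma isoI:
  assumes "f \<in> Arr C" "g \<in> Arr C" "Dom C g = Cod C f" "Cod C g = Dom C f"
    "g \<cdot> f = \<one> (Dom C f)" "f \<cdot> g = \<one> (Cod C f)"
  shows "is_iso C f"
  using assms by (auto simp: is_iso_def inverse_arrows_def hom_iff)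

text \<open>Composites are kept bracketed to the right, so the left side of a known equation usually
  occurs followed by further arrows \<open>t\<close>. This form and \<open>comp_reduce1\<close>
  apply the equation in front of such a tail.\<close>

lemma comp_reduce:
  assumes "g \<cdot> f = k \<cdot> h"
    and "f \<in> Arr C" "g \<in> Arr C" "h \<in> Arr C" "k \<in> Arr C" "t \<in> Arr C"
    and "Dom C g = Cod C f" "Dom C k = Cod C h" "Dom C f = Cod C t" "Dom C h = Cod C t"
  shows "g \<cdot> (f \<cdot> t) = k \<cdot> (h \<cdot> t)"
  using assms by (simp flip: comp_assoc)

lemma comp_reduce1:
  assumes "g \<cdot> f = k"
    and "f \<in> Arr C" "g \<in> Arr C" "t \<in> Arr C"
    and "Dom C g = Cod C f" "Dom C f = Cod C t"
  shows "g \<cdot> (f \<cdot> t) = k \<cdot> t"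
  using assms by (simp flip: comp_assoc)

end

context symmetric_monoidal_category
begin

declare tensO_Ob [simp] unitO_Ob [simp] Dom_Ob [simp] Cod_Ob [simp]

lemma tens_simps [simp]:
  assumes "f \<in> Arr C" "g \<in> Arr C"
  shows "f \<odot> g \<in> Arr C" "Dom C (f \<odot> g) = Dom C f \<otimes> Dom C g" "Cod C (f \<odot> g) = Cod C f \<otimes> Cod C g"
  using tensA_hom[of f "Dom C f" "Cod C f" g "Dom C g" "Cod C g"] assms by (auto simp: hom_iff)

lemma tens_id [simp]: "\<lbrakk>a \<in> Ob C; b \<in> Ob C\<rbrakk> \<Longrightarrow> \<one> a \<odot> \<one> b = \<one> (a \<otimes> b)"
  by (rule tensA_Id)

lemma tens_comp:
  "\<lbrakk>f \<in> Arr C; f' \<in> Arr C; g \<in> Arr C; g' \<in> Arr C; Dom C f' = Cod C f; Dom C g' = Cod C g\<rbrakk>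
    \<Longrightarrow> (f' \<odot> g') \<cdot> (f \<odot> g) = (f' \<cdot> f) \<odot> (g' \<cdot> g)"
  by (rule tensA_Comp[symmetric]) (auto simp: hom_iff)

lemma tens_comp':
  "\<lbrakk>f \<in> Arr C; f' \<in> Arr C; g \<in> Arr C; g' \<in> Arr C; Dom C f' = Cod C f; Dom C g' = Cod C g;
    t \<in> Arr C; Cod C t = Dom C f \<otimes> Dom C g\<rbrakk>
    \<Longrightarrow> (f' \<odot> g') \<cdot> ((f \<odot> g) \<cdot> t) = ((f' \<cdot> f) \<odot> (g' \<cdot> g)) \<cdot> t"
  by (simp flip: comp_assoc add: tens_comp)

lemma tens_iso [simp]: 
  assumes "is_iso C f" "is_iso C g"
  shows "is_iso C (f \<odot> g)"
  using assms iso_arr[OF assms(1)] iso_arr[OF assms(2)]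
  by (intro isoI[of _ "inv_arr C f \<odot> inv_arr C g"]) (auto simp: tens_comp)

lemma id_iso [simp]: "a \<in> Ob C \<Longrightarrow> is_iso C (\<one> a)"
  by (rule isoI[of _ "\<one> a"]) auto

abbreviation as where "as \<equiv> assoc C"
abbreviation lu where "lu \<equiv> lunit C"
abbreviation ru where "ru \<equiv> runit C"
abbreviation br where "br \<equiv> braid C"

lemma struct_simps [simp]:
  "\<lbrakk>a \<in> Ob C; b \<in> Ob C; c \<in> Ob C\<rbrakk> \<Longrightarrow> as a b c \<in> Arr C"
  "\<lbrakk>a \<in> Ob C; b \<in> Ob C; c \<in> Ob C\<rbrakk> \<Longrightarrow> Dom C (as a b c) = (a \<otimes> b) \<otimes> c"
  "\<lbrakk>a \<in> Ob C; b \<in> Ob C; c \<in> Ob C\<rbrakk> \<Longrightarrow> Cod C (as a b c) = a \<otimes> (b \<otimes> c)"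
  "a \<in> Ob C \<Longrightarrow> lu a \<in> Arr C" "a \<in> Ob C \<Longrightarrow> Dom C (lu a) = I \<otimes> a" "a \<in> Ob C \<Longrightarrow> Cod C (lu a) = a"
  "a \<in> Ob C \<Longrightarrow> ru a \<in> Arr C" "a \<in> Ob C \<Longrightarrow> Dom C (ru a) = a \<otimes> I" "a \<in> Ob C \<Longrightarrow> Cod C (ru a) = a"
  "\<lbrakk>a \<in> Ob C; b \<in> Ob C\<rbrakk> \<Longrightarrow> br a b \<in> Arr C"
  "\<lbrakk>a \<in> Ob C; b \<in> Ob C\<rbrakk> \<Longrightarrow> Dom C (br a b) = a \<otimes> b"
  "\<lbrakk>a \<in> Ob C; b \<in> Ob C\<rbrakk> \<Longrightarrow> Cod C (br a b) = b \<otimes> a"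
  using assoc_hom[of a b c] lunit_hom[of a] runit_hom[of a] braid_hom[of a b] by (auto simp: hom_iff)

declare assoc_iso [simp] lunit_iso [simp] runit_iso [simp]

lemma braid_iso [simp]: "\<lbrakk>a \<in> Ob C; b \<in> Ob C\<rbrakk> \<Longrightarrow> is_iso C (br a b)"
  by (rule isoI[of _ "br b a"]) (auto simp: braid_braid)

lemma assoc_nat:
  "\<lbrakk>f \<in> Arr C; g \<in> Arr C; h \<in> Arr C; Cod C f = a; Cod C g = b; Cod C h = c\<rbrakk> \<Longrightarrow>
    as a b c \<cdot> ((f \<odot> g) \<odot> h) = (f \<odot> (g \<odot> h)) \<cdot> as (Dom C f) (Dom C g) (Dom C h)"
  by (rule assoc_natural) (auto simp: hom_iff)

lemma lunit_nat: "\<lbrakk>f \<in> Arr C; Cod C f = b\<rbrakk> \<Longrightarrow> lu b \<cdot> (\<one> I \<odot> f) = f \<cdot> lu (Dom C f)"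
  by (rule lunit_natural) (auto simp: hom_iff)

lemma runit_nat: "\<lbrakk>f \<in> Arr C; Cod C f = b\<rbrakk> \<Longrightarrow> ru b \<cdot> (f \<odot> \<one> I) = f \<cdot> ru (Dom C f)"
  by (rule runit_natural) (auto simp: hom_iff)

lemma braid_nat: "\<lbrakk>f \<in> Arr C; g \<in> Arr C; Cod C f = a; Cod C g = b\<rbrakk> \<Longrightarrow>
  br a b \<cdot> (f \<odot> g) = (g \<odot> f) \<cdot> br (Dom C f) (Dom C g)"
  by (rule braid_natural) (auto simp: hom_iff)

text \<open>By \<open>ru\<close>, tensoring with \<open>I\<close> is naturally isomorphic to the
  identity functor. The unit coherences below are proved after tensoring with \<open>I\<close>,
  where pentagon, triangle and hexagon apply.\<close>

lemma tens_I_faithful: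
  assumes "f \<odot> \<one> I = g \<odot> \<one> I" "f \<in> Arr C" "g \<in> Arr C" "Dom C f = Dom C g" "Cod C f = Cod C g"
  shows "f = g"
proof (rule iso_epi)
  show "f \<cdot> ru (Dom C f) = g \<cdot> ru (Dom C f)"
    using runit_nat[OF assms(2) refl] runit_nat[OF assms(3) refl] assms(1,4,5) by metis
qed (use assms in auto)

lemma I_tens_faithful:
  assumes "\<one> I \<odot> f = \<one> I \<odot> g" "f \<in> Arr C" "g \<in> Arr C" "Dom C f = Dom C g" "Cod C f = Cod C g"
  shows "f = g"
proof (rule iso_epi)
  show "f \<cdot> lu (Dom C f) = g \<cdot> lu (Dom C f)"
    using lunit_nat[OF assms(2) refl] lunit_nat[OF assms(3) refl] assms(1,4,5) by metis
qed (use assms in auto)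

lemma whisk_left: "\<lbrakk>a \<in> Ob C; f \<in> Arr C; g \<in> Arr C; Dom C g = Cod C f\<rbrakk> \<Longrightarrow>
    \<one> a \<odot> (g \<cdot> f) = (\<one> a \<odot> g) \<cdot> (\<one> a \<odot> f)"
  by (simp add: tens_comp)

lemma whisk_right: "\<lbrakk>a \<in> Ob C; f \<in> Arr C; g \<in> Arr C; Dom C g = Cod C f\<rbrakk> \<Longrightarrow>
    (g \<cdot> f) \<odot> \<one> a = (g \<odot> \<one> a) \<cdot> (f \<odot> \<one> a)"
  by (simp add: tens_comp)

lemmas whisk = whisk_left whisk_right

lemma assoc_nat1: "\<lbrakk>f \<in> Arr C; b \<in> Ob C; c \<in> Ob C; Cod C f = a\<rbrakk> \<Longrightarrow>
    as a b c \<cdot> ((f \<odot> \<one> b) \<odot> \<one> c) = (f \<odot> \<one> (b \<otimes> c)) \<cdot> as (Dom C f) b c"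
  using assoc_nat[of f "\<one> b" "\<one> c" a b c] by simp

lemma assoc_nat2: "\<lbrakk>f \<in> Arr C; a \<in> Ob C; c \<in> Ob C; Cod C f = b\<rbrakk> \<Longrightarrow>
    as a b c \<cdot> ((\<one> a \<odot> f) \<odot> \<one> c) = (\<one> a \<odot> (f \<odot> \<one> c)) \<cdot> as a (Dom C f) c"
  using assoc_nat[of "\<one> a" f "\<one> c" a b c] by simp

lemma assoc_nat3: "\<lbrakk>f \<in> Arr C; a \<in> Ob C; b \<in> Ob C; Cod C f = c\<rbrakk> \<Longrightarrow>
    as a b c \<cdot> (\<one> (a \<otimes> b) \<odot> f) = (\<one> a \<odot> (\<one> b \<odot> f)) \<cdot> as a b (Dom C f)"
  using assoc_nat[of "\<one> a" "\<one> b" f a b c] by simp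

lemmas assoc_whisk = assoc_nat1 assoc_nat2 assoc_nat3
  comp_reduce[OF assoc_nat1] comp_reduce[OF assoc_nat2] comp_reduce[OF assoc_nat3]

section \<open>Unit coherences derived from pentagon, triangle and hexagon\<close>

lemma pentagon':
  "\<lbrakk>a \<in> Ob C; b \<in> Ob C; c \<in> Ob C; d \<in> Ob C\<rbrakk> \<Longrightarrow>
   (\<one> a \<odot> as b c d) \<cdot> (as a (b \<otimes> c) d \<cdot> (as a b c \<odot> \<one> d)) = as a b (c \<otimes> d) \<cdot> as (a \<otimes> b) c d"
  by (simp add: pentagon comp_assoc)

lemma pentagon'':
  "\<lbrakk>a \<in> Ob C; b \<in> Ob C; c \<in> Ob C; d \<in> Ob C; t \<in> Arr C; Cod C t = ((a \<otimes> b) \<otimes> c) \<otimes> d\<rbrakk> \<Longrightarrow>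
   (\<one> a \<odot> as b c d) \<cdot> (as a (b \<otimes> c) d \<cdot> ((as a b c \<odot> \<one> d) \<cdot> t)) = as a b (c \<otimes> d) \<cdot> (as (a \<otimes> b) c d \<cdot> t)"
  by (simp flip: comp_assoc add: pentagon)

text \<open>Kelly's argument: tensor with \<open>I\<close> on the left and precompose with the
  isomorphism \<open>?X\<close>, two edges of the pentagon at \<open>I\<close>, \<open>I\<close>,
  \<open>a\<close>, \<open>b\<close>. The triangle then turns both sides into the same whiskered
  \<open>ru I\<close>.\<close>

lemma lunit_tens:
  assumes [simp]: "a \<in> Ob C" "b \<in> Ob C"
  shows "lu (a \<otimes> b) \<cdot> as I a b = lu a \<odot> \<one> b"
proof (rule I_tens_faithful)
  let ?X = "as I (I \<otimes> a) b \<cdot> (as I I a \<odot> \<one> b)"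
  show "\<one> I \<odot> (lu (a \<otimes> b) \<cdot> as I a b) = \<one> I \<odot> (lu a \<odot> \<one> b)"
  proof (rule iso_epi)
    have "(\<one> I \<odot> (lu (a \<otimes> b) \<cdot> as I a b)) \<cdot> ?X =
        (\<one> I \<odot> lu (a \<otimes> b)) \<cdot> (as I I (a \<otimes> b) \<cdot> as (I \<otimes> I) a b)"
      by (simp add: whisk comp_assoc pentagon')
    also have "\<dots> = (ru I \<odot> \<one> (a \<otimes> b)) \<cdot> as (I \<otimes> I) a b"
      by (simp add: comp_reduce1[OF triangle])
    also have "\<dots> = as I a b \<cdot> ((ru I \<odot> \<one> a) \<odot> \<one> b)"
      by (simp add: assoc_whisk)
    also have "\<dots> = as I a b \<cdot> (((\<one> I \<odot> lu a) \<cdot> as I I a) \<odot> \<one> b)"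
      by (simp add: triangle)
    also have "\<dots> = (\<one> I \<odot> (lu a \<odot> \<one> b)) \<cdot> ?X"
      by (simp add: whisk assoc_whisk)
    finally show "(\<one> I \<odot> (lu (a \<otimes> b) \<cdot> as I a b)) \<cdot> ?X = (\<one> I \<odot> (lu a \<odot> \<one> b)) \<cdot> ?X" .
    show "is_iso C ?X" by (rule isoI[of _ "(inv_arr C (as I I a) \<odot> \<one> b) \<cdot> inv_arr C (as I (I \<otimes> a) b)"])
       (simp_all add: comp_assoc tens_comp tens_comp')
  qed auto
qed auto

text \<open>The mirror argument, with the pentagon at \<open>a\<close>, \<open>b\<close>,
  \<open>I\<close>, \<open>I\<close>; the auxiliary unit now stands on the right.\<close>

lemma runit_tens:
  assumes [simp]: "a \<in> Ob C" "b \<in> Ob C"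
  shows "(\<one> a \<odot> ru b) \<cdot> as a b I = ru (a \<otimes> b)"
proof (rule tens_I_faithful)
  show "((\<one> a \<odot> ru b) \<cdot> as a b I) \<odot> \<one> I = ru (a \<otimes> b) \<odot> \<one> I"
  proof (rule iso_mono)
    have "as a b I \<cdot> (((\<one> a \<odot> ru b) \<cdot> as a b I) \<odot> \<one> I) =
      (\<one> a \<odot> (ru b \<odot> \<one> I)) \<cdot> (as a (b \<otimes> I) I \<cdot> (as a b I \<odot> \<one> I))"
      by (simp add: whisk assoc_whisk)
    also have "\<dots> = (\<one> a \<odot> (\<one> b \<odot> lu I)) \<cdot> ((\<one> a \<odot> as b I I) \<cdot> (as a (b \<otimes> I) I \<cdot> (as a b I \<odot> \<one> I)))"
      by (simp add: comp_reduce1 tens_comp tens_comp' triangle)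
    also have "\<dots> = (\<one> a \<odot> (\<one> b \<odot> lu I)) \<cdot> (as a b (I \<otimes> I) \<cdot> as (a \<otimes> b) I I)"
      by (simp only: pentagon' assms unitO_Ob)
    also have "\<dots> = as a b I \<cdot> ((\<one> (a \<otimes> b) \<odot> lu I) \<cdot> as (a \<otimes> b) I I)"
      by (simp add: assoc_whisk del: tens_id)
    also have "\<dots> = as a b I \<cdot> (ru (a \<otimes> b) \<odot> \<one> I)"
      by (simp add: triangle)
    finally show "as a b I \<cdot> (((\<one> a \<odot> ru b) \<cdot> as a b I) \<odot> \<one> I) = as a b I \<cdot> (ru (a \<otimes> b) \<odot> \<one> I)" .
  qed auto
qed auto

text \<open>Naturality of \<open>lu\<close> at the arrow \<open>lu I\<close> gives
  \<open>lu (I \<otimes> I) = \<one> I \<odot> lu I\<close>; inserting this into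
  \<open>lunit_tens\<close> leaves the left side of the triangle at \<open>I\<close>,
  \<open>I\<close>.\<close>

lemma lunit_unit: "lu I = ru I"
proof (rule tens_I_faithful)
  have "lu (I \<otimes> I) = \<one> I \<odot> lu I"
    by (rule iso_mono[of "lu I"]) (auto simp: lunit_nat)
  then show "lu I \<odot> \<one> I = ru I \<odot> \<one> I"
    using lunit_tens[of I I] triangle[of I I] by simp
qed auto

text \<open>The hexagon at \<open>a\<close>, \<open>I\<close>, \<open>I\<close>: after tensoring
  with \<open>I\<close> and composing with the invertible \<open>br a I\<close>, naturality of
  \<open>lu\<close> and of the braiding bring the composite to the triangle.\<close>

lemma lunit_braid:
  assumes [simp]: "a \<in> Ob C"
  shows "lu a \<cdot> br a I = ru a"
proof (rule tens_I_faithful)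
  show "(lu a \<cdot> br a I) \<odot> \<one> I = ru a \<odot> \<one> I"
  proof (rule iso_mono)
    have "br a I \<cdot> ((lu a \<cdot> br a I) \<odot> \<one> I) = br a I \<cdot> ((lu a \<odot> \<one> I) \<cdot> (br a I \<odot> \<one> I))"
      by (simp add: whisk)
    also have "\<dots> = br a I \<cdot> (lu (a \<otimes> I) \<cdot> (as I a I \<cdot> (br a I \<odot> \<one> I)))"
      by (simp add: lunit_tens comp_reduce1)
    also have "\<dots> = lu (I \<otimes> a) \<cdot> ((\<one> I \<odot> br a I) \<cdot> (as I a I \<cdot> (br a I \<odot> \<one> I)))"
      by (simp add: comp_reduce[OF lunit_nat])
    also have "\<dots> = lu (I \<otimes> a) \<cdot> (as I I a \<cdot> (br a (I \<otimes> I) \<cdot> as a I I))"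
      using hexagon[of a I I] by (simp add: comp_assoc)
    also have "\<dots> = (lu I \<odot> \<one> a) \<cdot> (br a (I \<otimes> I) \<cdot> as a I I)"
      by (simp add: comp_reduce1[OF lunit_tens])
    also have "\<dots> = br a I \<cdot> ((\<one> a \<odot> lu I) \<cdot> as a I I)"
      by (simp add: comp_reduce[OF braid_nat])
    also have "\<dots> = br a I \<cdot> (ru a \<odot> \<one> I)" by (simp add: triangle)
    finally show "br a I \<cdot> ((lu a \<cdot> br a I) \<odot> \<one> I) = br a I \<cdot> (ru a \<odot> \<one> I)" .
  qed auto
qed auto

lemma runit_braid: "a \<in> Ob C \<Longrightarrow> ru a \<cdot> br I a = lu a"
  using lunit_braid[of a] by (simp flip: lunit_braid add: comp_assoc braid_braid)

lemma braid_unit: "br I I = \<one> (I \<otimes> I)"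
  by (rule iso_mono[of "lu I"]) (use lunit_braid[of I] lunit_unit in auto)

text \<open>
  Coherence equations are verified after moving all brackets to the right; there the symmetry acts
  only through \<open>swap\<close>, and the middle-four interchange becomes a single \<open>swap\<close> (\<open>assoc_ich\<close>).
\<close>

definition swap :: "'o \<Rightarrow> 'o \<Rightarrow> 'o \<Rightarrow> 'a" where
  "swap a b x = as b a x \<cdot> (br a b \<odot> \<one> x) \<cdot> inv_arr C (as a b x)"

lemma swap_simps [simp]:
  assumes "a \<in> Ob C" "b \<in> Ob C" "x \<in> Ob C"
  shows "swap a b x \<in> Arr C" "Dom C (swap a b x) = a \<otimes> (b \<otimes> x)" "Cod C (swap a b x) = b \<otimes> (a \<otimes> x)"
  using assms by (simp_all add: swap_def)

lemma swap_assoc: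
  assumes [simp]: "a \<in> Ob C" "b \<in> Ob C" "x \<in> Ob C"
  shows "swap a b x \<cdot> as a b x = as b a x \<cdot> (br a b \<odot> \<one> x)"
  by (simp add: swap_def comp_assoc)

lemma swap_sw:
  assumes [simp]: "a \<in> Ob C" "b \<in> Ob C" "x \<in> Ob C"
  shows "swap b a x \<cdot> swap a b x = \<one> (a \<otimes> (b \<otimes> x))"
  by (simp add: swap_def comp_assoc tens_comp' braid_braid)

lemma swap_iso [simp]:
  assumes "a \<in> Ob C" "b \<in> Ob C" "x \<in> Ob C"
  shows "is_iso C (swap a b x)"
  using assms by (intro isoI[of _ "swap b a x"]) (simp_all add: swap_sw)

lemma swap_nat:
  assumes [simp]: "f \<in> Arr C" "g \<in> Arr C" "h \<in> Arr C" and [simp]: "Cod C f = a" "Cod C g = b" "Cod C h = x"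
  shows "swap a b x \<cdot> (f \<odot> (g \<odot> h)) = (g \<odot> (f \<odot> h)) \<cdot> swap (Dom C f) (Dom C g) (Dom C h)"
proof (rule iso_epi)
  have [simp]: "a \<in> Ob C" "b \<in> Ob C" "x \<in> Ob C" using Cod_Ob assms by blast+
  let ?\<alpha> = "as (Dom C f) (Dom C g) (Dom C h)"
  have "(swap a b x \<cdot> (f \<odot> (g \<odot> h))) \<cdot> ?\<alpha> = swap a b x \<cdot> (as a b x \<cdot> ((f \<odot> g) \<odot> h))"
    by (simp add: assoc_nat comp_assoc)
  also have "\<dots> = as b a x \<cdot> ((br a b \<cdot> (f \<odot> g)) \<odot> h)"
    by (simp add: comp_reduce[OF swap_assoc] tens_comp)
  also have "\<dots> = as b a x \<cdot> (((g \<odot> f) \<odot> h) \<cdot> (br (Dom C f) (Dom C g) \<odot> \<one> (Dom C h)))"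
    by (simp add: braid_nat tens_comp)
  also have "\<dots> = (g \<odot> (f \<odot> h)) \<cdot> (as (Dom C g) (Dom C f) (Dom C h) \<cdot> (br (Dom C f) (Dom C g) \<odot> \<one> (Dom C h)))"
    by (simp add: comp_reduce[OF assoc_nat])
  also have "\<dots> = ((g \<odot> (f \<odot> h)) \<cdot> swap (Dom C f) (Dom C g) (Dom C h)) \<cdot> ?\<alpha>"
    by (simp add: swap_assoc comp_assoc)
  finally show "(swap a b x \<cdot> (f \<odot> (g \<odot> h))) \<cdot> ?\<alpha> = ((g \<odot> (f \<odot> h)) \<cdot> swap (Dom C f) (Dom C g) (Dom C h)) \<cdot> ?\<alpha>" .
qed (use Cod_Ob[OF assms(1)] Cod_Ob[OF assms(2)] Cod_Ob[OF assms(3)] in auto)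

text \<open>The hexagon with a further factor \<open>x\<close> carried along: precomposing with the
  rebracketing \<open>?Z\<close> reduces it to the hexagon tensored with \<open>\<one> x\<close>,
  and pentagons restore the brackets.\<close>

lemma swap_tens_right:
  assumes [simp]: "a \<in> Ob C" "b \<in> Ob C" "c \<in> Ob C" "x \<in> Ob C"
  shows "as b c (a \<otimes> x) \<cdot> swap a (b \<otimes> c) x = (\<one> b \<odot> swap a c x) \<cdot> (swap a b (c \<otimes> x) \<cdot> (\<one> a \<odot> as b c x))"
proof (rule iso_epi)
  let ?Z = "as a (b \<otimes> c) x \<cdot> (as a b c \<odot> \<one> x)"
  have "(as b c (a \<otimes> x) \<cdot> swap a (b \<otimes> c) x) \<cdot> ?Z =
      as b c (a \<otimes> x) \<cdot> (as (b \<otimes> c) a x \<cdot> ((br a (b \<otimes> c) \<odot> \<one> x) \<cdot> (as a b c \<odot> \<one> x)))"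
    by (simp add: comp_assoc comp_reduce[OF swap_assoc])
  also have "\<dots> = (\<one> b \<odot> as c a x) \<cdot> (as b (c \<otimes> a) x \<cdot>
      ((as b c a \<odot> \<one> x) \<cdot> ((br a (b \<otimes> c) \<odot> \<one> x) \<cdot> (as a b c \<odot> \<one> x))))"
    by (simp add: pentagon'')
  also have "\<dots> = (\<one> b \<odot> as c a x) \<cdot> (as b (c \<otimes> a) x \<cdot> ((as b c a \<cdot> br a (b \<otimes> c) \<cdot> as a b c) \<odot> \<one> x))"
    by (simp add: whisk comp_assoc)
  also have "\<dots> = (\<one> b \<odot> as c a x) \<cdot> (as b (c \<otimes> a) x \<cdot>
      (((\<one> b \<odot> br a c) \<odot> \<one> x) \<cdot> ((as b a c \<odot> \<one> x) \<cdot> ((br a b \<odot> \<one> c) \<odot> \<one> x))))"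
    by (simp add: hexagon) (simp add: whisk comp_assoc)
  also have "\<dots> = (\<one> b \<odot> (as c a x \<cdot> (br a c \<odot> \<one> x))) \<cdot>
      (as b (a \<otimes> c) x \<cdot> ((as b a c \<odot> \<one> x) \<cdot> ((br a b \<odot> \<one> c) \<odot> \<one> x)))"
    by (simp add: whisk assoc_whisk comp_assoc)
  also have "\<dots> = (\<one> b \<odot> swap a c x) \<cdot> ((\<one> b \<odot> as a c x) \<cdot>
      (as b (a \<otimes> c) x \<cdot> ((as b a c \<odot> \<one> x) \<cdot> ((br a b \<odot> \<one> c) \<odot> \<one> x))))"
    by (simp add: whisk flip: swap_assoc) (simp add: comp_assoc)
  also have "\<dots> = (\<one> b \<odot> swap a c x) \<cdot> (as b a (c \<otimes> x) \<cdot> ((br a b \<odot> \<one> (c \<otimes> x)) \<cdot> as (a \<otimes> b) c x))"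
    by (simp add: pentagon'' assoc_whisk)
  also have "\<dots> = (\<one> b \<odot> swap a c x) \<cdot> (swap a b (c \<otimes> x) \<cdot> (as a b (c \<otimes> x) \<cdot> as (a \<otimes> b) c x))"
    by (simp add: comp_reduce[OF swap_assoc])
  also have "\<dots> = ((\<one> b \<odot> swap a c x) \<cdot> (swap a b (c \<otimes> x) \<cdot> (\<one> a \<odot> as b c x))) \<cdot> ?Z"
    by (simp add: comp_assoc pentagon')
  finally show "(as b c (a \<otimes> x) \<cdot> swap a (b \<otimes> c) x) \<cdot> ?Z =
      ((\<one> b \<odot> swap a c x) \<cdot> (swap a b (c \<otimes> x) \<cdot> (\<one> a \<odot> as b c x))) \<cdot> ?Z" .
  show "is_iso C ?Z" by (rule isoI[of _ "(inv_arr C (as a b c) \<odot> \<one> x) \<cdot> inv_arr C (as a (b \<otimes> c) x)"])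
       (simp_all add: comp_assoc tens_comp tens_comp')
qed auto

text \<open>The other hexagon. In a symmetric category it comes from inverting
  \<open>swap_tens_right\<close>, since \<open>swap c (a \<otimes> b) x\<close> is inverse to
  \<open>swap (a \<otimes> b) c x\<close>.\<close>

lemma swap_tens_left:
  assumes [simp]: "a \<in> Ob C" "b \<in> Ob C" "c \<in> Ob C" "x \<in> Ob C"
  shows "(\<one> c \<odot> as a b x) \<cdot> swap (a \<otimes> b) c x = swap a c (b \<otimes> x) \<cdot> ((\<one> a \<odot> swap b c x) \<cdot> as a b (c \<otimes> x))"
proof (rule iso_epi[of "swap c (a \<otimes> b) x"])
  show "((\<one> c \<odot> as a b x) \<cdot> swap (a \<otimes> b) c x) \<cdot> swap c (a \<otimes> b) x =
      (swap a c (b \<otimes> x) \<cdot> ((\<one> a \<odot> swap b c x) \<cdot> as a b (c \<otimes> x))) \<cdot> swap c (a \<otimes> b) x"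
    by (simp add: comp_assoc swap_sw swap_tens_right tens_comp' comp_reduce1[OF swap_sw])
qed auto

text \<open>A \<open>swap\<close> moves only the first two factors, so it does not matter whether
  \<open>y\<close> is bracketed with the tail \<open>x\<close> or stands outside; pentagon and
  naturality of the associator express this.\<close>

lemma swap_tail:
  assumes [simp]: "a \<in> Ob C" "b \<in> Ob C" "x \<in> Ob C" "y \<in> Ob C"
  shows "(\<one> b \<odot> as a x y) \<cdot> (as b (a \<otimes> x) y \<cdot> (swap a b x \<odot> \<one> y)) =
    swap a b (x \<otimes> y) \<cdot> ((\<one> a \<odot> as b x y) \<cdot> as a (b \<otimes> x) y)"
proof (rule iso_epi[of "as a b x \<odot> \<one> y"])
  have "((\<one> b \<odot> as a x y) \<cdot> (as b (a \<otimes> x) y \<cdot> (swap a b x \<odot> \<one> y))) \<cdot> (as a b x \<odot> \<one> y) =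
     (\<one> b \<odot> as a x y) \<cdot> (as b (a \<otimes> x) y \<cdot> ((as b a x \<odot> \<one> y) \<cdot> ((br a b \<odot> \<one> x) \<odot> \<one> y)))"
    by (simp add: comp_assoc flip: whisk) (simp add: swap_assoc)
  also have "\<dots> = as b a (x \<otimes> y) \<cdot> ((br a b \<odot> \<one> (x \<otimes> y)) \<cdot> as (a \<otimes> b) x y)"
    by (simp add: pentagon'' assoc_whisk)
  also have "\<dots> = swap a b (x \<otimes> y) \<cdot> (as a b (x \<otimes> y) \<cdot> as (a \<otimes> b) x y)"
    by (simp add: comp_reduce[OF swap_assoc])
  also have "\<dots> = (swap a b (x \<otimes> y) \<cdot> ((\<one> a \<odot> as b x y) \<cdot> as a (b \<otimes> x) y)) \<cdot> (as a b x \<odot> \<one> y)"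
    by (simp add: comp_assoc pentagon')
  finally show "((\<one> b \<odot> as a x y) \<cdot> (as b (a \<otimes> x) y \<cdot> (swap a b x \<odot> \<one> y))) \<cdot> (as a b x \<odot> \<one> y) =
    (swap a b (x \<otimes> y) \<cdot> ((\<one> a \<odot> as b x y) \<cdot> as a (b \<otimes> x) y)) \<cdot> (as a b x \<odot> \<one> y)" .
qed auto

section \<open>The middle-four interchange and its coherence\<close>

abbreviation ich where "ich \<equiv> interchange C"

lemma ich_simps [simp]:
  assumes "a \<in> Ob C" "b \<in> Ob C" "c \<in> Ob C" "d \<in> Ob C"
  shows "ich a b c d \<in> Arr C" "Dom C (ich a b c d) = (a \<otimes> b) \<otimes> (c \<otimes> d)"
    "Cod C (ich a b c d) = (a \<otimes> c) \<otimes> (b \<otimes> d)"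
  using assms by (simp_all add: interchange_def)

lemma assoc_ich:
  assumes [simp]: "a \<in> Ob C" "b \<in> Ob C" "c \<in> Ob C" "d \<in> Ob C"
  shows "as a c (b \<otimes> d) \<cdot> ich a b c d = (\<one> a \<odot> swap b c d) \<cdot> as a b (c \<otimes> d)"
  by (simp add: interchange_def swap_def comp_assoc)

lemma ich_nat:
  assumes [simp]: "f \<in> Arr C" "g \<in> Arr C" "h \<in> Arr C" "k \<in> Arr C" 
   and [simp]: "Cod C f = a" "Cod C g = b" "Cod C h = c" "Cod C k = d"
  shows "ich a b c d \<cdot> ((f \<odot> g) \<odot> (h \<odot> k)) =
    ((f \<odot> h) \<odot> (g \<odot> k)) \<cdot> ich (Dom C f) (Dom C g) (Dom C h) (Dom C k)"
proof (rule iso_mono)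
  have [simp]: "a \<in> Ob C" "b \<in> Ob C" "c \<in> Ob C" "d \<in> Ob C" using Cod_Ob assms by blast+
  show "as a c (b \<otimes> d) \<cdot> (ich a b c d \<cdot> ((f \<odot> g) \<odot> (h \<odot> k))) = as a c (b \<otimes> d) \<cdot>
    (((f \<odot> h) \<odot> (g \<odot> k)) \<cdot> ich (Dom C f) (Dom C g) (Dom C h) (Dom C k))"
    by (simp add: assoc_nat tens_comp' swap_nat assoc_ich comp_reduce[OF assoc_ich] comp_reduce[OF assoc_nat])
qed (use Cod_Ob[OF assms(1)] Cod_Ob[OF assms(2)] Cod_Ob[OF assms(3)] Cod_Ob[OF assms(4)] in auto)

lemma ich_ich:
  assumes [simp]: "a \<in> Ob C" "b \<in> Ob C" "c \<in> Ob C" "d \<in> Ob C"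
  shows "ich a c b d \<cdot> ich a b c d = \<one> ((a \<otimes> b) \<otimes> (c \<otimes> d))"
  by (rule iso_mono[of "as a b (c \<otimes> d)"]) (simp_all add: assoc_ich comp_reduce[OF assoc_ich] tens_comp' swap_sw)

lemma ich_iso [simp]:
  assumes "a \<in> Ob C" "b \<in> Ob C" "c \<in> Ob C" "d \<in> Ob C"
  shows "is_iso C (ich a b c d)"
  using assms by (intro isoI[of _ "ich a c b d"]) (simp_all add: ich_ich)

text \<open>Needed for coassociativity of tensor coalgebras. The rebracketing \<open>?N\<close> puts
  all six factors into one right-bracketed word; both sides then become the same list of swaps:
  \<open>a3\<close> past \<open>b1\<close>, \<open>a2\<close> past \<open>b1\<close>,
  \<open>a3\<close> past \<open>b2\<close>.\<close>

lemma ich_assoc: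
  assumes [simp]: "a1 \<in> Ob C" "a2 \<in> Ob C" "a3 \<in> Ob C" "b1 \<in> Ob C" "b2 \<in> Ob C" "b3 \<in> Ob C"
  shows "as (a1 \<otimes> b1) (a2 \<otimes> b2) (a3 \<otimes> b3) \<cdot>
      ((ich a1 a2 b1 b2 \<odot> \<one> (a3 \<otimes> b3)) \<cdot> ich (a1 \<otimes> a2) a3 (b1 \<otimes> b2) b3) =
    (\<one> (a1 \<otimes> b1) \<odot> ich a2 a3 b2 b3) \<cdot> (ich a1 (a2 \<otimes> a3) b1 (b2 \<otimes> b3) \<cdot> (as a1 a2 a3 \<odot> as b1 b2 b3))"
    (is "?L = ?R")
proof (rule iso_mono)
  let ?z = "a3 \<otimes> b3"
  let ?N = "(\<one> a1 \<odot> (\<one> b1 \<odot> as a2 b2 ?z)) \<cdot> as a1 b1 ((a2 \<otimes> b2) \<otimes> ?z)"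
  show "is_iso C ?N"
    by (rule isoI[of _ "inv_arr C (as a1 b1 ((a2 \<otimes> b2) \<otimes> ?z)) \<cdot> (\<one> a1 \<odot> (\<one> b1 \<odot> inv_arr C (as a2 b2 ?z)))"])
       (simp_all add: comp_assoc tens_comp tens_comp')
  have "?N \<cdot> ?L = (\<one> a1 \<odot> (\<one> b1 \<odot> as a2 b2 ?z)) \<cdot> (as a1 b1 ((a2 \<otimes> b2) \<otimes> ?z) \<cdot>
      (as (a1 \<otimes> b1) (a2 \<otimes> b2) ?z \<cdot> ((ich a1 a2 b1 b2 \<odot> \<one> ?z) \<cdot> ich (a1 \<otimes> a2) a3 (b1 \<otimes> b2) b3)))"
    by (simp add: comp_assoc)
  also have "\<dots> = (\<one> a1 \<odot> (\<one> b1 \<odot> as a2 b2 ?z)) \<cdot> ((\<one> a1 \<odot> as b1 (a2 \<otimes> b2) ?z) \<cdot>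
      (as a1 (b1 \<otimes> (a2 \<otimes> b2)) ?z \<cdot> (((as a1 b1 (a2 \<otimes> b2) \<cdot> ich a1 a2 b1 b2) \<odot> \<one> ?z) \<cdot>
       ich (a1 \<otimes> a2) a3 (b1 \<otimes> b2) b3)))"
    by (simp add: pentagon'' whisk comp_assoc)
  also have "\<dots> = (\<one> a1 \<odot> (\<one> b1 \<odot> as a2 b2 ?z)) \<cdot> ((\<one> a1 \<odot> as b1 (a2 \<otimes> b2) ?z) \<cdot>
      ((\<one> a1 \<odot> (swap a2 b1 b2 \<odot> \<one> ?z)) \<cdot> (as a1 (a2 \<otimes> (b1 \<otimes> b2)) ?z \<cdot> ((as a1 a2 (b1 \<otimes> b2) \<odot> \<one> ?z) \<cdot>
       ich (a1 \<otimes> a2) a3 (b1 \<otimes> b2) b3))))"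
    by (simp add: assoc_ich whisk assoc_whisk comp_assoc)
  also have "\<dots> = (\<one> a1 \<odot> ((\<one> b1 \<odot> as a2 b2 ?z) \<cdot> (as b1 (a2 \<otimes> b2) ?z \<cdot> (swap a2 b1 b2 \<odot> \<one> ?z)))) \<cdot>
      (as a1 (a2 \<otimes> (b1 \<otimes> b2)) ?z \<cdot> ((as a1 a2 (b1 \<otimes> b2) \<odot> \<one> ?z) \<cdot>
       ich (a1 \<otimes> a2) a3 (b1 \<otimes> b2) b3))"
    by (simp add: whisk comp_assoc)
  also have "\<dots> = (\<one> a1 \<odot> swap a2 b1 (b2 \<otimes> ?z)) \<cdot> ((\<one> a1 \<odot> (\<one> a2 \<odot> as b1 b2 ?z)) \<cdot>
      ((\<one> a1 \<odot> as a2 (b1 \<otimes> b2) ?z) \<cdot>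
      (as a1 (a2 \<otimes> (b1 \<otimes> b2)) ?z \<cdot> ((as a1 a2 (b1 \<otimes> b2) \<odot> \<one> ?z) \<cdot>
       ich (a1 \<otimes> a2) a3 (b1 \<otimes> b2) b3))))"
    by (simp add: swap_tail) (simp add: whisk comp_assoc)
  also have "\<dots> = (\<one> a1 \<odot> swap a2 b1 (b2 \<otimes> ?z)) \<cdot> ((\<one> a1 \<odot> (\<one> a2 \<odot> as b1 b2 ?z)) \<cdot>
      (as a1 a2 ((b1 \<otimes> b2) \<otimes> ?z) \<cdot> (as (a1 \<otimes> a2) (b1 \<otimes> b2) ?z \<cdot> ich (a1 \<otimes> a2) a3 (b1 \<otimes> b2) b3)))"
    by (simp add: pentagon'')
  also have "\<dots> = (\<one> a1 \<odot> swap a2 b1 (b2 \<otimes> ?z)) \<cdot> ((\<one> a1 \<odot> (\<one> a2 \<odot> (as b1 b2 ?z \<cdot> swap a3 (b1 \<otimes> b2) b3))) \<cdot>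
      (as a1 a2 (a3 \<otimes> ((b1 \<otimes> b2) \<otimes> b3)) \<cdot> as (a1 \<otimes> a2) a3 ((b1 \<otimes> b2) \<otimes> b3)))"
    by (simp add: assoc_ich comp_assoc whisk assoc_whisk del: tens_id)
  also have "\<dots> = (\<one> a1 \<odot> swap a2 b1 (b2 \<otimes> ?z)) \<cdot> ((\<one> a1 \<odot> (\<one> a2 \<odot> (\<one> b1 \<odot> swap a3 b2 b3))) \<cdot>
      ((\<one> a1 \<odot> (\<one> a2 \<odot> swap a3 b1 (b2 \<otimes> b3))) \<cdot> ((\<one> a1 \<odot> (\<one> a2 \<odot> (\<one> a3 \<odot> as b1 b2 b3))) \<cdot>
      (as a1 a2 (a3 \<otimes> ((b1 \<otimes> b2) \<otimes> b3)) \<cdot> as (a1 \<otimes> a2) a3 ((b1 \<otimes> b2) \<otimes> b3)))))"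
    by (simp add: swap_tens_right) (simp add: whisk comp_assoc)
  also have "\<dots> = (\<one> a1 \<odot> (swap a2 b1 (b2 \<otimes> ?z) \<cdot> (\<one> a2 \<odot> (\<one> b1 \<odot> swap a3 b2 b3)))) \<cdot>
      ((\<one> a1 \<odot> (\<one> a2 \<odot> swap a3 b1 (b2 \<otimes> b3))) \<cdot> ((\<one> a1 \<odot> (\<one> a2 \<odot> (\<one> a3 \<odot> as b1 b2 b3))) \<cdot>
      (as a1 a2 (a3 \<otimes> ((b1 \<otimes> b2) \<otimes> b3)) \<cdot> as (a1 \<otimes> a2) a3 ((b1 \<otimes> b2) \<otimes> b3))))"
    by (simp add: whisk comp_assoc)
  \<comment> \<open>The swaps of \<open>a2\<close>, \<open>b1\<close> and of \<open>a3\<close>,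
    \<open>b2\<close> concern disjoint factors, so naturality interchanges them; this gives the
    order of swaps in which \<open>?R\<close> comes out.\<close>
  also have "\<dots> = (\<one> a1 \<odot> (\<one> b1 \<odot> (\<one> a2 \<odot> swap a3 b2 b3))) \<cdot> ((\<one> a1 \<odot> swap a2 b1 (a3 \<otimes> (b2 \<otimes> b3))) \<cdot>
      ((\<one> a1 \<odot> (\<one> a2 \<odot> swap a3 b1 (b2 \<otimes> b3))) \<cdot> ((\<one> a1 \<odot> (\<one> a2 \<odot> (\<one> a3 \<odot> as b1 b2 b3))) \<cdot>
      (as a1 a2 (a3 \<otimes> ((b1 \<otimes> b2) \<otimes> b3)) \<cdot> as (a1 \<otimes> a2) a3 ((b1 \<otimes> b2) \<otimes> b3)))))"
    by (simp add: swap_nat) (simp add: whisk comp_assoc)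
  also have "\<dots> = (\<one> a1 \<odot> (\<one> b1 \<odot> (\<one> a2 \<odot> swap a3 b2 b3))) \<cdot> ((\<one> a1 \<odot> swap a2 b1 (a3 \<otimes> (b2 \<otimes> b3))) \<cdot>
      ((\<one> a1 \<odot> (\<one> a2 \<odot> swap a3 b1 (b2 \<otimes> b3))) \<cdot> (as a1 a2 (a3 \<otimes> (b1 \<otimes> (b2 \<otimes> b3))) \<cdot> 
       (as (a1 \<otimes> a2) a3 (b1 \<otimes> (b2 \<otimes> b3)) \<cdot> (\<one> ((a1 \<otimes> a2) \<otimes> a3) \<odot> as b1 b2 b3)))))"
    by (simp add: assoc_whisk del: tens_id)
  finally have L: "?N \<cdot> ?L = \<dots>" .
  have split: "as a1 a2 a3 \<odot> as b1 b2 b3 =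
      (as a1 a2 a3 \<odot> \<one> (b1 \<otimes> (b2 \<otimes> b3))) \<cdot> (\<one> ((a1 \<otimes> a2) \<otimes> a3) \<odot> as b1 b2 b3)"
    by (simp add: tens_comp)
  have "?N \<cdot> ?R = (\<one> a1 \<odot> (\<one> b1 \<odot> as a2 b2 ?z)) \<cdot> ((\<one> a1 \<odot> (\<one> b1 \<odot> ich a2 a3 b2 b3)) \<cdot>
     (as a1 b1 ((a2 \<otimes> a3) \<otimes> (b2 \<otimes> b3)) \<cdot> (ich a1 (a2 \<otimes> a3) b1 (b2 \<otimes> b3) \<cdot> (as a1 a2 a3 \<odot> as b1 b2 b3))))"
    by (simp add: comp_assoc assoc_whisk)
  also have "\<dots> = (\<one> a1 \<odot> (\<one> b1 \<odot> (as a2 b2 ?z \<cdot> ich a2 a3 b2 b3))) \<cdot>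
     (as a1 b1 ((a2 \<otimes> a3) \<otimes> (b2 \<otimes> b3)) \<cdot> (ich a1 (a2 \<otimes> a3) b1 (b2 \<otimes> b3) \<cdot> (as a1 a2 a3 \<odot> as b1 b2 b3)))"
    by (simp add: comp_assoc whisk)
  also have "\<dots> = (\<one> a1 \<odot> (\<one> b1 \<odot> (\<one> a2 \<odot> swap a3 b2 b3))) \<cdot> ((\<one> a1 \<odot> ((\<one> b1 \<odot> as a2 a3 (b2 \<otimes> b3)) \<cdot> swap (a2 \<otimes> a3) b1 (b2 \<otimes> b3))) \<cdot>
     (as a1 (a2 \<otimes> a3) (b1 \<otimes> (b2 \<otimes> b3)) \<cdot> (as a1 a2 a3 \<odot> as b1 b2 b3)))"
    by (simp add: assoc_ich comp_reduce[OF assoc_ich]) (simp add: comp_assoc whisk)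
  also have "\<dots> = (\<one> a1 \<odot> (\<one> b1 \<odot> (\<one> a2 \<odot> swap a3 b2 b3))) \<cdot> ((\<one> a1 \<odot> swap a2 b1 (a3 \<otimes> (b2 \<otimes> b3))) \<cdot>
      ((\<one> a1 \<odot> (\<one> a2 \<odot> swap a3 b1 (b2 \<otimes> b3))) \<cdot> ((\<one> a1 \<odot> as a2 a3 (b1 \<otimes> (b2 \<otimes> b3))) \<cdot>
     (as a1 (a2 \<otimes> a3) (b1 \<otimes> (b2 \<otimes> b3)) \<cdot> ((as a1 a2 a3 \<odot> \<one> (b1 \<otimes> (b2 \<otimes> b3))) \<cdot> (\<one> ((a1 \<otimes> a2) \<otimes> a3) \<odot> as b1 b2 b3))))))"
    by (simp add: swap_tens_left split) (simp add: whisk comp_assoc)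
  also have "\<dots> = ?N \<cdot> ?L" unfolding L
    by (simp add: pentagon'')
  finally show "?N \<cdot> ?L = ?N \<cdot> ?R" by simp
qed auto

text \<open>Braidings with a tensor product, resolved into swaps: the first equation is the hexagon,
  the second follows from it by passing to inverses, which symmetry provides.\<close>

lemma swap_braid:
  assumes [simp]: "a \<in> Ob C" "b \<in> Ob C" "c \<in> Ob C"
  shows "as b c a \<cdot> br a (b \<otimes> c) = (\<one> b \<odot> br a c) \<cdot> swap a b c"
    and "br (a \<otimes> b) c = swap a c b \<cdot> ((\<one> a \<odot> br b c) \<cdot> as a b c)"
proof -
  have 1: "as b c a \<cdot> br a (b \<otimes> c) = (\<one> b \<odot> br a c) \<cdot> swap a b c" if [simp]: "a \<in> Ob C" "b \<in> Ob C" "c \<in> Ob C" for a b c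
    by (rule iso_epi[of "as a b c"]) (use hexagon[of a b c] in \<open>simp_all add: comp_assoc swap_assoc\<close>)
  then show "as b c a \<cdot> br a (b \<otimes> c) = (\<one> b \<odot> br a c) \<cdot> swap a b c" by simp
  show "br (a \<otimes> b) c = swap a c b \<cdot> ((\<one> a \<odot> br b c) \<cdot> as a b c)"
    by (rule iso_epi[of "br c (a \<otimes> b)"]) 
      (simp_all add: comp_assoc braid_braid 1 tens_comp' swap_sw)
qed

text \<open>Yields cocommutativity of tensor coalgebras. The braiding of the blocks is resolved by
  \<open>swap_braid\<close>; a swap of \<open>b\<close> and \<open>c\<close> that appears there
  cancels against the one inside the interchange.\<close>

lemma ich_braid:
  assumes [simp]: "a \<in> Ob C" "b \<in> Ob C" "c \<in> Ob C" "d \<in> Ob C"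
  shows "br (a \<otimes> b) (c \<otimes> d) \<cdot> ich a c b d = ich c a d b \<cdot> (br a c \<odot> br b d)"
proof (rule iso_mono[of "as c d (a \<otimes> b)"])
  have aux: "as c a (d \<otimes> b) \<cdot> ((\<one> (c \<otimes> a) \<odot> br b d) \<cdot> (br a c \<odot> \<one> (b \<otimes> d))) =
      (\<one> c \<odot> (\<one> a \<odot> br b d)) \<cdot> (as c a (b \<otimes> d) \<cdot> (br a c \<odot> \<one> (b \<otimes> d)))"
    by (simp add: assoc_whisk)
  have "as c d (a \<otimes> b) \<cdot> (br (a \<otimes> b) (c \<otimes> d) \<cdot> ich a c b d) =
      (\<one> c \<odot> br (a \<otimes> b) d) \<cdot> (swap (a \<otimes> b) c d \<cdot> ich a c b d)"
    by (simp add: comp_reduce[OF swap_braid(1)])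
  also have "\<dots> = (\<one> c \<odot> swap a d b) \<cdot> ((\<one> c \<odot> (\<one> a \<odot> br b d)) \<cdot> (((\<one> c \<odot> as a b d) \<cdot> swap (a \<otimes> b) c d) \<cdot> ich a c b d))"
    by (simp add: swap_braid(2) whisk comp_assoc)
  also have "\<dots> = (\<one> c \<odot> swap a d b) \<cdot> ((\<one> c \<odot> (\<one> a \<odot> br b d)) \<cdot> (swap a c (b \<otimes> d) \<cdot>
      ((\<one> a \<odot> swap b c d) \<cdot> (as a b (c \<otimes> d) \<cdot> ich a c b d))))"
    by (simp add: swap_tens_left comp_assoc)
  also have "\<dots> = (\<one> c \<odot> swap a d b) \<cdot> ((\<one> c \<odot> (\<one> a \<odot> br b d)) \<cdot> (swap a c (b \<otimes> d) \<cdot> as a c (b \<otimes> d)))"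
    by (simp add: assoc_ich tens_comp' swap_sw)
  also have "\<dots> = (\<one> c \<odot> swap a d b) \<cdot> (as c a (d \<otimes> b) \<cdot> (br a c \<odot> br b d))"
    by (simp add: swap_assoc tens_comp flip: aux)
  also have "\<dots> = as c d (a \<otimes> b) \<cdot> (ich c a d b \<cdot> (br a c \<odot> br b d))"
    by (simp add: comp_reduce[OF assoc_ich])
  finally show "as c d (a \<otimes> b) \<cdot> (br (a \<otimes> b) (c \<otimes> d) \<cdot> ich a c b d) =
      as c d (a \<otimes> b) \<cdot> (ich c a d b \<cdot> (br a c \<odot> br b d))" .
qed auto

text \<open>Needed for the left counit law of tensor coalgebras; \<open>ich_runit\<close> is the
  mirror image. The auxiliary fact says that removing \<open>I\<close> after moving it past
  \<open>a\<close> is the same as removing it where it stands, by \<open>lunit_braid\<close> and the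
  triangle.\<close>

lemma ich_lunit:
  assumes [simp]: "a \<in> Ob C" "b \<in> Ob C"
  shows "lu (a \<otimes> b) \<cdot> ((lu I \<odot> \<one> (a \<otimes> b)) \<cdot> ich I a I b) = lu a \<odot> lu b"
proof -
  have 1: "lu (a \<otimes> b) \<cdot> swap a I b = \<one> a \<odot> lu b"
  proof (rule iso_epi[of "as a I b"])
    have "(lu (a \<otimes> b) \<cdot> swap a I b) \<cdot> as a I b = (lu a \<odot> \<one> b) \<cdot> (br a I \<odot> \<one> b)"
      by (simp add: comp_assoc swap_assoc comp_reduce1[OF lunit_tens])
    also have "\<dots> = (lu a \<cdot> br a I) \<odot> \<one> b" by (simp add: whisk)
    also have "\<dots> = (\<one> a \<odot> lu b) \<cdot> as a I b" by (simp add: lunit_braid triangle)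
    finally show "(lu (a \<otimes> b) \<cdot> swap a I b) \<cdot> as a I b = (\<one> a \<odot> lu b) \<cdot> as a I b" .
  qed auto
  have "lu (a \<otimes> b) \<cdot> ((lu I \<odot> \<one> (a \<otimes> b)) \<cdot> ich I a I b) =
      lu (a \<otimes> b) \<cdot> ((\<one> I \<odot> lu (a \<otimes> b)) \<cdot> (as I I (a \<otimes> b) \<cdot> ich I a I b))"
    using triangle[of I "a \<otimes> b"] by (simp add: lunit_unit comp_reduce1)
  also have "\<dots> = lu (a \<otimes> b) \<cdot> ((\<one> I \<odot> (lu (a \<otimes> b) \<cdot> swap a I b)) \<cdot> as I a (I \<otimes> b))"
    by (simp add: assoc_ich whisk comp_assoc)
  also have "\<dots> = lu (a \<otimes> b) \<cdot> (as I a b \<cdot> (\<one> (I \<otimes> a) \<odot> lu b))"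
    by (simp add: 1 assoc_whisk)
  also have "\<dots> = lu a \<odot> lu b"
    by (simp add: comp_reduce1[OF lunit_tens] tens_comp)
  finally show ?thesis .
qed

lemma ich_runit:
  assumes [simp]: "a \<in> Ob C" "b \<in> Ob C"
  shows "ru (a \<otimes> b) \<cdot> ((\<one> (a \<otimes> b) \<odot> lu I) \<cdot> ich a I b I) = ru a \<odot> ru b"
proof -
  have 1: "(\<one> b \<odot> lu I) \<cdot> swap I b I = lu (b \<otimes> I)"
  proof (rule iso_epi[of "as I b I"])
    have "((\<one> b \<odot> lu I) \<cdot> swap I b I) \<cdot> as I b I = (ru b \<odot> \<one> I) \<cdot> (br I b \<odot> \<one> I)"
      by (simp add: comp_assoc swap_assoc comp_reduce1[OF triangle])
    also have "\<dots> = (ru b \<cdot> br I b) \<odot> \<one> I" by (simp add: whisk)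
    also have "\<dots> = lu (b \<otimes> I) \<cdot> as I b I" by (simp add: runit_braid lunit_tens)
    finally show "((\<one> b \<odot> lu I) \<cdot> swap I b I) \<cdot> as I b I = lu (b \<otimes> I) \<cdot> as I b I" .
  qed auto
  have "ru (a \<otimes> b) \<cdot> ((\<one> (a \<otimes> b) \<odot> lu I) \<cdot> ich a I b I) =
      (\<one> a \<odot> ru b) \<cdot> ((\<one> a \<odot> (\<one> b \<odot> lu I)) \<cdot> (as a b (I \<otimes> I) \<cdot> ich a I b I))"
    by (simp add: comp_assoc flip: runit_tens) (simp add: assoc_whisk)
  also have "\<dots> = (\<one> a \<odot> (ru b \<cdot> ((\<one> b \<odot> lu I) \<cdot> swap I b I))) \<cdot> as a I (b \<otimes> I)"
    by (simp add: assoc_ich whisk comp_assoc)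
  also have "\<dots> = (\<one> a \<odot> ru b) \<cdot> ((\<one> a \<odot> lu (b \<otimes> I)) \<cdot> as a I (b \<otimes> I))"
    by (simp add: 1 whisk comp_assoc)
  also have "\<dots> = ru a \<odot> ru b"
    by (simp add: triangle tens_comp)
  finally show ?thesis .
qed

text \<open>The only braiding inside this interchange is \<open>br I I\<close>, an identity by
  \<open>braid_unit\<close>. The case arises in \<open>pair_pr\<close>, where the two inner factors
  have been discarded.\<close>

lemma ich_unit_middle:
  assumes [simp]: "a \<in> Ob C" "b \<in> Ob C"
  shows "ich a I I b = \<one> ((a \<otimes> I) \<otimes> (I \<otimes> b))"
  by (simp add: interchange_def braid_unit comp_assoc)

section \<open>Cocommutative coalgebras as a cartesian category\<close>

lemma ich_nat_rev:
  assumes "f \<in> Arr C" "g \<in> Arr C" "h \<in> Arr C" "k \<in> Arr C" 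
   and "Dom C f = a" "Dom C g = b" "Dom C h = c" "Dom C k = d"
  shows "((f \<odot> h) \<odot> (g \<odot> k)) \<cdot> ich a b c d =
    ich (Cod C f) (Cod C g) (Cod C h) (Cod C k) \<cdot> ((f \<odot> g) \<odot> (h \<odot> k))"
  using ich_nat[OF assms(1-4) refl refl refl refl] assms(5-) by simp

definition coc_coalg :: "('o, 'a) coalg \<Rightarrow> bool" where
  "coc_coalg A \<longleftrightarrow> coalgebra C A \<and> cocommutative C A"

abbreviation "ch \<equiv> coalg_hom C"

lemma coc_coalg_simps [simp]:
  assumes "coc_coalg A"
  shows "coalgO A \<in> Ob C"
    "coalgComult A \<in> Arr C" "Dom C (coalgComult A) = coalgO A" "Cod C (coalgComult A) = coalgO A \<otimes> coalgO A"
    "coalgCounit A \<in> Arr C" "Dom C (coalgCounit A) = coalgO A" "Cod C (coalgCounit A) = I"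
  using assms by (auto simp: coc_coalg_def coalgebra_def Let_def hom_iff)

lemma coc_coalg_laws:
  assumes "coc_coalg A"
  shows comult_assoc: "as (coalgO A) (coalgO A) (coalgO A) \<cdot> ((coalgComult A \<odot> \<one> (coalgO A)) \<cdot> coalgComult A) =
      (\<one> (coalgO A) \<odot> coalgComult A) \<cdot> coalgComult A"
    and counit_left: "lu (coalgO A) \<cdot> ((coalgCounit A \<odot> \<one> (coalgO A)) \<cdot> coalgComult A) = \<one> (coalgO A)"
    and counit_right: "ru (coalgO A) \<cdot> ((\<one> (coalgO A) \<odot> coalgCounit A) \<cdot> coalgComult A) = \<one> (coalgO A)"
    and comult_comm: "br (coalgO A) (coalgO A) \<cdot> coalgComult A = coalgComult A"
proof -
  have co: "coalgebra C A" and br: "cocommutative C A" using assms by (auto simp: coc_coalg_def)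
  note eqs = co[unfolded coalgebra_def Let_def]
  note [simp] = coc_coalg_simps[OF assms]
  show "br (coalgO A) (coalgO A) \<cdot> coalgComult A = coalgComult A"
    using br by (simp only: cocommutative_def)
  show "as (coalgO A) (coalgO A) (coalgO A) \<cdot> ((coalgComult A \<odot> \<one> (coalgO A)) \<cdot> coalgComult A) =
      (\<one> (coalgO A) \<odot> coalgComult A) \<cdot> coalgComult A"
    by (rule trans[OF comp_assoc[symmetric]]) (use eqs in \<open>simp_all only:\<close>, simp_all)
  show "lu (coalgO A) \<cdot> ((coalgCounit A \<odot> \<one> (coalgO A)) \<cdot> coalgComult A) = \<one> (coalgO A)"
    by (rule trans[OF comp_assoc[symmetric]]) (use eqs in \<open>simp_all only:\<close>, simp_all)
  show "ru (coalgO A) \<cdot> ((\<one> (coalgO A) \<odot> coalgCounit A) \<cdot> coalgComult A) = \<one> (coalgO A)"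
    by (rule trans[OF comp_assoc[symmetric]]) (use eqs in \<open>simp_all only:\<close>, simp_all)
qed

lemma coc_coalgI:
  assumes "coalgO A \<in> Ob C" "coalgComult A \<in> hom C (coalgO A) (coalgO A \<otimes> coalgO A)"
    "coalgCounit A \<in> hom C (coalgO A) I"
    "as (coalgO A) (coalgO A) (coalgO A) \<cdot> ((coalgComult A \<odot> \<one> (coalgO A)) \<cdot> coalgComult A) =
      (\<one> (coalgO A) \<odot> coalgComult A) \<cdot> coalgComult A"
    "lu (coalgO A) \<cdot> ((coalgCounit A \<odot> \<one> (coalgO A)) \<cdot> coalgComult A) = \<one> (coalgO A)"
    "ru (coalgO A) \<cdot> ((\<one> (coalgO A) \<odot> coalgCounit A) \<cdot> coalgComult A) = \<one> (coalgO A)"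
    "br (coalgO A) (coalgO A) \<cdot> coalgComult A = coalgComult A"
  shows "coc_coalg A"
proof -
  have [simp]: "coalgO A \<in> Ob C"
    "coalgComult A \<in> Arr C" "Dom C (coalgComult A) = coalgO A" "Cod C (coalgComult A) = coalgO A \<otimes> coalgO A"
    "coalgCounit A \<in> Arr C" "Dom C (coalgCounit A) = coalgO A" "Cod C (coalgCounit A) = I"
    using assms(1-3) by (auto simp: hom_iff)
  have "as (coalgO A) (coalgO A) (coalgO A) \<cdot> (coalgComult A \<odot> \<one> (coalgO A)) \<cdot> coalgComult A =
      (\<one> (coalgO A) \<odot> coalgComult A) \<cdot> coalgComult A"
    by (rule trans[OF comp_assoc assms(4)]) simp_all
  moreover have "lu (coalgO A) \<cdot> (coalgCounit A \<odot> \<one> (coalgO A)) \<cdot> coalgComult A = \<one> (coalgO A)"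
    by (rule trans[OF comp_assoc assms(5)]) simp_all
  moreover have "ru (coalgO A) \<cdot> (\<one> (coalgO A) \<odot> coalgCounit A) \<cdot> coalgComult A = \<one> (coalgO A)"
    by (rule trans[OF comp_assoc assms(6)]) simp_all
  ultimately show ?thesis
    unfolding coc_coalg_def coalgebra_def cocommutative_def Let_def using assms(1-3,7) by blast
qed

lemma counit_counit:
  assumes [simp]: "coc_coalg A"
  shows "lu I \<cdot> ((coalgCounit A \<odot> coalgCounit A) \<cdot> coalgComult A) = coalgCounit A"
proof -
  have "lu I \<cdot> ((coalgCounit A \<odot> coalgCounit A) \<cdot> coalgComult A) =
      lu I \<cdot> ((\<one> I \<odot> coalgCounit A) \<cdot> ((coalgCounit A \<odot> \<one> (coalgO A)) \<cdot> coalgComult A))"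
    by (simp add: tens_comp')
  also have "\<dots> = coalgCounit A"
    by (simp add: comp_reduce[OF lunit_nat] counit_left)
  finally show ?thesis .
qed

text \<open>Cocommutativity makes the comultiplication a coalgebra morphism. Bracketed to the right,
  the iterated comultiplication has four copies of \<open>a\<close> as output, and the interchange
  acts on it as a swap of the two middle ones, which cocommutativity absorbs.\<close>

lemma comult_comult:
  assumes [simp]: "coc_coalg A"
  defines "a \<equiv> coalgO A" and "d \<equiv> coalgComult A"
  shows "ich a a a a \<cdot> ((d \<odot> d) \<cdot> d) = (d \<odot> d) \<cdot> d"
proof (rule iso_mono[of "as a a (a \<otimes> a)"])
  have [simp]: "a \<in> Ob C" "d \<in> Arr C" "Dom C d = a" "Cod C d = a \<otimes> a" by (simp_all add: a_def d_def)
  have ass: "as a a a \<cdot> ((d \<odot> \<one> a) \<cdot> d) = (\<one> a \<odot> d) \<cdot> d"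
    and comm: "br a a \<cdot> d = d"
    using comult_assoc[of A] comult_comm[of A] by (simp_all add: a_def d_def)
  \<comment> \<open>Coassociativity makes the two copies to be exchanged the output of a single
    \<open>d\<close>, where \<open>comm\<close> applies.\<close>
  have swap: "swap a a a \<cdot> ((\<one> a \<odot> d) \<cdot> d) = (\<one> a \<odot> d) \<cdot> d"
  proof -
    have "swap a a a \<cdot> ((\<one> a \<odot> d) \<cdot> d) = as a a a \<cdot> (((br a a \<cdot> d) \<odot> \<one> a) \<cdot> d)"
      by (simp add: comp_reduce[OF swap_assoc] whisk comp_assoc flip: ass)
    then show ?thesis by (simp add: comm ass)
  qed
  have norm: "as a a (a \<otimes> a) \<cdot> ((d \<odot> d) \<cdot> d) = (\<one> a \<odot> ((\<one> a \<odot> d) \<cdot> d)) \<cdot> d"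
  proof -
    have "as a a (a \<otimes> a) \<cdot> ((d \<odot> d) \<cdot> d) = as a a (a \<otimes> a) \<cdot> ((\<one> (a \<otimes> a) \<odot> d) \<cdot> ((d \<odot> \<one> a) \<cdot> d))"
      by (simp add: tens_comp')
    also have "\<dots> = (\<one> a \<odot> (\<one> a \<odot> d)) \<cdot> ((\<one> a \<odot> d) \<cdot> d)"
      by (simp add: assoc_whisk ass)
    finally show ?thesis by (simp add: whisk comp_assoc)
  qed
  have "as a a (a \<otimes> a) \<cdot> (ich a a a a \<cdot> ((d \<odot> d) \<cdot> d)) =
      (\<one> a \<odot> swap a a a) \<cdot> ((\<one> a \<odot> ((\<one> a \<odot> d) \<cdot> d)) \<cdot> d)"
    by (simp add: comp_reduce[OF assoc_ich] norm)
  also have "\<dots> = (\<one> a \<odot> (swap a a a \<cdot> ((\<one> a \<odot> d) \<cdot> d))) \<cdot> d"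
    by (simp add: whisk comp_assoc)
  also have "\<dots> = as a a (a \<otimes> a) \<cdot> ((d \<odot> d) \<cdot> d)"
    by (simp add: swap norm)
  finally show "as a a (a \<otimes> a) \<cdot> (ich a a a a \<cdot> ((d \<odot> d) \<cdot> d)) = as a a (a \<otimes> a) \<cdot> ((d \<odot> d) \<cdot> d)" .
qed (use assms in auto)

definition tensor_coalg :: "('o, 'a) coalg \<Rightarrow> ('o, 'a) coalg \<Rightarrow> ('o, 'a) coalg" where
  "tensor_coalg A B = \<lparr>coalgO = coalgO A \<otimes> coalgO B,
     coalgComult = ich (coalgO A) (coalgO A) (coalgO B) (coalgO B) \<cdot> (coalgComult A \<odot> coalgComult B),
     coalgCounit = lu I \<cdot> (coalgCounit A \<odot> coalgCounit B)\<rparr>"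

definition unit_coalg :: "('o, 'a) coalg" where
  "unit_coalg = \<lparr>coalgO = I, coalgComult = inv_arr C (lu I), coalgCounit = \<one> I\<rparr>"

lemma unit_coalg_sel [simp]: "coalgO unit_coalg = I" "coalgComult unit_coalg = inv_arr C (lu I)" "coalgCounit unit_coalg = \<one> I"
  by (simp_all add: unit_coalg_def)

lemma tensor_coalg_sel: "coalgO (tensor_coalg A B) = coalgO A \<otimes> coalgO B"
  "coalgComult (tensor_coalg A B) = ich (coalgO A) (coalgO A) (coalgO B) (coalgO B) \<cdot> (coalgComult A \<odot> coalgComult B)"
  "coalgCounit (tensor_coalg A B) = lu I \<cdot> (coalgCounit A \<odot> coalgCounit B)"
  by (simp_all add: tensor_coalg_def)

lemma tensor_coalg_obj [simp]: "coalgO (tensor_coalg A B) = coalgO A \<otimes> coalgO B"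
  by (simp add: tensor_coalg_def)

lemma coc_coalg_unit_coalg [simp]: "coc_coalg unit_coalg"
proof (rule coc_coalgI, simp_all add: hom_iff)
  show "as I I I \<cdot> ((inv_arr C (lu I) \<odot> \<one> I) \<cdot> inv_arr C (lu I)) = (\<one> I \<odot> inv_arr C (lu I)) \<cdot> inv_arr C (lu I)"
  proof (rule iso_mono[of "\<one> I \<odot> lu I"])
    show "(\<one> I \<odot> lu I) \<cdot> (as I I I \<cdot> ((inv_arr C (lu I) \<odot> \<one> I) \<cdot> inv_arr C (lu I))) =
      (\<one> I \<odot> lu I) \<cdot> ((\<one> I \<odot> inv_arr C (lu I)) \<cdot> inv_arr C (lu I))"
      by (simp add: comp_reduce1[OF triangle] tens_comp' flip: lunit_unit)
  qed auto
  show "ru I \<cdot> inv_arr C (lu I) = \<one> I" by (simp flip: lunit_unit)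
  show "br I I \<cdot> inv_arr C (lu I) = inv_arr C (lu I)" by (simp add: braid_unit)
qed

text \<open>Each law is the tensor product of the laws for \<open>A\<close> and \<open>B\<close>,
  once the interchange has been moved outside by \<open>ich_assoc\<close>, \<open>ich_lunit\<close>,
  \<open>ich_runit\<close> or \<open>ich_braid\<close>.\<close>

lemma coc_coalg_tensor_coalg [simp]:
  assumes [simp]: "coc_coalg A" "coc_coalg B"
  shows "coc_coalg (tensor_coalg A B)"
proof -
  define a b d d' e e' where defs: "a = coalgO A" "b = coalgO B" "d = coalgComult A" "d' = coalgComult B"
    "e = coalgCounit A" "e' = coalgCounit B"
  have [simp]: "a \<in> Ob C" "d \<in> Arr C" "Dom C d = a" "Cod C d = a \<otimes> a" "e \<in> Arr C" "Dom C e = a" "Cod C e = I"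
     "b \<in> Ob C" "d' \<in> Arr C" "Dom C d' = b" "Cod C d' = b \<otimes> b" "e' \<in> Arr C" "Dom C e' = b" "Cod C e' = I"
    by (simp_all add: defs)
  note laws = comult_assoc[OF assms(1)] comult_assoc[OF assms(2)] comult_comm[OF assms(1)] comult_comm[OF assms(2)]
    counit_left[OF assms(1)] counit_left[OF assms(2)] counit_right[OF assms(1)] counit_right[OF assms(2)]
  note laws = laws[folded defs]
  let ?D = "ich a a b b \<cdot> (d \<odot> d')" and ?E = "lu I \<cdot> (e \<odot> e')"
  have "as (a \<otimes> b) (a \<otimes> b) (a \<otimes> b) \<cdot> ((?D \<odot> \<one> (a \<otimes> b)) \<cdot> ?D) =
    as (a \<otimes> b) (a \<otimes> b) (a \<otimes> b) \<cdot> ((ich a a b b \<odot> \<one> (a \<otimes> b)) \<cdot> (((d \<odot> d') \<odot> (\<one> a \<odot> \<one> b)) \<cdot> (ich a a b b \<cdot> (d \<odot> d'))))"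
    by (simp add: whisk comp_assoc)
  also have "\<dots> = as (a \<otimes> b) (a \<otimes> b) (a \<otimes> b) \<cdot> ((ich a a b b \<odot> \<one> (a \<otimes> b)) \<cdot> (ich (a \<otimes> a) a (b \<otimes> b) b \<cdot>
      (((d \<odot> \<one> a) \<cdot> d) \<odot> ((d' \<odot> \<one> b) \<cdot> d'))))"
    by (simp add: comp_reduce[OF ich_nat_rev] tens_comp del: tens_id)
  also have "\<dots> = (\<one> (a \<otimes> b) \<odot> ich a a b b) \<cdot> (ich a (a \<otimes> a) b (b \<otimes> b) \<cdot>
       (((\<one> a \<odot> d) \<cdot> d) \<odot> ((\<one> b \<odot> d') \<cdot> d')))"
    using arg_cong[OF ich_assoc[of a a a b b b], of "\<lambda>t. t \<cdot> (((d \<odot> \<one> a) \<cdot> d) \<odot> ((d' \<odot> \<one> b) \<cdot> d'))"]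
    by (simp add: comp_assoc) (simp add: tens_comp laws)
  also have "\<dots> = (\<one> (a \<otimes> b) \<odot> ich a a b b) \<cdot> (((\<one> a \<odot> \<one> b) \<odot> (d \<odot> d')) \<cdot> (ich a a b b \<cdot> (d \<odot> d')))"
    by (simp add: comp_reduce[OF ich_nat_rev] tens_comp del: tens_id)
  also have "\<dots> = (\<one> (a \<otimes> b) \<odot> ?D) \<cdot> ?D"
    by (simp add: whisk comp_assoc)
  finally have ass: "as (a \<otimes> b) (a \<otimes> b) (a \<otimes> b) \<cdot> ((?D \<odot> \<one> (a \<otimes> b)) \<cdot> ?D) = (\<one> (a \<otimes> b) \<odot> ?D) \<cdot> ?D" .
  have "lu (a \<otimes> b) \<cdot> ((?E \<odot> \<one> (a \<otimes> b)) \<cdot> ?D) =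
      lu (a \<otimes> b) \<cdot> ((lu I \<odot> \<one> (a \<otimes> b)) \<cdot> (((e \<odot> e') \<odot> (\<one> a \<odot> \<one> b)) \<cdot> (ich a a b b \<cdot> (d \<odot> d'))))"
    by (simp add: whisk comp_assoc)
  also have "\<dots> = lu (a \<otimes> b) \<cdot> ((lu I \<odot> \<one> (a \<otimes> b)) \<cdot> (ich I a I b \<cdot> (((e \<odot> \<one> a) \<cdot> d) \<odot> ((e' \<odot> \<one> b) \<cdot> d'))))"
    by (simp add: comp_reduce[OF ich_nat_rev] tens_comp del: tens_id)
  also have "\<dots> = (lu a \<odot> lu b) \<cdot> (((e \<odot> \<one> a) \<cdot> d) \<odot> ((e' \<odot> \<one> b) \<cdot> d'))"
    by (simp add: comp_assoc flip: ich_lunit)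
  also have "\<dots> = \<one> (a \<otimes> b)"
    by (simp add: tens_comp laws)
  finally have cl: "lu (a \<otimes> b) \<cdot> ((?E \<odot> \<one> (a \<otimes> b)) \<cdot> ?D) = \<one> (a \<otimes> b)" .
  have "ru (a \<otimes> b) \<cdot> ((\<one> (a \<otimes> b) \<odot> ?E) \<cdot> ?D) =
      ru (a \<otimes> b) \<cdot> ((\<one> (a \<otimes> b) \<odot> lu I) \<cdot> (((\<one> a \<odot> \<one> b) \<odot> (e \<odot> e')) \<cdot> (ich a a b b \<cdot> (d \<odot> d'))))"
    by (simp add: whisk comp_assoc)
  also have "\<dots> = ru (a \<otimes> b) \<cdot> ((\<one> (a \<otimes> b) \<odot> lu I) \<cdot> (ich a I b I \<cdot> (((\<one> a \<odot> e) \<cdot> d) \<odot> ((\<one> b \<odot> e') \<cdot> d'))))"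
    by (simp add: comp_reduce[OF ich_nat_rev] tens_comp del: tens_id)
  also have "\<dots> = (ru a \<odot> ru b) \<cdot> (((\<one> a \<odot> e) \<cdot> d) \<odot> ((\<one> b \<odot> e') \<cdot> d'))"
    by (simp add: comp_assoc flip: ich_runit)
  also have "\<dots> = \<one> (a \<otimes> b)"
    by (simp add: tens_comp laws)
  finally have cr: "ru (a \<otimes> b) \<cdot> ((\<one> (a \<otimes> b) \<odot> ?E) \<cdot> ?D) = \<one> (a \<otimes> b)" .
  have comm: "br (a \<otimes> b) (a \<otimes> b) \<cdot> ?D = ?D"
    by (simp add: comp_reduce[OF ich_braid] tens_comp laws)
  show ?thesis
    by (rule coc_coalgI) (simp_all add: hom_iff tensor_coalg_sel ass cl cr comm flip: defs)
qed

lemma ch_simps [simp]: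
  assumes "ch A B f"
  shows "f \<in> Arr C" "Dom C f = coalgO A" "Cod C f = coalgO B"
  using assms by (auto simp: coalg_hom_def hom_iff)

lemma ch_comult: "ch A B f \<Longrightarrow> coalgComult B \<cdot> f = (f \<odot> f) \<cdot> coalgComult A"
  and ch_counit: "ch A B f \<Longrightarrow> coalgCounit B \<cdot> f = coalgCounit A"
  by (auto simp: coalg_hom_def)

lemma chI: "\<lbrakk>f \<in> hom C (coalgO A) (coalgO B); coalgComult B \<cdot> f = (f \<odot> f) \<cdot> coalgComult A;
    coalgCounit B \<cdot> f = coalgCounit A\<rbrakk> \<Longrightarrow> ch A B f"
  by (auto simp: coalg_hom_def)

lemma ch_id: "coc_coalg A \<Longrightarrow> ch A A (\<one> (coalgO A))"
  by (rule chI) (auto simp: hom_iff)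

lemma ch_comp:
  assumes [simp]: "coc_coalg T" "coc_coalg A" "coc_coalg B" and f: "ch T A f" and g: "ch A B g"
  shows "ch T B (g \<cdot> f)"
proof (rule chI)
  note [simp] = ch_simps[OF f] ch_simps[OF g]
  show "g \<cdot> f \<in> hom C (coalgO T) (coalgO B)" by (simp add: hom_iff)
  show "coalgComult B \<cdot> (g \<cdot> f) = ((g \<cdot> f) \<odot> (g \<cdot> f)) \<cdot> coalgComult T"
    by (simp add: comp_reduce[OF ch_comult[OF g]] ch_comult[OF f] tens_comp')
  show "coalgCounit B \<cdot> (g \<cdot> f) = coalgCounit T"
    by (simp add: comp_reduce1[OF ch_counit[OF g]] ch_counit[OF f])
qed

lemma ch_counit_arr:
  assumes [simp]: "coc_coalg A"
  shows "ch A unit_coalg (coalgCounit A)"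
proof (rule chI)
  show "coalgComult unit_coalg \<cdot> coalgCounit A = (coalgCounit A \<odot> coalgCounit A) \<cdot> coalgComult A"
    by (rule iso_mono[of "lu I"]) (simp_all add: counit_counit)
qed (simp_all add: hom_iff)

lemma ch_terminal: "ch A unit_coalg f \<Longrightarrow> f = coalgCounit A"
  using ch_counit[of A unit_coalg f] by simp

section \<open>The tensor product as the product of cocommutative coalgebras\<close>

definition pr1 where "pr1 A B = ru (coalgO A) \<cdot> (\<one> (coalgO A) \<odot> coalgCounit B)"
definition pr2 where "pr2 A B = lu (coalgO B) \<cdot> (coalgCounit A \<odot> \<one> (coalgO B))"
definition pair where "pair T f g = (f \<odot> g) \<cdot> coalgComult T"

lemma ch_pr1:
  assumes [simp]: "coc_coalg A" "coc_coalg B"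
  shows "ch (tensor_coalg A B) A (pr1 A B)"
proof -
  define a b d d' e e' where defs: "a = coalgO A" "b = coalgO B" "d = coalgComult A" "d' = coalgComult B"
    "e = coalgCounit A" "e' = coalgCounit B"
  have [simp]: "a \<in> Ob C" "d \<in> Arr C" "Dom C d = a" "Cod C d = a \<otimes> a" "e \<in> Arr C" "Dom C e = a" "Cod C e = I"
     "b \<in> Ob C" "d' \<in> Arr C" "Dom C d' = b" "Cod C d' = b \<otimes> b" "e' \<in> Arr C" "Dom C e' = b" "Cod C e' = I"
    by (simp_all add: defs)
  have ee: "lu I \<cdot> ((e' \<odot> e') \<cdot> d') = e'" using counit_counit[of B] by (simp add: defs)
  \<comment> \<open>This is \<open>ich_runit\<close> with the interchange brought to the other side,
    possible because it is inverted by another interchange (\<open>ich_ich\<close>).\<close>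
  have rr: "(ru a \<odot> ru a) \<cdot> ich a a I I = ru (a \<otimes> a) \<cdot> (\<one> (a \<otimes> a) \<odot> lu I)"
    by (simp add: comp_assoc ich_ich flip: ich_runit)
  let ?p = "ru a \<cdot> (\<one> a \<odot> e')"
  have "(?p \<odot> ?p) \<cdot> (ich a a b b \<cdot> (d \<odot> d')) =
      (ru a \<odot> ru a) \<cdot> (((\<one> a \<odot> e') \<odot> (\<one> a \<odot> e')) \<cdot> (ich a a b b \<cdot> (d \<odot> d')))"
    by (simp add: tens_comp')
  also have "\<dots> = (ru a \<odot> ru a) \<cdot> (ich a a I I \<cdot> (d \<odot> ((e' \<odot> e') \<cdot> d')))"
    by (simp add: comp_reduce[OF ich_nat_rev] tens_comp)
  also have "\<dots> = ru (a \<otimes> a) \<cdot> ((\<one> (a \<otimes> a) \<odot> lu I) \<cdot> (d \<odot> ((e' \<odot> e') \<cdot> d')))"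
    by (simp add: comp_reduce[OF rr])
  also have "\<dots> = ru (a \<otimes> a) \<cdot> ((d \<odot> \<one> I) \<cdot> (\<one> a \<odot> e'))"
    by (simp add: tens_comp ee)
  also have "\<dots> = d \<cdot> ?p" by (simp add: comp_reduce[OF runit_nat])
  finally have 1: "d \<cdot> ?p = (?p \<odot> ?p) \<cdot> (ich a a b b \<cdot> (d \<odot> d'))" by simp
  have "e \<cdot> ?p = ru I \<cdot> ((e \<odot> \<one> I) \<cdot> (\<one> a \<odot> e'))"
    by (simp add: comp_reduce[OF runit_nat])
  then have 2: "e \<cdot> ?p = lu I \<cdot> (e \<odot> e')" by (simp add: tens_comp lunit_unit)
  show ?thesis
    by (rule chI) (simp_all add: hom_iff tensor_coalg_sel pr1_def 1 2 flip: defs)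
qed

lemma ch_pr2:
  assumes [simp]: "coc_coalg A" "coc_coalg B"
  shows "ch (tensor_coalg A B) B (pr2 A B)"
proof -
  define a b d d' e e' where defs: "a = coalgO A" "b = coalgO B" "d = coalgComult A" "d' = coalgComult B"
    "e = coalgCounit A" "e' = coalgCounit B"
  have [simp]: "a \<in> Ob C" "d \<in> Arr C" "Dom C d = a" "Cod C d = a \<otimes> a" "e \<in> Arr C" "Dom C e = a" "Cod C e = I"
     "b \<in> Ob C" "d' \<in> Arr C" "Dom C d' = b" "Cod C d' = b \<otimes> b" "e' \<in> Arr C" "Dom C e' = b" "Cod C e' = I"
    by (simp_all add: defs)
  have ee: "lu I \<cdot> ((e \<odot> e) \<cdot> d) = e" using counit_counit[of A] by (simp add: defs)
  have rr: "(lu b \<odot> lu b) \<cdot> ich I I b b = lu (b \<otimes> b) \<cdot> (lu I \<odot> \<one> (b \<otimes> b))"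
    by (simp add: comp_assoc ich_ich flip: ich_lunit)
  let ?p = "lu b \<cdot> (e \<odot> \<one> b)"
  have "(?p \<odot> ?p) \<cdot> (ich a a b b \<cdot> (d \<odot> d')) =
      (lu b \<odot> lu b) \<cdot> (((e \<odot> \<one> b) \<odot> (e \<odot> \<one> b)) \<cdot> (ich a a b b \<cdot> (d \<odot> d')))"
    by (simp add: tens_comp')
  also have "\<dots> = (lu b \<odot> lu b) \<cdot> (ich I I b b \<cdot> (((e \<odot> e) \<cdot> d) \<odot> d'))"
    by (simp add: comp_reduce[OF ich_nat_rev] tens_comp)
  also have "\<dots> = lu (b \<otimes> b) \<cdot> ((lu I \<odot> \<one> (b \<otimes> b)) \<cdot> (((e \<odot> e) \<cdot> d) \<odot> d'))"
    by (simp add: comp_reduce[OF rr])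
  also have "\<dots> = lu (b \<otimes> b) \<cdot> ((\<one> I \<odot> d') \<cdot> (e \<odot> \<one> b))"
    by (simp add: tens_comp ee)
  also have "\<dots> = d' \<cdot> ?p" by (simp add: comp_reduce[OF lunit_nat])
  finally have 1: "d' \<cdot> ?p = (?p \<odot> ?p) \<cdot> (ich a a b b \<cdot> (d \<odot> d'))" by simp
  have "e' \<cdot> ?p = lu I \<cdot> ((\<one> I \<odot> e') \<cdot> (e \<odot> \<one> b))"
    by (simp add: comp_reduce[OF lunit_nat])
  then have 2: "e' \<cdot> ?p = lu I \<cdot> (e \<odot> e')" by (simp add: tens_comp)
  show ?thesis
    by (rule chI) (simp_all add: hom_iff tensor_coalg_sel pr2_def 1 2 flip: defs)
qed

text \<open>A pair is \<open>f \<odot> g\<close> after the comultiplication of \<open>T\<close>, and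
  \<open>comult_comult\<close> lets that comultiplication pass through the interchange. This is the
  point where cocommutativity of the test object is used.\<close>

lemma ch_pair:
  assumes [simp]: "coc_coalg T" "coc_coalg A" "coc_coalg B" and f: "ch T A f" and g: "ch T B g"
  shows "ch T (tensor_coalg A B) (pair T f g)"
proof (rule chI)
  note [simp] = ch_simps[OF f] ch_simps[OF g]
  show "pair T f g \<in> hom C (coalgO T) (coalgO (tensor_coalg A B))" by (simp add: pair_def hom_iff)
  have "coalgComult (tensor_coalg A B) \<cdot> pair T f g = ich (coalgO A) (coalgO A) (coalgO B) (coalgO B) \<cdot>
      (((f \<odot> f) \<odot> (g \<odot> g)) \<cdot> ((coalgComult T \<odot> coalgComult T) \<cdot> coalgComult T))"
    by (simp add: tensor_coalg_sel pair_def comp_assoc tens_comp' ch_comult[OF f] ch_comult[OF g])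
  also have "\<dots> = ((f \<odot> g) \<odot> (f \<odot> g)) \<cdot> ((coalgComult T \<odot> coalgComult T) \<cdot> coalgComult T)"
    by (simp add: comp_reduce[OF ich_nat] comult_comult)
  finally show "coalgComult (tensor_coalg A B) \<cdot> pair T f g = (pair T f g \<odot> pair T f g) \<cdot> coalgComult T"
    by (simp add: pair_def tens_comp')
  show "coalgCounit (tensor_coalg A B) \<cdot> pair T f g = coalgCounit T"
    by (simp add: tensor_coalg_sel pair_def comp_assoc tens_comp' ch_counit[OF f] ch_counit[OF g] counit_counit)
qed

lemma pr_pair:
  assumes [simp]: "coc_coalg T" "coc_coalg A" "coc_coalg B" and f: "ch T A f" and g: "ch T B g"
  shows "pr1 A B \<cdot> pair T f g = f" "pr2 A B \<cdot> pair T f g = g"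
proof -
  note [simp] = ch_simps[OF f] ch_simps[OF g]
  have "pr1 A B \<cdot> pair T f g = ru (coalgO A) \<cdot> ((f \<odot> \<one> I) \<cdot> ((\<one> (coalgO T) \<odot> coalgCounit T) \<cdot> coalgComult T))"
    by (simp add: pr1_def pair_def comp_assoc tens_comp' ch_counit[OF g])
  then show "pr1 A B \<cdot> pair T f g = f"
    by (simp add: comp_reduce[OF runit_nat] counit_right)
  have "pr2 A B \<cdot> pair T f g = lu (coalgO B) \<cdot> ((\<one> I \<odot> g) \<cdot> ((coalgCounit T \<odot> \<one> (coalgO T)) \<cdot> coalgComult T))"
    by (simp add: pr2_def pair_def comp_assoc tens_comp' ch_counit[OF f])
  then show "pr2 A B \<cdot> pair T f g = g"
    by (simp add: comp_reduce[OF lunit_nat] counit_left)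
qed

lemma pair_comp:
  assumes [simp]: "coc_coalg T" "coc_coalg T'" "coc_coalg A" "coc_coalg B" and f: "ch T A f" and g: "ch T B g" and t: "ch T' T t"
  shows "pair T f g \<cdot> t = pair T' (f \<cdot> t) (g \<cdot> t)"
proof -
  note [simp] = ch_simps[OF f] ch_simps[OF g] ch_simps[OF t]
  show ?thesis by (simp add: pair_def comp_assoc ch_comult[OF t] tens_comp')
qed

lemma tens_pair:
  assumes "coc_coalg T" "ch T A f" "ch T B g" "ch A A' h" "ch B B' k"
  shows "(h \<odot> k) \<cdot> pair T f g = pair T (h \<cdot> f) (k \<cdot> g)"
  using assms by (simp add: pair_def tens_comp')

lemma assoc_pair:
  assumes [simp]: "coc_coalg T" "coc_coalg A" "coc_coalg B" "coc_coalg D" and f: "ch T A f" and g: "ch T B g" and h: "ch T D h"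
  shows "as (coalgO A) (coalgO B) (coalgO D) \<cdot> pair T (pair T f g) h = pair T f (pair T g h)"
proof -
  note [simp] = ch_simps[OF f] ch_simps[OF g] ch_simps[OF h]
  let ?d = "coalgComult T" and ?t = "coalgO T"
  have "pair T (pair T f g) h = ((f \<odot> g) \<odot> h) \<cdot> ((?d \<odot> \<one> ?t) \<cdot> ?d)"
    by (simp add: pair_def tens_comp')
  then have "as (coalgO A) (coalgO B) (coalgO D) \<cdot> pair T (pair T f g) h =
      (f \<odot> (g \<odot> h)) \<cdot> ((\<one> ?t \<odot> ?d) \<cdot> ?d)"
    by (simp add: comp_reduce[OF assoc_nat] comult_assoc)
  also have "\<dots> = pair T f (pair T g h)"
    by (simp add: pair_def tens_comp')
  finally show ?thesis .
qed

text \<open>The uniqueness half of the product property: with \<open>pair_comp\<close> it shows in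
  \<open>pair_eta\<close> that a coalgebra morphism into the tensor product is determined by its
  projections. Each counit cancels one of the duplicated copies.\<close>

lemma pair_pr:
  assumes [simp]: "coc_coalg A" "coc_coalg B"
  shows "pair (tensor_coalg A B) (pr1 A B) (pr2 A B) = \<one> (coalgO A \<otimes> coalgO B)"
proof -
  define a b d d' e e' where defs: "a = coalgO A" "b = coalgO B" "d = coalgComult A" "d' = coalgComult B"
    "e = coalgCounit A" "e' = coalgCounit B"
  have [simp]: "a \<in> Ob C" "d \<in> Arr C" "Dom C d = a" "Cod C d = a \<otimes> a" "e \<in> Arr C" "Dom C e = a" "Cod C e = I"
     "b \<in> Ob C" "d' \<in> Arr C" "Dom C d' = b" "Cod C d' = b \<otimes> b" "e' \<in> Arr C" "Dom C e' = b" "Cod C e' = I"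
    by (simp_all add: defs)
  have "((ru a \<cdot> (\<one> a \<odot> e')) \<odot> (lu b \<cdot> (e \<odot> \<one> b))) \<cdot> (ich a a b b \<cdot> (d \<odot> d')) =
     (ru a \<odot> lu b) \<cdot> (((\<one> a \<odot> e') \<odot> (e \<odot> \<one> b)) \<cdot> (ich a a b b \<cdot> (d \<odot> d')))"
    by (simp add: tens_comp')
  also have "\<dots> = (ru a \<cdot> ((\<one> a \<odot> e) \<cdot> d)) \<odot> (lu b \<cdot> ((e' \<odot> \<one> b) \<cdot> d'))"
    by (simp add: comp_reduce[OF ich_nat_rev] tens_comp ich_unit_middle)
  also have "\<dots> = \<one> (a \<otimes> b)" using counit_right[of A] counit_left[of B] by (simp add: defs)
  finally show ?thesis by (simp add: pair_def pr1_def pr2_def tensor_coalg_sel flip: defs)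
qed

lemma pair_eta:
  assumes [simp]: "coc_coalg T" "coc_coalg A" "coc_coalg B" and h: "ch T (tensor_coalg A B) h"
  shows "pair T (pr1 A B \<cdot> h) (pr2 A B \<cdot> h) = h"
  using pair_comp[OF _ _ _ _ ch_pr1 ch_pr2 h] pair_pr[of A B] ch_simps[OF h] by simp

lemma pair_ext:
  assumes "coc_coalg T" "coc_coalg A" "coc_coalg B" "ch T (tensor_coalg A B) h" "ch T (tensor_coalg A B) k"
    "pr1 A B \<cdot> h = pr1 A B \<cdot> k" "pr2 A B \<cdot> h = pr2 A B \<cdot> k"
  shows "h = k"
  using pair_eta assms by metis

lemma ch_tens:
  assumes [simp]: "coc_coalg A" "coc_coalg B" "coc_coalg A'" "coc_coalg B'" and f: "ch A A' f" and g: "ch B B' g"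
  shows "f \<odot> g = pair (tensor_coalg A B) (f \<cdot> pr1 A B) (g \<cdot> pr2 A B)" "ch (tensor_coalg A B) (tensor_coalg A' B') (f \<odot> g)"
proof -
  note [simp] = ch_simps[OF f] ch_simps[OF g]
  show 1: "f \<odot> g = pair (tensor_coalg A B) (f \<cdot> pr1 A B) (g \<cdot> pr2 A B)"
    using tens_pair[OF _ ch_pr1[of A B] ch_pr2[of A B] f g] by (simp add: pair_pr)
  show "ch (tensor_coalg A B) (tensor_coalg A' B') (f \<odot> g)"
    unfolding 1 by (intro ch_pair ch_comp[OF _ _ _ _ f] ch_comp[OF _ _ _ _ g] ch_pr1 ch_pr2) auto
qed

section \<open>Cocommutative bialgebras as internal monoids\<close>

abbreviation "cb \<equiv> coc_bialgebra C"
abbreviation "bh \<equiv> bialg_hom C"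

text \<open>
  The coalgebra morphisms from \<open>T\<close> to a cocommutative bialgebra \<open>A\<close> are the generalized elements of an
  internal monoid; they form an ordinary monoid under \<open>mul A T\<close> with unit \<open>one A T\<close>.
\<close>

definition mul where "mul A T f g = mult A \<cdot> pair T f g"
definition one where "one A T = unit A \<cdot> coalgCounit T"

lemma coalg_of_sel [simp]: "coalgO (coalg_of A) = obj A" "coalgComult (coalg_of A) = comult A"
  "coalgCounit (coalg_of A) = counit A"
  by (simp_all add: coalg_of_def)

lemma alg_of_sel [simp]: "algO (alg_of A) = obj A" "algMult (alg_of A) = mult A"
  "algUnit (alg_of A) = unit A"
  by (simp_all add: alg_of_def)

lemma cb_cc [simp]: "cb A \<Longrightarrow> coc_coalg (coalg_of A)"
  by (simp add: coc_bialgebra_def bialgebra_def coc_coalg_def)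

text \<open>That \<open>comult\<close> and \<open>counit\<close> are algebra morphisms is, equation
  by equation, that \<open>mult\<close> and \<open>unit\<close> are coalgebra morphisms: tensor
  algebra and tensor coalgebra are built with the same interchange.\<close>

lemma cb_ch:
  assumes "cb A"
  shows ch_mult: "ch (tensor_coalg (coalg_of A) (coalg_of A)) (coalg_of A) (mult A)"
    and ch_unit: "ch unit_coalg (coalg_of A) (unit A)"
proof -
  note [simp] = coc_coalg_simps[OF cb_cc[OF assms], unfolded coalg_of_sel]
  have alg: "algebra C (alg_of A)"
    and dm: "alg_hom C (alg_of A) (tensor_alg C (alg_of A) (alg_of A)) (comult A)"
    and em: "alg_hom C (alg_of A) (unit_alg C) (counit A)"
    using assms by (auto simp: coc_bialgebra_def bialgebra_def)
  have [simp]: "mult A \<in> Arr C" "Dom C (mult A) = obj A \<otimes> obj A" "Cod C (mult A) = obj A"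
     "unit A \<in> Arr C" "Dom C (unit A) = I" "Cod C (unit A) = obj A"
    using alg by (auto simp: algebra_def Let_def hom_iff)
  show "ch (tensor_coalg (coalg_of A) (coalg_of A)) (coalg_of A) (mult A)"
    using dm em by (intro chI) (simp_all add: alg_hom_def tensor_alg_def unit_alg_def tensor_coalg_sel hom_iff comp_assoc)
  show "ch unit_coalg (coalg_of A) (unit A)"
    using dm em by (intro chI) (simp_all add: alg_hom_def tensor_alg_def unit_alg_def tensor_coalg_sel hom_iff comp_assoc)
qed

lemma cb_simps [simp]:
  assumes "cb A"
  shows "obj A \<in> Ob C" "mult A \<in> Arr C" "Dom C (mult A) = obj A \<otimes> obj A" "Cod C (mult A) = obj A"
     "unit A \<in> Arr C" "Dom C (unit A) = I" "Cod C (unit A) = obj A"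
     "comult A \<in> Arr C" "Dom C (comult A) = obj A" "Cod C (comult A) = obj A \<otimes> obj A"
     "counit A \<in> Arr C" "Dom C (counit A) = obj A" "Cod C (counit A) = I"
  using ch_simps[OF ch_mult[OF assms]] ch_simps[OF ch_unit[OF assms]] coc_coalg_simps[OF cb_cc[OF assms]] by simp_all

lemma cb_alg_laws:
  assumes [simp]: "cb A"
  shows "mult A \<cdot> (mult A \<odot> \<one> (obj A)) = mult A \<cdot> ((\<one> (obj A) \<odot> mult A) \<cdot> as (obj A) (obj A) (obj A))"
    "mult A \<cdot> (unit A \<odot> \<one> (obj A)) = lu (obj A)"
    "mult A \<cdot> (\<one> (obj A) \<odot> unit A) = ru (obj A)"
proof -
  have "algebra C (alg_of A)"
    using assms by (auto simp: coc_bialgebra_def bialgebra_def)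
  note eqs = this[unfolded algebra_def Let_def alg_of_sel]
  have "mult A \<cdot> (mult A \<odot> \<one> (obj A)) = mult A \<cdot> (\<one> (obj A) \<odot> mult A) \<cdot> as (obj A) (obj A) (obj A)"
    using eqs by blast
  also have "\<dots> = mult A \<cdot> ((\<one> (obj A) \<odot> mult A) \<cdot> as (obj A) (obj A) (obj A))"
    by (rule comp_assoc) simp_all
  finally show "mult A \<cdot> (mult A \<odot> \<one> (obj A)) = mult A \<cdot> ((\<one> (obj A) \<odot> mult A) \<cdot> as (obj A) (obj A) (obj A))" .
qed (use assms[unfolded coc_bialgebra_def bialgebra_def algebra_def Let_def alg_of_sel] in blast)+

lemma ch_mul:
  assumes "cb A" "coc_coalg T" "ch T (coalg_of A) f" "ch T (coalg_of A) g"
  shows "ch T (coalg_of A) (mul A T f g)"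
  unfolding mul_def using assms by (intro ch_comp[OF _ _ _ ch_pair ch_mult]) auto

lemma ch_one:
  assumes "cb A" "coc_coalg T"
  shows "ch T (coalg_of A) (one A T)"
  unfolding one_def using assms by (intro ch_comp[OF _ _ _ ch_counit_arr ch_unit]) auto

lemma mul_comp:
  assumes "cb A" "coc_coalg T" "coc_coalg T'" "ch T (coalg_of A) f" "ch T (coalg_of A) g" "ch T' T t"
  shows "mul A T f g \<cdot> t = mul A T' (f \<cdot> t) (g \<cdot> t)"
  using pair_comp[of T T' "coalg_of A" "coalg_of A" f g t] ch_simps[OF ch_pair[of T "coalg_of A" "coalg_of A" f g]] assms
  by (simp add: mul_def comp_assoc)

lemma one_comp:
  assumes "cb A" "coc_coalg T" "coc_coalg T'" "ch T' T t"
  shows "one A T \<cdot> t = one A T'"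
  using assms ch_counit[of T' T t] by (simp add: one_def comp_assoc)

lemma mul_assoc:
  assumes [simp]: "cb A" "coc_coalg T" and f: "ch T (coalg_of A) f" and g: "ch T (coalg_of A) g"
    and h: "ch T (coalg_of A) h"
  shows "mul A T (mul A T f g) h = mul A T f (mul A T g h)"
proof -
  let ?A = "coalg_of A" and ?a = "obj A"
  have id: "ch ?A ?A (\<one> ?a)" using ch_id[of ?A] by simp
  have fg: "ch T (tensor_coalg ?A ?A) (pair T f g)" and gh: "ch T (tensor_coalg ?A ?A) (pair T g h)" by (simp_all add: ch_pair f g h)
  note [simp] = ch_simps[OF f] ch_simps[OF g] ch_simps[OF h]
    ch_simps[OF ch_pair[OF _ _ _ fg h]] ch_simps[OF ch_pair[OF _ _ _ f gh]]
  have "mul A T (mul A T f g) h = mult A \<cdot> ((mult A \<odot> \<one> ?a) \<cdot> pair T (pair T f g) h)"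
    using tens_pair[OF _ fg h ch_mult id] by (simp add: mul_def)
  also have "\<dots> = mult A \<cdot> ((\<one> ?a \<odot> mult A) \<cdot> (as ?a ?a ?a \<cdot> pair T (pair T f g) h))"
    by (simp add: comp_reduce[OF cb_alg_laws(1)] comp_assoc)
  also have "\<dots> = mult A \<cdot> ((\<one> ?a \<odot> mult A) \<cdot> pair T f (pair T g h))"
    using assoc_pair[of T ?A ?A ?A f g h] f g h by simp
  also have "\<dots> = mul A T f (mul A T g h)"
    using tens_pair[OF _ f gh id ch_mult] by (simp add: mul_def)
  finally show ?thesis .
qed

lemma pr_unit: "coc_coalg A \<Longrightarrow> pr2 unit_coalg A = lu (coalgO A)" "coc_coalg A \<Longrightarrow> pr1 A unit_coalg = ru (coalgO A)"
  by (simp_all add: pr1_def pr2_def)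

lemma mul_one:
  assumes [simp]: "cb A" "coc_coalg T" and f: "ch T (coalg_of A) f"
  shows "mul A T (one A T) f = f" "mul A T f (one A T) = f"
proof -
  let ?A = "coalg_of A" and ?a = "obj A"
  have id: "ch ?A ?A (\<one> ?a)" using ch_id[of ?A] by simp
  have e: "ch T unit_coalg (coalgCounit T)" by (simp add: ch_counit_arr)
  note [simp] = ch_simps[OF f] ch_simps[OF ch_pair[OF _ _ _ f e]] ch_simps[OF ch_pair[OF _ _ _ e f]]
  have "mul A T (one A T) f = mult A \<cdot> ((unit A \<odot> \<one> ?a) \<cdot> pair T (coalgCounit T) f)"
    using tens_pair[OF _ e f ch_unit id] by (simp add: mul_def one_def)
  then show "mul A T (one A T) f = f"
    using pr_pair(2)[OF _ _ _ e f] by (simp add: comp_reduce1[OF cb_alg_laws(2)] pr_unit)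
  have "mul A T f (one A T) = mult A \<cdot> ((\<one> ?a \<odot> unit A) \<cdot> pair T f (coalgCounit T))"
    using tens_pair[OF _ f e id ch_unit] by (simp add: mul_def one_def)
  then show "mul A T f (one A T) = f"
    using pr_pair(1)[OF _ _ _ f e] by (simp add: comp_reduce1[OF cb_alg_laws(3)] pr_unit)
qed

text \<open>A Yoneda argument: laws that hold for generalized elements are evaluated at the generic
  ones, the projections of a tensor product, where \<open>pair_pr\<close> turns pairs into
  identities. Bialgebra structures given by formulas on elements can thus be checked without
  coherence computations.\<close>

lemma cb_of_elements:
  assumes coc_coalg [simp]: "coc_coalg (coalg_of A)" and m: "ch (tensor_coalg (coalg_of A) (coalg_of A)) (coalg_of A) (mult A)"
    and u: "ch unit_coalg (coalg_of A) (unit A)"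
    and ass: "\<And>T f g h. \<lbrakk>coc_coalg T; ch T (coalg_of A) f; ch T (coalg_of A) g; ch T (coalg_of A) h\<rbrakk> \<Longrightarrow>
      mul A T (mul A T f g) h = mul A T f (mul A T g h)"
    and one1: "\<And>T f. \<lbrakk>coc_coalg T; ch T (coalg_of A) f\<rbrakk> \<Longrightarrow> mul A T (one A T) f = f"
    and one2: "\<And>T f. \<lbrakk>coc_coalg T; ch T (coalg_of A) f\<rbrakk> \<Longrightarrow> mul A T f (one A T) = f"
  shows "cb A"
proof -
  let ?A = "coalg_of A" and ?a = "obj A"
  have id: "ch ?A ?A (\<one> ?a)" using ch_id[of ?A] by simp
  note [simp] = ch_simps[OF m, simplified] ch_simps[OF u, simplified] coc_coalg_simps[OF coc_coalg, simplified]
  have M: "mult A \<cdot> (mult A \<odot> \<one> ?a) = mult A \<cdot> (\<one> ?a \<odot> mult A) \<cdot> as ?a ?a ?a"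
  proof -
    let ?T = "tensor_coalg (tensor_coalg ?A ?A) ?A"
    \<comment> \<open>The generic triple of elements; by \<open>fgh\<close> its left-bracketed
      pairing is the identity of the threefold tensor product, so the right-bracketed one is the
      associator.\<close>
    let ?f = "pr1 ?A ?A \<cdot> pr1 (tensor_coalg ?A ?A) ?A" and ?g = "pr2 ?A ?A \<cdot> pr1 (tensor_coalg ?A ?A) ?A" and ?h = "pr2 (tensor_coalg ?A ?A) ?A"
    have f: "ch ?T ?A ?f" and g: "ch ?T ?A ?g" by (rule ch_comp[OF _ _ _ ch_pr1]; simp add: ch_pr1 ch_pr2)+
    have h: "ch ?T ?A ?h" by (simp add: ch_pr2)
    have fg: "pair ?T ?f ?g = pr1 (tensor_coalg ?A ?A) ?A" by (rule pair_eta) (simp_all add: ch_pr1)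
    have fgc: "ch ?T (tensor_coalg ?A ?A) (pair ?T ?f ?g)" and ghc: "ch ?T (tensor_coalg ?A ?A) (pair ?T ?g ?h)" 
      by (simp_all add: ch_pair f g h)
    have fgh: "pair ?T (pair ?T ?f ?g) ?h = \<one> ((?a \<otimes> ?a) \<otimes> ?a)" unfolding fg by (simp add: pair_pr)
    note [simp] = ch_simps[OF ch_pair[OF _ _ _ f ghc]]
    have 1: "mul A ?T (mul A ?T ?f ?g) ?h = mult A \<cdot> (mult A \<odot> \<one> ?a)"
      using tens_pair[OF _ fgc h m id] ch_simps[OF h] by (simp add: mul_def fgh)
    have "mul A ?T ?f (mul A ?T ?g ?h) = mult A \<cdot> ((\<one> ?a \<odot> mult A) \<cdot> pair ?T ?f (pair ?T ?g ?h))"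
      using tens_pair[OF _ f ghc id m] ch_simps[OF f] by (simp add: mul_def)
    also have "pair ?T ?f (pair ?T ?g ?h) = as ?a ?a ?a"
      using assoc_pair[OF _ _ _ _ f g h] by (simp add: fgh)
    finally have "mul A ?T ?f (mul A ?T ?g ?h) = mult A \<cdot> (\<one> ?a \<odot> mult A) \<cdot> as ?a ?a ?a"
      by (simp add: comp_assoc)
    then show ?thesis using ass[OF _ f g h] 1 by simp
  qed
  have U1: "mult A \<cdot> (unit A \<odot> \<one> ?a) = lu ?a"
  proof -
    let ?T = "tensor_coalg unit_coalg ?A"
    have f: "ch ?T unit_coalg (pr1 unit_coalg ?A)" and g: "ch ?T ?A (pr2 unit_coalg ?A)" by (simp_all add: ch_pr1 ch_pr2)
    have "mul A ?T (one A ?T) (pr2 unit_coalg ?A) = mult A \<cdot> ((unit A \<odot> \<one> ?a) \<cdot> pair ?T (pr1 unit_coalg ?A) (pr2 unit_coalg ?A))"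
      using tens_pair[OF _ f g u id] ch_simps[OF g] by (simp add: mul_def one_def ch_terminal[OF f])
    also have "\<dots> = mult A \<cdot> (unit A \<odot> \<one> ?a)" by (simp add: pair_pr)
    finally show ?thesis using one1[OF _ g] by (simp add: pr_unit)
  qed
  have U2: "mult A \<cdot> (\<one> ?a \<odot> unit A) = ru ?a"
  proof -
    let ?T = "tensor_coalg ?A unit_coalg"
    have f: "ch ?T ?A (pr1 ?A unit_coalg)" and g: "ch ?T unit_coalg (pr2 ?A unit_coalg)" by (simp_all add: ch_pr1 ch_pr2)
    have "mul A ?T (pr1 ?A unit_coalg) (one A ?T) = mult A \<cdot> ((\<one> ?a \<odot> unit A) \<cdot> pair ?T (pr1 ?A unit_coalg) (pr2 ?A unit_coalg))"
      using tens_pair[OF _ f g id u] ch_simps[OF f] by (simp add: mul_def one_def ch_terminal[OF g])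
    also have "\<dots> = mult A \<cdot> (\<one> ?a \<odot> unit A)" by (simp add: pair_pr)
    finally show ?thesis using one2[OF _ f] by (simp add: pr_unit)
  qed
  have 1: "algebra C (alg_of A)"
    by (simp add: algebra_def Let_def hom_iff M U1 U2)
  have 2: "alg_hom C (alg_of A) (tensor_alg C (alg_of A) (alg_of A)) (comult A)"
    using ch_comult[OF m] ch_comult[OF u]
    by (simp add: alg_hom_def tensor_alg_def tensor_coalg_sel hom_iff comp_assoc)
  have 3: "alg_hom C (alg_of A) (unit_alg C) (counit A)"
    using ch_counit[OF m] ch_counit[OF u] by (simp add: alg_hom_def unit_alg_def tensor_coalg_sel hom_iff)
  show ?thesis using 1 2 3 coc_coalg by (simp add: coc_bialgebra_def bialgebra_def coc_coalg_def)
qed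

lemma mult_elements:
  assumes [simp]: "cb A"
  defines "A' \<equiv> coalg_of A"
  shows "mul A (tensor_coalg A' A') (pr1 A' A') (pr2 A' A') = mult A" "one A unit_coalg = unit A"
  by (simp_all add: mul_def one_def pair_pr A'_def)

lemma bh_ch: "bh A B f \<Longrightarrow> ch (coalg_of A) (coalg_of B) f"
  by (simp add: bialg_hom_def)

lemma bh_mul:
  assumes [simp]: "cb A" "cb B" "coc_coalg T" and f: "bh A B f"
    and x: "ch T (coalg_of A) x" and y: "ch T (coalg_of A) y"
  shows "f \<cdot> mul A T x y = mul B T (f \<cdot> x) (f \<cdot> y)"
proof -
  note fc = bh_ch[OF f]
  note [simp] = ch_simps[OF fc] ch_simps[OF x] ch_simps[OF y] ch_simps[OF ch_pair[OF _ _ _ x y]]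
  have e: "f \<cdot> mult A = mult B \<cdot> (f \<odot> f)" using f by (simp add: bialg_hom_def alg_hom_def)
  show ?thesis using tens_pair[OF _ x y fc fc] by (simp add: mul_def comp_reduce[OF e])
qed

lemma bh_one:
  assumes [simp]: "cb A" "cb B" "coc_coalg T" and f: "bh A B f"
  shows "f \<cdot> one A T = one B T"
proof -
  note [simp] = ch_simps[OF bh_ch[OF f]]
  have e: "f \<cdot> unit A = unit B" using f by (simp add: bialg_hom_def alg_hom_def)
  show ?thesis by (simp add: one_def comp_reduce1[OF e])
qed

text \<open>Multiplicativity on the generic pair \<open>pr1\<close>, \<open>pr2\<close> is the
  equation for \<open>mult\<close> itself, since \<open>f \<odot> f\<close> is the pairing of
  \<open>f\<close> composed with the two projections.\<close>

lemma bhI: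
  assumes [simp]: "cb A" "cb B" and f: "ch (coalg_of A) (coalg_of B) f"
    and mul: "\<And>T x y. \<lbrakk>coc_coalg T; ch T (coalg_of A) x; ch T (coalg_of A) y\<rbrakk> \<Longrightarrow>
      f \<cdot> mul A T x y = mul B T (f \<cdot> x) (f \<cdot> y)"
    and one: "f \<cdot> unit A = unit B"
  shows "bh A B f"
proof -
  let ?A = "coalg_of A"
  have "f \<cdot> mult A = mul B (tensor_coalg ?A ?A) (f \<cdot> pr1 ?A ?A) (f \<cdot> pr2 ?A ?A)"
    using mul[of "tensor_coalg ?A ?A" "pr1 ?A ?A" "pr2 ?A ?A"] mult_elements(1)[of A] by (simp add: ch_pr1 ch_pr2)
  also have "\<dots> = mult B \<cdot> (f \<odot> f)"
    using ch_tens(1)[OF _ _ _ _ f f] by (simp add: mul_def)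
  finally show ?thesis using one f ch_simps[OF f]
    by (simp add: bialg_hom_def alg_hom_def hom_iff)
qed

lemma bh_comp:
  assumes [simp]: "cb A" "cb B" "cb D" and f: "bh A B f" and g: "bh B D g"
  shows "bh A D (g \<cdot> f)"
proof (rule bhI)
  note [simp] = ch_simps[OF bh_ch[OF f]] ch_simps[OF bh_ch[OF g]]
  show "ch (coalg_of A) (coalg_of D) (g \<cdot> f)"
    by (rule ch_comp[OF _ _ _ bh_ch[OF f] bh_ch[OF g]]) simp_all
  show "g \<cdot> f \<cdot> mul A T x y = mul D T (g \<cdot> f \<cdot> x) (g \<cdot> f \<cdot> y)"
    if [simp]: "coc_coalg T" and x: "ch T (coalg_of A) x" and y: "ch T (coalg_of A) y" for T x y
    using bh_mul[OF _ _ _ f x y] bh_mul[OF _ _ _ g, of T "f \<cdot> x" "f \<cdot> y"]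
      ch_comp[OF _ _ _ x bh_ch[OF f]] ch_comp[OF _ _ _ y bh_ch[OF f]] ch_simps[OF ch_mul[OF _ _ x y]]
      ch_simps[OF x] ch_simps[OF y]
    by (simp add: comp_assoc)
  have e: "f \<cdot> unit A = unit B" "g \<cdot> unit B = unit D" 
    using f g by (simp_all add: bialg_hom_def alg_hom_def)
  show "g \<cdot> f \<cdot> unit A = unit D" by (simp add: comp_assoc e)
qed simp_all

lemma bh_id: "cb A \<Longrightarrow> bh A A (\<one> (obj A))"
proof (rule bhI)
  show "\<one> (obj A) \<cdot> mul A T x y = mul A T (\<one> (obj A) \<cdot> x) (\<one> (obj A) \<cdot> y)"
    if "cb A" "coc_coalg T" "ch T (coalg_of A) x" "ch T (coalg_of A) y" for T x y
    using that ch_simps[OF ch_mul[OF that]] ch_simps[OF that(3)] ch_simps[OF that(4)] by simp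
qed (use ch_id[of "coalg_of A"] in simp_all)

lemma bh_zero:
  assumes [simp]: "cb A" "cb B"
  shows "bh A B (one B (coalg_of A))"
proof (rule bhI)
  show "ch (coalg_of A) (coalg_of B) (one B (coalg_of A))" by (simp add: ch_one)
  show "one B (coalg_of A) \<cdot> mul A T x y = mul B T (one B (coalg_of A) \<cdot> x) (one B (coalg_of A) \<cdot> y)"
    if "coc_coalg T" "ch T (coalg_of A) x" "ch T (coalg_of A) y" for T x y
    using that by (simp add: one_comp ch_mul mul_one ch_one)
  show "one B (coalg_of A) \<cdot> unit A = unit B"
    using one_comp[OF _ _ _ ch_unit[of A], of B] by (simp add: mult_elements(2))
qed simp_all

text \<open>Cancellation is demanded for coalgebra morphisms from every cocommutative coalgebra
  \<open>T\<close>, not just for bialgebra morphisms, because products \<open>mul\<close> of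
  elements and the retractions studied later are in general only coalgebra morphisms.\<close>

definition jointly_monic :: "('o, 'a) bialg \<Rightarrow> 'i set \<Rightarrow> ('i \<Rightarrow> ('o, 'a) bialg) \<Rightarrow> ('i \<Rightarrow> 'a) \<Rightarrow> bool" where
  "jointly_monic A J B p \<longleftrightarrow> cb A \<and> (\<forall>j\<in>J. cb (B j) \<and> bh A (B j) (p j)) \<and>
    (\<forall>T x y. coc_coalg T \<longrightarrow> ch T (coalg_of A) x \<longrightarrow> ch T (coalg_of A) y \<longrightarrow>
      (\<forall>j\<in>J. p j \<cdot> x = p j \<cdot> y) \<longrightarrow> x = y)"

lemma jointly_monicD:
  assumes "jointly_monic A J B p"
  shows "cb A" "j \<in> J \<Longrightarrow> cb (B j)" "j \<in> J \<Longrightarrow> bh A (B j) (p j)"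
    "\<lbrakk>coc_coalg T; ch T (coalg_of A) x; ch T (coalg_of A) y; \<And>j. j \<in> J \<Longrightarrow> p j \<cdot> x = p j \<cdot> y\<rbrakk> \<Longrightarrow> x = y"
  using assms unfolding jointly_monic_def by blast+

lemma comp_ch_assoc:
  assumes "ch T A x" "ch A B f" "ch B D g"
  shows "g \<cdot> f \<cdot> x = g \<cdot> (f \<cdot> x)"
  using assms by (intro comp_assoc) (auto dest: ch_simps)

text \<open>Both sides of the multiplication law for \<open>t\<close> are coalgebra morphisms into
  \<open>A\<close> whose composites with every \<open>p j\<close> agree, and the family cannot
  separate such arrows. The same argument on \<open>unit_coalg\<close> gives the unit law.\<close>

lemma jointly_monic_reflects_bh:
  assumes jm: "jointly_monic A J B p" and [simp]: "cb T" and t: "ch (coalg_of T) (coalg_of A) t"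
    and point: "\<And>j. j \<in> J \<Longrightarrow> bh T (B j) (p j \<cdot> t)"
  shows "bh T A t"
proof (rule bhI)
  note [simp] = jointly_monicD(1)[OF jm] jointly_monicD(2)[OF jm]
  note pb = jointly_monicD(3)[OF jm] 
  note pc = bh_ch[OF pb]
  show "t \<cdot> mul T S x y = mul A S (t \<cdot> x) (t \<cdot> y)"
    if [simp]: "coc_coalg S" and x: "ch S (coalg_of T) x" and y: "ch S (coalg_of T) y" for S x y
  proof (rule jointly_monicD(4)[OF jm])
    have tx: "ch S (coalg_of A) (t \<cdot> x)" and ty: "ch S (coalg_of A) (t \<cdot> y)"
      by (rule ch_comp[OF _ _ _ x t]; simp) (rule ch_comp[OF _ _ _ y t]; simp)
    have xy: "ch S (coalg_of T) (mul T S x y)" by (simp add: ch_mul x y)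
    show "ch S (coalg_of A) (t \<cdot> mul T S x y)" by (rule ch_comp[OF _ _ _ xy t]) simp_all
    show "ch S (coalg_of A) (mul A S (t \<cdot> x) (t \<cdot> y))" by (simp add: ch_mul tx ty)
    show "p j \<cdot> (t \<cdot> mul T S x y) = p j \<cdot> mul A S (t \<cdot> x) (t \<cdot> y)" if j: "j \<in> J" for j
      using bh_mul[OF _ _ _ point[OF j] x y] bh_mul[OF _ _ _ pb[OF j] tx ty] j
      by (simp add: comp_ch_assoc[OF x t pc] comp_ch_assoc[OF y t pc] comp_ch_assoc[OF xy t pc])
  qed simp
  show "t \<cdot> unit T = unit A"
  proof (rule jointly_monicD(4)[OF jm])
    show "ch unit_coalg (coalg_of A) (t \<cdot> unit T)" by (rule ch_comp[OF _ _ _ ch_unit t]) simp_all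
    show "ch unit_coalg (coalg_of A) (unit A)" by (simp add: ch_unit)
    show "p j \<cdot> (t \<cdot> unit T) = p j \<cdot> unit A" if j: "j \<in> J" for j
      using point[OF j] pb[OF j] comp_ch_assoc[OF ch_unit t pc[OF j]] 
      by (simp add: bialg_hom_def alg_hom_def)
  qed simp
qed (use t jointly_monicD[OF jm] in simp_all)

text \<open>The multiplication is written on the generic pair of elements of \<open>P\<close>,
  component by component, instead of with the interchange; the monoid laws then reduce to those of
  \<open>A\<close> and \<open>B\<close> by \<open>cb_of_elements\<close> and
  \<open>pair_ext\<close>.\<close>

definition prod_bialg :: "('o, 'a) bialg \<Rightarrow> ('o, 'a) bialg \<Rightarrow> ('o, 'a) bialg" where
  "prod_bialg A B = (let A' = coalg_of A; B' = coalg_of B; P = tensor_coalg A' B'; Q = tensor_coalg P P in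
    \<lparr>obj = obj A \<otimes> obj B,
     mult = pair Q (mul A Q (pr1 A' B' \<cdot> pr1 P P) (pr1 A' B' \<cdot> pr2 P P))
       (mul B Q (pr2 A' B' \<cdot> pr1 P P) (pr2 A' B' \<cdot> pr2 P P)),
     unit = pair unit_coalg (unit A) (unit B), comult = coalgComult P, counit = coalgCounit P\<rparr>)"

lemma coalg_of_prod_bialg [simp]: "coalg_of (prod_bialg A B) = tensor_coalg (coalg_of A) (coalg_of B)"
  by (simp add: prod_bialg_def Let_def coalg_of_def tensor_coalg_def)

lemma prod_bialg_mul:
  assumes [simp]: "cb A" "cb B" "coc_coalg T" and f: "ch T (tensor_coalg (coalg_of A) (coalg_of B)) f"
    and g: "ch T (tensor_coalg (coalg_of A) (coalg_of B)) g"
  defines "p \<equiv> pr1 (coalg_of A) (coalg_of B)" and "q \<equiv> pr2 (coalg_of A) (coalg_of B)"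
  shows "mul (prod_bialg A B) T f g = pair T (mul A T (p \<cdot> f) (p \<cdot> g)) (mul B T (q \<cdot> f) (q \<cdot> g))"
    and "ch (tensor_coalg (coalg_of (prod_bialg A B)) (coalg_of (prod_bialg A B))) (coalg_of (prod_bialg A B)) (mult (prod_bialg A B))"
proof -
  let ?A = "coalg_of A" and ?B = "coalg_of B"
  let ?P = "tensor_coalg ?A ?B" let ?Q = "tensor_coalg ?P ?P"
  let ?p = "pr1 ?P ?P" and ?q = "pr2 ?P ?P"
  have p: "ch ?P ?A p" and q: "ch ?P ?B q" and p': "ch ?Q ?P ?p" and q': "ch ?Q ?P ?q"
    by (simp_all add: p_def q_def ch_pr1 ch_pr2)
  have pp: "ch ?Q ?A (p \<cdot> ?p)" "ch ?Q ?A (p \<cdot> ?q)" "ch ?Q ?B (q \<cdot> ?p)" "ch ?Q ?B (q \<cdot> ?q)"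
    by (simp_all add: ch_comp[OF _ _ _ p' p] ch_comp[OF _ _ _ p' q] ch_comp[OF _ _ _ q' p] ch_comp[OF _ _ _ q' q])
  have m: "mult (prod_bialg A B) = pair ?Q (mul A ?Q (p \<cdot> ?p) (p \<cdot> ?q)) (mul B ?Q (q \<cdot> ?p) (q \<cdot> ?q))"
    by (simp add: prod_bialg_def Let_def p_def q_def)
  show "ch (tensor_coalg (coalg_of (prod_bialg A B)) (coalg_of (prod_bialg A B))) (coalg_of (prod_bialg A B)) (mult (prod_bialg A B))"
    by (simp add: m ch_pair ch_mul pp)
  have fg: "ch T ?Q (pair T f g)" by (simp add: ch_pair f g)
  have pr: "?p \<cdot> pair T f g = f" "?q \<cdot> pair T f g = g"
    by (rule pr_pair[OF _ _ _ f g]; simp)+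
  show "mul (prod_bialg A B) T f g = pair T (mul A T (p \<cdot> f) (p \<cdot> g)) (mul B T (q \<cdot> f) (q \<cdot> g))"
    unfolding mul_def[of "prod_bialg A B"] m
    by (subst pair_comp[of ?Q T ?A ?B _ _ "pair T f g"])
      (simp_all add: ch_mul pp mul_comp[OF _ _ _ _ _ fg] fg pr
        comp_ch_assoc[OF fg p' p] comp_ch_assoc[OF fg p' q] comp_ch_assoc[OF fg q' p] comp_ch_assoc[OF fg q' q])
qed

lemma prod_bialg:
  assumes [simp]: "cb A" "cb B"
  shows cb_prod_bialg: "cb (prod_bialg A B)"
    and bh_pr1: "bh (prod_bialg A B) A (pr1 (coalg_of A) (coalg_of B))"
    and bh_pr2: "bh (prod_bialg A B) B (pr2 (coalg_of A) (coalg_of B))"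
proof -
  let ?A = "coalg_of A" and ?B = "coalg_of B"
  let ?P = "tensor_coalg ?A ?B" let ?p = "pr1 ?A ?B" and ?q = "pr2 ?A ?B"
  have p: "ch ?P ?A ?p" and q: "ch ?P ?B ?q" by (simp_all add: ch_pr1 ch_pr2)
  have pf: "ch T ?A (?p \<cdot> f)" "ch T ?B (?q \<cdot> f)" if "coc_coalg T" "ch T ?P f" for T f
    using that by (simp_all add: ch_comp[OF _ _ _ that(2) p] ch_comp[OF _ _ _ that(2) q])
  have u: "unit (prod_bialg A B) = pair unit_coalg (unit A) (unit B)" by (simp add: prod_bialg_def Let_def)
  have ou: "one (prod_bialg A B) T = pair T (one A T) (one B T)" if "coc_coalg T" for T
    unfolding one_def u using that by (simp add: pair_comp[OF _ _ _ _ ch_unit ch_unit ch_counit_arr])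
  have m: "ch T ?P (mul (prod_bialg A B) T f g)" "?p \<cdot> mul (prod_bialg A B) T f g = mul A T (?p \<cdot> f) (?p \<cdot> g)"
     "?q \<cdot> mul (prod_bialg A B) T f g = mul B T (?q \<cdot> f) (?q \<cdot> g)"
    if [simp]: "coc_coalg T" and f: "ch T ?P f" and g: "ch T ?P g" for T f g
    by (simp_all add: prod_bialg_mul(1) f g ch_pair ch_mul pf pr_pair)
  have o: "ch T ?P (one (prod_bialg A B) T)" "?p \<cdot> one (prod_bialg A B) T = one A T" "?q \<cdot> one (prod_bialg A B) T = one B T"
    if "coc_coalg T" for T using that by (simp_all add: ou ch_pair ch_one pr_pair)
  show cb: "cb (prod_bialg A B)"
  proof (rule cb_of_elements)
    show "ch (tensor_coalg (coalg_of (prod_bialg A B)) (coalg_of (prod_bialg A B))) (coalg_of (prod_bialg A B)) (mult (prod_bialg A B))"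
      using prod_bialg_mul(2)[of A B ?P "\<one> (obj A \<otimes> obj B)" "\<one> (obj A \<otimes> obj B)"] ch_id[of ?P] by simp
    show "ch unit_coalg (coalg_of (prod_bialg A B)) (unit (prod_bialg A B))" by (simp add: u ch_pair ch_unit)
    show "mul (prod_bialg A B) T (mul (prod_bialg A B) T f g) h = mul (prod_bialg A B) T f (mul (prod_bialg A B) T g h)"
      if c [simp]: "coc_coalg T" and "ch T (coalg_of (prod_bialg A B)) f" "ch T (coalg_of (prod_bialg A B)) g" "ch T (coalg_of (prod_bialg A B)) h" for T f g h
    proof -
      have f: "ch T ?P f" and g: "ch T ?P g" and h: "ch T ?P h" using that by simp_all
      note fg = m(1)[OF c f g] and gh = m(1)[OF c g h]
      note p_mul = m(2)[OF c f g] m(2)[OF c g h] m(2)[OF c fg h] m(2)[OF c f gh]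
      note q_mul = m(3)[OF c f g] m(3)[OF c g h] m(3)[OF c fg h] m(3)[OF c f gh]
      show ?thesis
        by (rule pair_ext[OF c _ _ m(1)[OF c fg h] m(1)[OF c f gh]])
          (simp_all only: p_mul q_mul mul_assoc[OF _ c pf(1)[OF c f] pf(1)[OF c g] pf(1)[OF c h]]
            mul_assoc[OF _ c pf(2)[OF c f] pf(2)[OF c g] pf(2)[OF c h]] assms cb_cc)
    qed
    show "mul (prod_bialg A B) T (one (prod_bialg A B) T) f = f" "mul (prod_bialg A B) T f (one (prod_bialg A B) T) = f"
      if "coc_coalg T" "ch T (coalg_of (prod_bialg A B)) f" for T f
      by (rule pair_ext[of _ ?A ?B]; use that in \<open>simp add: m mul_one pf o\<close>)+
  qed simp
  show "bh (prod_bialg A B) A ?p" "bh (prod_bialg A B) B ?q"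
    by (rule bhI; simp add: cb p q m u pr_pair ch_unit)+
qed

lemma jointly_monic_prod_bialg:
  assumes [simp]: "cb A" "cb B"
  shows "jointly_monic (prod_bialg A B) UNIV (\<lambda>b. if b then A else B)
     (\<lambda>b. if b then pr1 (coalg_of A) (coalg_of B) else pr2 (coalg_of A) (coalg_of B))"
  unfolding jointly_monic_def
proof (intro conjI allI impI)
  show "x = y" if "coc_coalg T" "ch T (coalg_of (prod_bialg A B)) x" "ch T (coalg_of (prod_bialg A B)) y" 
    and *: "\<forall>b\<in>UNIV. (if b then pr1 (coalg_of A) (coalg_of B) else pr2 (coalg_of A) (coalg_of B)) \<cdot> x =
      (if b then pr1 (coalg_of A) (coalg_of B) else pr2 (coalg_of A) (coalg_of B)) \<cdot> y" for T x y
    using that(1-3) *[THEN bspec, of True] *[THEN bspec, of False] pair_ext[of T "coalg_of A" "coalg_of B" x y] by simp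
qed (simp_all add: cb_prod_bialg bh_pr1 bh_pr2)

lemma bh_pair:
  assumes "cb T" "cb A" "cb B" "bh T A f" "bh T B g"
  shows "bh T (prod_bialg A B) (pair (coalg_of T) f g)"
  by (rule jointly_monic_reflects_bh[OF jointly_monic_prod_bialg[of A B]])
    (use assms in \<open>simp_all add: ch_pair bh_ch pr_pair[OF _ _ _ bh_ch bh_ch]\<close>)

definition unit_bialg :: "('o, 'a) bialg" where
  "unit_bialg = \<lparr>obj = I, mult = lu I, unit = \<one> I, comult = inv_arr C (lu I), counit = \<one> I\<rparr>"

lemma coalg_of_unit_bialg [simp]: "coalg_of unit_bialg = unit_coalg"
  by (simp add: unit_bialg_def coalg_of_def unit_coalg_def)

lemma unit_bialg_sel [simp]: "obj unit_bialg = I" "mult unit_bialg = lu I" "unit unit_bialg = \<one> I"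
  "comult unit_bialg = inv_arr C (lu I)" "counit unit_bialg = \<one> I"
  by (simp_all add: unit_bialg_def)

text \<open>\<open>unit_coalg\<close> is terminal among cocommutative coalgebras, so every law on
  elements equates two arrows into a terminal object.\<close>

lemma cb_unit_bialg [simp]: "cb unit_bialg"
proof (rule cb_of_elements)
  have m: "ch (tensor_coalg unit_coalg unit_coalg) unit_coalg (lu I)" using ch_pr2[of unit_coalg unit_coalg] by (simp add: pr_unit)
  then show "ch (tensor_coalg (coalg_of unit_bialg) (coalg_of unit_bialg)) (coalg_of unit_bialg) (mult unit_bialg)" by simp
  have "ch unit_coalg unit_coalg (\<one> I)" using ch_id[of unit_coalg] by simp
  then show "ch unit_coalg (coalg_of unit_bialg) (unit unit_bialg)" by simp
  have t: "f = g" if "ch T unit_coalg f" "ch T unit_coalg g" for T f g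
    using that ch_terminal by metis
  have mul: "ch T unit_coalg (mul unit_bialg T f g)" if "coc_coalg T" "ch T unit_coalg f" "ch T unit_coalg g" for T f g
    unfolding mul_def using that m by (intro ch_comp[OF _ _ _ ch_pair]) simp_all
  show "mul unit_bialg T (mul unit_bialg T f g) h = mul unit_bialg T f (mul unit_bialg T g h)"
    if "coc_coalg T" "ch T (coalg_of unit_bialg) f" "ch T (coalg_of unit_bialg) g" "ch T (coalg_of unit_bialg) h" for T f g h
    using that by (intro t[of T] mul) simp_all
  have one: "ch T unit_coalg (one unit_bialg T)" if "coc_coalg T" for T using that by (simp add: one_def ch_counit_arr)
  show "mul unit_bialg T (one unit_bialg T) f = f" "mul unit_bialg T f (one unit_bialg T) = f"
    if "coc_coalg T" "ch T (coalg_of unit_bialg) f" for T f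
    using that by (intro t[of T] mul one; simp)+
qed simp

lemma bh_to_unit_bialg: "cb A \<Longrightarrow> bh A unit_bialg f \<longleftrightarrow> f = counit A"
  using bh_zero[of A unit_bialg] ch_terminal[of "coalg_of A"] bh_ch[of A unit_bialg] by (auto simp: one_def)

lemma bh_from_unit_bialg: "cb A \<Longrightarrow> bh unit_bialg A f \<longleftrightarrow> f = unit A"
  using bh_zero[of unit_bialg A] by (auto simp: one_def bialg_hom_def alg_hom_def hom_iff)

end

section \<open>Arrows of bialgebras and coalgebras in terms of their underlying arrows\<close>

lemma BiAlg_coc_sel [simp]:
  "A \<in> Ob (BiAlg_coc C) \<longleftrightarrow> coc_bialgebra C A"
  "(A, f, B) \<in> Arr (BiAlg_coc C) \<longleftrightarrow> coc_bialgebra C A \<and> coc_bialgebra C B \<and> bialg_hom C A B f"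
  "Dom (BiAlg_coc C) (A, f, B) = A"
  "Cod (BiAlg_coc C) (A, f, B) = B"
  "Id (BiAlg_coc C) A = (A, \<one>\<^bsub>C\<^esub> (obj A), A)"
  "(B', g, D) \<cdot>\<^bsub>BiAlg_coc C\<^esub> (A, f, B) = (A, g \<cdot>\<^bsub>C\<^esub> f, D)"
  by (auto simp: BiAlg_coc_def)

lemma CoAlg_coc_sel [simp]:
  "(A, f, B) \<in> Arr (CoAlg_coc C) \<longleftrightarrow> coalgebra C A \<and> cocommutative C A \<and> coalgebra C B \<and> cocommutative C B \<and> coalg_hom C A B f"
  "Dom (CoAlg_coc C) (A, f, B) = A"
  "Cod (CoAlg_coc C) (A, f, B) = B"
  "(B', g, D) \<cdot>\<^bsub>CoAlg_coc C\<^esub> (A, f, B) = (A, g \<cdot>\<^bsub>C\<^esub> f, D)"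
  by (auto simp: CoAlg_coc_def)

lemma Arr_BiAlg_coc: "F \<in> Arr (BiAlg_coc C) \<longleftrightarrow>
    (\<exists>A f B. F = (A, f, B) \<and> coc_bialgebra C A \<and> coc_bialgebra C B \<and> bialg_hom C A B f)"
  by (auto simp: BiAlg_coc_def)

lemma hom_BiAlg_coc: "F \<in> hom (BiAlg_coc C) A B \<longleftrightarrow>
    (\<exists>f. F = (A, f, B) \<and> coc_bialgebra C A \<and> coc_bialgebra C B \<and> bialg_hom C A B f)"
  by (auto simp: hom_def Arr_BiAlg_coc)

lemma hom_CoAlg_coc: "F \<in> hom (CoAlg_coc C) A B \<longleftrightarrow>
    (\<exists>f. F = (A, f, B) \<and> coalgebra C A \<and> cocommutative C A \<and> coalgebra C B \<and> cocommutative C B \<and> coalg_hom C A B f)"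
  by (auto simp: hom_def CoAlg_coc_def)

context symmetric_monoidal_category
begin

section \<open>Limits and split extensions of cocommutative bialgebras\<close>

abbreviation "M \<equiv> BiAlg_coc C"

lemma bh_simps:
  assumes "bh A B f"
  shows "f \<in> Arr C" "Dom C f = obj A" "Cod C f = obj B"
  using ch_simps[OF bh_ch[OF assms]] by simp_all

lemma category_BiAlg: "category M"
proof
  show "Dom M f \<in> Ob M" "Cod M f \<in> Ob M" if "f \<in> Arr M" for f
    using that by (auto simp: Arr_BiAlg_coc)
  show "\<one>\<^bsub>M\<^esub> a \<in> hom M a a" if "a \<in> Ob M" for a
    using that by (auto simp: hom_BiAlg_coc bh_id)
  show "g \<cdot>\<^bsub>M\<^esub> f \<in> hom M a c" if "f \<in> hom M a b" "g \<in> hom M b c" for f g a b c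
    using that by (auto simp: hom_BiAlg_coc bh_comp)
  show "\<one>\<^bsub>M\<^esub> b \<cdot>\<^bsub>M\<^esub> f = f" "f \<cdot>\<^bsub>M\<^esub> \<one>\<^bsub>M\<^esub> a = f" if "f \<in> hom M a b" for f a b
    using that bh_simps by (auto simp: hom_BiAlg_coc)
  show "h \<cdot>\<^bsub>M\<^esub> g \<cdot>\<^bsub>M\<^esub> f = h \<cdot>\<^bsub>M\<^esub> (g \<cdot>\<^bsub>M\<^esub> f)"
    if "f \<in> hom M a b" "g \<in> hom M b c" "h \<in> hom M c d" for f g h a b c d
    using that by (auto simp: hom_BiAlg_coc comp_ch_assoc[OF bh_ch bh_ch bh_ch])
qed

lemma zero_object_unit_bialg: "zero_object M unit_bialg"
  unfolding zero_object_def by (auto simp: hom_BiAlg_coc bh_to_unit_bialg bh_from_unit_bialg)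

text \<open>The definition of \<open>zero_arrow\<close> admits any zero object \<open>z\<close>. The
  arrow from \<open>A\<close> to \<open>z\<close> is unique, hence it is \<open>one z\<close>, and
  its composite with any bialgebra morphism to \<open>B\<close> no longer depends on
  \<open>z\<close>.\<close>

lemma zero_arrow_iff:
  assumes [simp]: "cb A" "cb B"
  shows "zero_arrow M (A, f, B) \<longleftrightarrow> f = one B (coalg_of A)"
proof
  assume "zero_arrow M (A, f, B)"
  then obtain z h g where z: "zero_object M z" and h: "bh A z h" and g: "bh z B g"
    and f: "f = g \<cdot> h" and [simp]: "cb z"
    by (auto simp: zero_arrow_def hom_BiAlg_coc)
  have "\<exists>!k. k \<in> hom M A z" using z by (simp add: zero_object_def)
  then have "(A, h, z) = (A, one z (coalg_of A), z)" using h bh_zero[of A z] by (auto simp: hom_BiAlg_coc)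
  then show "f = one B (coalg_of A)" using bh_one[OF _ _ _ g, of "coalg_of A"] by (simp add: f)
next
  assume "f = one B (coalg_of A)"
  then have "(A, f, B) = (unit_bialg, unit B, B) \<cdot>\<^bsub>M\<^esub> (A, counit A, unit_bialg)" and "bh A B f"
    using bh_zero[of A B] by (simp_all add: one_def)
  moreover have "(unit_bialg, unit B, B) \<in> hom M unit_bialg B" "(A, counit A, unit_bialg) \<in> hom M A unit_bialg"
    by (simp_all add: hom_BiAlg_coc bh_to_unit_bialg bh_from_unit_bialg)
  ultimately show "zero_arrow M (A, f, B)"
    unfolding zero_arrow_def using zero_object_unit_bialg by (fastforce simp: hom_BiAlg_coc)
qed

text \<open>
  A triple \<open>(i, f, k)\<close> in \<open>R\<close> imposes \<open>f \<cdot> p i = p k\<close>. Universality is required against all coalgebras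
  \<open>T\<close>, which by \<open>jointly_monic_reflects_bh\<close> entails universality among bialgebras.
\<close>

definition universal_cone :: "('o, 'a) bialg \<Rightarrow> 'i set \<Rightarrow> ('i \<Rightarrow> ('o, 'a) bialg) \<Rightarrow> ('i \<times> 'a \<times> 'i) set \<Rightarrow> ('i \<Rightarrow> 'a) \<Rightarrow> bool" where
  "universal_cone V S B R p \<longleftrightarrow> jointly_monic V S B p \<and> (\<forall>(i, f, k) \<in> R. f \<cdot> p i = p k) \<and>
    (\<forall>T t. coc_coalg T \<longrightarrow> (\<forall>j\<in>S. ch T (coalg_of (B j)) (t j)) \<longrightarrow> (\<forall>(i, f, k) \<in> R. f \<cdot> t i = t k) \<longrightarrow>
      (\<exists>h. ch T (coalg_of V) h \<and> (\<forall>j\<in>S. p j \<cdot> h = t j)))"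

lemma universal_coneD:
  assumes "universal_cone V S B R p"
  shows "jointly_monic V S B p" "(i, f, k) \<in> R \<Longrightarrow> f \<cdot> p i = p k"
    "\<lbrakk>coc_coalg T; \<And>j. j \<in> S \<Longrightarrow> ch T (coalg_of (B j)) (t j); \<And>i f k. (i, f, k) \<in> R \<Longrightarrow> f \<cdot> t i = t k\<rbrakk>
      \<Longrightarrow> \<exists>h. ch T (coalg_of V) h \<and> (\<forall>j\<in>S. p j \<cdot> h = t j)"
  using assms unfolding universal_cone_def by blast+

text \<open>Starts from \<open>unit_bialg\<close>, whose empty family is jointly monic because
  \<open>unit_coalg\<close> is terminal, and adjoins one factor at a time with
  \<open>prod_bialg\<close>.\<close>

lemma universal_cone_product:
  assumes "finite S" "\<And>j. j \<in> S \<Longrightarrow> cb (B j)"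
  shows "\<exists>V p. universal_cone V S B {} p"
  using assms
proof (induction S rule: finite_induct)
  case empty
  have "jointly_monic unit_bialg {} B p" for p :: "'b \<Rightarrow> 'a"
    unfolding jointly_monic_def using ch_terminal by auto
  then have "universal_cone unit_bialg {} B {} p" for p unfolding universal_cone_def using ch_counit_arr by fastforce
  then show ?case by blast
next
  case (insert s S)
  then obtain V p where u: "universal_cone V S B {} p" by auto
  note jm = universal_coneD(1)[OF u]
  have [simp]: "cb V" "cb (B s)" using jointly_monicD(1)[OF jm] insert.prems by auto
  let ?V = "coalg_of V" and ?B = "coalg_of (B s)"
  let ?W = "prod_bialg V (B s)"
  let ?p = "\<lambda>j. if j = s then pr2 ?V ?B else p j \<cdot> pr1 ?V ?B"
  have p1: "ch (tensor_coalg ?V ?B) ?V (pr1 ?V ?B)" and p2: "ch (tensor_coalg ?V ?B) ?B (pr2 ?V ?B)" by (simp_all add: ch_pr1 ch_pr2)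
  have bp: "bh ?W (B j) (?p j)" if "j \<in> insert s S" for j
    using that insert.prems insert.hyps jointly_monicD(3)[OF jm, of j] bh_comp[OF _ _ _ bh_pr1[of V "B s"], of "B j" "p j"]
    by (auto simp: bh_pr2 cb_prod_bialg)
  have ass: "p j \<cdot> pr1 ?V ?B \<cdot> x = p j \<cdot> (pr1 ?V ?B \<cdot> x)" if "j \<in> S" "ch T (tensor_coalg ?V ?B) x" for T x j
    using comp_ch_assoc[OF that(2) p1 bh_ch[OF jointly_monicD(3)[OF jm that(1)]]] .
  have "jointly_monic ?W (insert s S) B ?p"
    unfolding jointly_monic_def
  proof (intro conjI allI impI)
    show "x = y" if T: "coc_coalg T" and x: "ch T (coalg_of ?W) x" and y: "ch T (coalg_of ?W) y"
      and eq: "\<forall>j\<in>insert s S. ?p j \<cdot> x = ?p j \<cdot> y" for T x y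
    proof (rule pair_ext[of T ?V ?B])
      have cx: "ch T ?V (pr1 ?V ?B \<cdot> x)" "ch T ?V (pr1 ?V ?B \<cdot> y)"
        using ch_comp[OF T _ _ _ p1, of x] ch_comp[OF T _ _ _ p1, of y] x y by simp_all
      have px: "p j \<cdot> (pr1 ?V ?B \<cdot> x) = p j \<cdot> (pr1 ?V ?B \<cdot> y)" if "j \<in> S" for j
      proof -
        have "j \<noteq> s" using that insert.hyps by auto
        then show ?thesis using eq[THEN bspec, of j] that x y ass[OF that] by auto
      qed
      show "pr1 ?V ?B \<cdot> x = pr1 ?V ?B \<cdot> y"
        by (rule jointly_monicD(4)[OF jm T cx px])
    qed (use T x y eq in simp_all)
  qed (use bp insert.prems in \<open>auto simp: cb_prod_bialg\<close>)
  moreover have "\<exists>h. ch T (coalg_of ?W) h \<and> (\<forall>j\<in>insert s S. ?p j \<cdot> h = t j)"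
    if T: "coc_coalg T" and t: "\<forall>j\<in>insert s S. ch T (coalg_of (B j)) (t j)" for T t
  proof -
    obtain h where h: "ch T ?V h" "\<forall>j\<in>S. p j \<cdot> h = t j"
      using universal_coneD(3)[OF u T, of t] t by auto
    have ts: "ch T ?B (t s)" using t by simp
    have hh: "ch T (tensor_coalg ?V ?B) (pair T h (t s))" using T h(1) ts by (simp add: ch_pair)
    have "?p j \<cdot> pair T h (t s) = t j" if "j \<in> insert s S" for j
      using that h(2) ass[OF _ hh] T insert.hyps by (auto simp: pr_pair[OF _ _ _ h(1) ts])
    then show ?thesis using hh by (intro exI[of _ "pair T h (t s)"]) simp
  qed
  ultimately show ?case unfolding universal_cone_def by blast
qed

lemma universal_cone_lift:
  assumes u: "universal_cone V S B R p" and T: "cb T" and t: "\<And>j. j \<in> S \<Longrightarrow> bh T (B j) (t j)"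
    and R: "\<And>i f k. (i, f, k) \<in> R \<Longrightarrow> f \<cdot> t i = t k"
  shows "\<exists>h. bh T V h \<and> (\<forall>j\<in>S. p j \<cdot> h = t j)"
proof -
  obtain h where h: "ch (coalg_of T) (coalg_of V) h" "\<forall>j\<in>S. p j \<cdot> h = t j"
    using universal_coneD(3)[OF u, of "coalg_of T" t] T t R bh_ch by auto
  have "bh T V h" by (rule jointly_monic_reflects_bh[OF universal_coneD(1)[OF u] T h(1)]) (use h t in auto)
  then show ?thesis using h by blast
qed

text \<open>
  The arrow \<open>q\<close> stands for \<open>\<kappa> \<cdot> \<lambda>\<close>. It determines the split extension, because \<open>X\<close> can be recovered as
  the kernel of \<open>\<alpha>\<close>; unlike \<open>X\<close> and \<open>\<lambda>\<close> it is an endomorphism of \<open>A\<close>, so it passes to limits directly.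
\<close>

definition kernel_retraction where
  "kernel_retraction A B \<alpha> e q \<longleftrightarrow> cb A \<and> cb B \<and> bh A B \<alpha> \<and> bh B A e \<and> \<alpha> \<cdot> e = \<one> (obj B) \<and>
    ch (coalg_of A) (coalg_of A) q \<and> \<alpha> \<cdot> q = one B (coalg_of A) \<and>
    mul A (coalg_of A) q (e \<cdot> \<alpha>) = \<one> (obj A) \<and>
    (\<forall>T x b. coc_coalg T \<longrightarrow> ch T (coalg_of A) x \<longrightarrow> ch T (coalg_of B) b \<longrightarrow> \<alpha> \<cdot> x = one B T \<longrightarrow>
      q \<cdot> mul A T x (e \<cdot> b) = x)"

lemma kernel_retractionD:
  assumes "kernel_retraction A B \<alpha> e q"
  shows "cb A" "cb B" "bh A B \<alpha>" "bh B A e" "\<alpha> \<cdot> e = \<one> (obj B)"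
    "ch (coalg_of A) (coalg_of A) q" "\<alpha> \<cdot> q = one B (coalg_of A)"
    "mul A (coalg_of A) q (e \<cdot> \<alpha>) = \<one> (obj A)"
    "\<lbrakk>coc_coalg T; ch T (coalg_of A) x; ch T (coalg_of B) b; \<alpha> \<cdot> x = one B T\<rbrakk> \<Longrightarrow> q \<cdot> mul A T x (e \<cdot> b) = x"
  using assms unfolding kernel_retraction_def by blast+

lemma ch_bh_comp:
  assumes "coc_coalg T" "cb A" "cb B" "ch T (coalg_of A) x" "bh A B f"
  shows "ch T (coalg_of B) (f \<cdot> x)"
  using assms by (intro ch_comp[OF _ _ _ _ bh_ch]) simp_all

text \<open>For an element \<open>x\<close> with trivial image under \<open>\<alpha>\<close>, the
  decomposition \<open>3\<close> shows \<open>x = \<kappa> \<cdot> (l \<cdot> x)\<close>. The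
  product of \<open>x\<close> with \<open>e \<cdot> b\<close> is then the image of the pair of
  \<open>l \<cdot> x\<close> and \<open>b\<close>, and \<open>4\<close> says that \<open>l\<close>
  returns the first component.\<close>

lemma split_extension_kernel_retraction:
  assumes "split_extension C X A B \<kappa> \<alpha> e l"
  shows "kernel_retraction A B \<alpha> e (\<kappa> \<cdot> l)"
proof -
  have [simp]: "cb X" "cb A" "cb B" and k: "bh X A \<kappa>" and a: "bh A B \<alpha>" and e: "bh B A e"
    and lk: "l \<cdot> \<kappa> = \<one> (obj X)" and ae: "\<alpha> \<cdot> e = \<one> (obj B)" and ak: "\<alpha> \<cdot> \<kappa> = unit B \<cdot> counit X"
    and 3: "mult A \<cdot> ((\<kappa> \<cdot> l) \<odot> (e \<cdot> \<alpha>)) \<cdot> comult A = \<one> (obj A)"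
    and 4: "l \<cdot> mult A \<cdot> (\<kappa> \<odot> e) = ru (obj X) \<cdot> (\<one> (obj X) \<odot> counit B)"
    and l: "ch (coalg_of A) (coalg_of X) l"
    using assms by (auto simp: split_extension_def)
  note [simp] = bh_simps[OF k] bh_simps[OF a] bh_simps[OF e] ch_simps[OF l, simplified]
  let ?A = "coalg_of A" and ?B = "coalg_of B" and ?X = "coalg_of X"
  have q: "ch ?A ?A (\<kappa> \<cdot> l)" by (rule ch_comp[OF _ _ _ l bh_ch[OF k]]) simp_all
  have ak': "\<alpha> \<cdot> \<kappa> = one B ?X" by (simp add: ak one_def)
  have "\<alpha> \<cdot> (\<kappa> \<cdot> l) = one B ?A"
    by (simp add: comp_reduce1[OF ak'] one_comp[OF _ _ _ l])
  moreover have m3: "mul A ?A (\<kappa> \<cdot> l) (e \<cdot> \<alpha>) = \<one> (obj A)"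
    using 3 by (simp add: mul_def pair_def comp_assoc)
  moreover have "\<kappa> \<cdot> l \<cdot> mul A T x (e \<cdot> b) = x"
    if [simp]: "coc_coalg T" and x: "ch T ?A x" and b: "ch T ?B b" and ax: "\<alpha> \<cdot> x = one B T" for T x b
  proof -
    note [simp] = ch_simps[OF x, simplified] ch_simps[OF b, simplified]
    let ?y = "l \<cdot> x"
    have y: "ch T ?X ?y" by (rule ch_comp[OF _ _ _ x l]) simp_all
    have qx: "ch T ?A (\<kappa> \<cdot> ?y)" by (rule ch_bh_comp[OF _ _ _ y k]) simp_all
    note [simp] = ch_simps[OF ch_pair[OF _ _ _ y b], simplified]
    \<comment> \<open>The decomposition is evaluated at \<open>x\<close>: its second factor
      \<open>e \<cdot> (\<alpha> \<cdot> x)\<close> is the unit, which puts \<open>x\<close> in the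
      image of \<open>\<kappa>\<close>.\<close>
    have "x = mul A ?A (\<kappa> \<cdot> l) (e \<cdot> \<alpha>) \<cdot> x" by (simp add: m3)
    also have "\<dots> = mul A T (\<kappa> \<cdot> ?y) (e \<cdot> (\<alpha> \<cdot> x))"
      using mul_comp[OF _ _ _ q _ x, of "e \<cdot> \<alpha>"] bh_ch[OF bh_comp[OF _ _ _ a e]] by (simp add: comp_assoc)
    also have "\<dots> = \<kappa> \<cdot> ?y"
      using qx by (simp add: ax bh_one[OF _ _ _ e] mul_one)
    finally have xy: "x = \<kappa> \<cdot> ?y" .
    have "mul A T x (e \<cdot> b) = mult A \<cdot> ((\<kappa> \<odot> e) \<cdot> pair T ?y b)"
      unfolding mul_def using xy tens_pair[OF _ y b bh_ch[OF k] bh_ch[OF e]] by simp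
    then have "l \<cdot> mul A T x (e \<cdot> b) = l \<cdot> mult A \<cdot> (\<kappa> \<odot> e) \<cdot> pair T ?y b"
      by (simp add: comp_assoc)
    also have "\<dots> = pr1 ?X ?B \<cdot> pair T ?y b" by (simp only: 4) (simp add: pr1_def)
    also have "\<dots> = ?y" by (simp add: pr_pair[OF _ _ _ y b])
    finally have "l \<cdot> mul A T x (e \<cdot> b) = ?y" .
    moreover have "ch T ?A (mul A T x (e \<cdot> b))"
      by (simp add: ch_mul x ch_bh_comp[OF _ _ _ b e])
    ultimately show ?thesis using xy ch_simps[of T ?A "mul A T x (e \<cdot> b)"] by (simp add: comp_assoc)
  qed
  ultimately show ?thesis unfolding kernel_retraction_def using k a e ae q by simp
qed

text \<open>The case of a trivial factor from \<open>B\<close> in the last clause of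
  \<open>kernel_retraction\<close>.\<close>

lemma kernel_retraction_section:
  assumes r: "kernel_retraction A B \<alpha> e q" and T: "coc_coalg T" and x: "ch T (coalg_of A) x" and ax: "\<alpha> \<cdot> x = one B T"
  shows "q \<cdot> x = x"
  using kernel_retractionD(9)[OF r T x _ ax, of "one B T"] T x kernel_retractionD(1,2)[OF r]
  by (simp add: ch_one bh_one[OF _ _ _ kernel_retractionD(4)[OF r]] mul_one)

text \<open>Applying \<open>p\<close> to the decomposition of an element of \<open>A\<close> gives a
  product of an element \<open>p \<cdot> q\<close> of the kernel of \<open>\<alpha>'\<close> and an
  element in the image of \<open>e'\<close>, and \<open>q'\<close> picks the first factor of any
  such product. For identities \<open>p\<close> and \<open>g\<close> this is uniqueness of
  \<open>q\<close>.\<close>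

lemma kernel_retraction_natural:
  assumes r: "kernel_retraction A B \<alpha> e q" and r': "kernel_retraction A' B' \<alpha>' e' q'"
    and p: "bh A A' p" and g: "bh B B' g" and ap: "\<alpha>' \<cdot> p = g \<cdot> \<alpha>" and pe: "p \<cdot> e = e' \<cdot> g"
  shows "q' \<cdot> p = p \<cdot> q"
proof -
  let ?A = "coalg_of A"
  note [simp] = kernel_retractionD(1,2)[OF r] kernel_retractionD(1,2)[OF r']
  note a = kernel_retractionD(3)[OF r] and e = kernel_retractionD(4)[OF r] and q = kernel_retractionD(6)[OF r]
  note a' = kernel_retractionD(3)[OF r'] and e' = kernel_retractionD(4)[OF r'] and q' = kernel_retractionD(6)[OF r']
  note [simp] = bh_simps[OF a] bh_simps[OF e] bh_simps[OF a'] bh_simps[OF e'] bh_simps[OF p] bh_simps[OF g]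
    ch_simps[OF q, simplified] ch_simps[OF q', simplified]
  have ga: "ch ?A (coalg_of B') (g \<cdot> \<alpha>)" using bh_ch[OF bh_comp[OF _ _ _ a g]] by simp
  have pq: "ch ?A (coalg_of A') (p \<cdot> q)" using ch_bh_comp[OF _ _ _ q p] by simp
  have "p = p \<cdot> mul A ?A q (e \<cdot> \<alpha>)" by (simp add: kernel_retractionD(8)[OF r])
  also have "\<dots> = mul A' ?A (p \<cdot> q) (p \<cdot> (e \<cdot> \<alpha>))"
    using bh_mul[OF _ _ _ p q, of "e \<cdot> \<alpha>"] bh_ch[OF bh_comp[OF _ _ _ a e]] by simp
  also have "\<dots> = mul A' ?A (p \<cdot> q) (e' \<cdot> (g \<cdot> \<alpha>))"
    by (simp add: comp_reduce[OF pe])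
  finally have pp: "p = mul A' ?A (p \<cdot> q) (e' \<cdot> (g \<cdot> \<alpha>))" .
  have "\<alpha>' \<cdot> (p \<cdot> q) = one B' ?A"
    by (simp add: comp_reduce[OF ap] kernel_retractionD(7)[OF r] bh_one[OF _ _ _ g])
  then have "q' \<cdot> mul A' ?A (p \<cdot> q) (e' \<cdot> (g \<cdot> \<alpha>)) = p \<cdot> q"
    using kernel_retractionD(9)[OF r' _ pq ga] by simp
  then show ?thesis using pp by simp
qed

text \<open>The laws of \<open>q\<close> can be tested after the jointly monic \<open>p j\<close>,
  where they become the laws of \<open>qs j\<close>. This serves both limits of diagrams of points
  and pullbacks of a single point.\<close>

lemma kernel_retraction_family:
  assumes jm: "jointly_monic A J As p" and [simp]: "cb B" and a: "bh A B \<alpha>" and e: "bh B A e"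
    and ae: "\<alpha> \<cdot> e = \<one> (obj B)" and q: "ch (coalg_of A) (coalg_of A) q"
    and r: "\<And>j. j \<in> J \<Longrightarrow> kernel_retraction (As j) (Bs j) (\<alpha>s j) (es j) (qs j)"
    and g: "\<And>j. j \<in> J \<Longrightarrow> bh B (Bs j) (g j)"
    and ap: "\<And>j. j \<in> J \<Longrightarrow> \<alpha>s j \<cdot> p j = g j \<cdot> \<alpha>"
    and pe: "\<And>j. j \<in> J \<Longrightarrow> p j \<cdot> e = es j \<cdot> g j"
    and pq: "\<And>j. j \<in> J \<Longrightarrow> p j \<cdot> q = qs j \<cdot> p j"
  shows "kernel_retraction A B \<alpha> e q"
proof -
  let ?A = "coalg_of A" and ?B = "coalg_of B"
  note [simp] = jointly_monicD(1)[OF jm] kernel_retractionD(1,2)[OF r]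
  note p = jointly_monicD(3)[OF jm] and aj = kernel_retractionD(3)[OF r] and ej = kernel_retractionD(4)[OF r] and qj = kernel_retractionD(6)[OF r]
  note [simp] = bh_simps[OF a] bh_simps[OF e] bh_simps[OF p] bh_simps[OF aj] bh_simps[OF ej] bh_simps[OF g]
    ch_simps[OF q, simplified] ch_simps[OF qj, simplified]
  have aq_ch: "ch ?A ?B (\<alpha> \<cdot> q)" using ch_bh_comp[OF _ _ _ q a] by simp
  have ea: "ch ?A ?A (e \<cdot> \<alpha>)" using bh_ch[OF bh_comp[OF _ _ _ a e]] by simp
  \<comment> \<open>The arrows \<open>g j\<close> are not known to be jointly monic, so the equation
    in \<open>B\<close> is transported into \<open>A\<close> along \<open>e\<close>, tested there,
    and recovered below from \<open>\<alpha> \<cdot> e = \<one> (obj B)\<close>.\<close>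
  have "e \<cdot> (\<alpha> \<cdot> q) = one A ?A"
  proof (rule jointly_monicD(4)[OF jm])
    show "ch ?A ?A (e \<cdot> (\<alpha> \<cdot> q))" using ch_bh_comp[OF _ _ _ aq_ch e] by simp
    show "p j \<cdot> (e \<cdot> (\<alpha> \<cdot> q)) = p j \<cdot> one A ?A" if j [simp]: "j \<in> J" for j
    proof -
      have "p j \<cdot> (e \<cdot> (\<alpha> \<cdot> q)) = es j \<cdot> (g j \<cdot> (\<alpha> \<cdot> q))"
        by (simp add: comp_reduce[OF pe])
      also have "\<dots> = es j \<cdot> (\<alpha>s j \<cdot> (p j \<cdot> q))" by (simp flip: comp_reduce[OF ap])
      also have "\<dots> = es j \<cdot> (one (Bs j) (coalg_of (As j)) \<cdot> p j)"
        by (simp add: pq comp_reduce1[OF kernel_retractionD(7)[OF r]])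
      also have "\<dots> = p j \<cdot> one A ?A"
        by (simp add: one_comp[OF _ _ _ bh_ch[OF p]] bh_one[OF _ _ _ ej] bh_one[OF _ _ _ p])
      finally show ?thesis .
    qed
  qed (simp_all add: ch_one)
  then have "\<alpha> \<cdot> (e \<cdot> (\<alpha> \<cdot> q)) = one B ?A" by (simp add: bh_one[OF _ _ _ a])
  then have aq: "\<alpha> \<cdot> q = one B ?A" by (simp add: comp_reduce1[OF ae])
  have m: "mul A ?A q (e \<cdot> \<alpha>) = \<one> (obj A)"
  proof (rule jointly_monicD(4)[OF jm])
    show "ch ?A ?A (mul A ?A q (e \<cdot> \<alpha>))" by (simp add: ch_mul q ea)
    show "ch ?A ?A (\<one> (obj A))" using ch_id[of ?A] by simp
    show "p j \<cdot> mul A ?A q (e \<cdot> \<alpha>) = p j \<cdot> \<one> (obj A)" if j [simp]: "j \<in> J" for j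
    proof -
      have ch1: "ch (coalg_of (As j)) (coalg_of (As j)) (es j \<cdot> \<alpha>s j)"
        using bh_ch[OF bh_comp[OF _ _ _ aj ej]] by simp
      have "p j \<cdot> mul A ?A q (e \<cdot> \<alpha>) = mul (As j) ?A (qs j \<cdot> p j) (p j \<cdot> (e \<cdot> \<alpha>))"
        by (simp add: bh_mul[OF _ _ _ p] q ea pq)
      also have "p j \<cdot> (e \<cdot> \<alpha>) = es j \<cdot> \<alpha>s j \<cdot> p j"
        by (simp add: comp_reduce[OF pe] comp_assoc ap)
      also have "mul (As j) ?A (qs j \<cdot> p j) (es j \<cdot> \<alpha>s j \<cdot> p j) =
          mul (As j) (coalg_of (As j)) (qs j) (es j \<cdot> \<alpha>s j) \<cdot> p j"
        by (rule mul_comp[symmetric]) (simp_all add: qj ch1 bh_ch[OF p])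
      finally show ?thesis by (simp add: kernel_retractionD(8)[OF r])
    qed
  qed simp
  have sec: "q \<cdot> mul A T x (e \<cdot> b) = x"
    if [simp]: "coc_coalg T" and x: "ch T ?A x" and b: "ch T ?B b" and ax: "\<alpha> \<cdot> x = one B T" for T x b
  proof (rule jointly_monicD(4)[OF jm])
    note [simp] = ch_simps[OF x, simplified] ch_simps[OF b, simplified]
    have eb: "ch T ?A (e \<cdot> b)" by (rule ch_bh_comp[OF _ _ _ b e]) simp_all
    have y: "ch T ?A (mul A T x (e \<cdot> b))" by (simp add: ch_mul x eb)
    show "ch T ?A (q \<cdot> mul A T x (e \<cdot> b))" by (rule ch_comp[OF _ _ _ y q]) simp_all
    show "p j \<cdot> (q \<cdot> mul A T x (e \<cdot> b)) = p j \<cdot> x" if j [simp]: "j \<in> J" for j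
    proof -
      have px: "ch T (coalg_of (As j)) (p j \<cdot> x)" using ch_bh_comp[OF _ _ _ x p] by simp
      have gb: "ch T (coalg_of (Bs j)) (g j \<cdot> b)" using ch_bh_comp[OF _ _ _ b g] by simp
      have "p j \<cdot> (q \<cdot> mul A T x (e \<cdot> b)) = qs j \<cdot> (p j \<cdot> mul A T x (e \<cdot> b))"
        using ch_simps[OF y] by (simp add: comp_reduce[OF pq])
      also have "\<dots> = qs j \<cdot> mul (As j) T (p j \<cdot> x) (es j \<cdot> (g j \<cdot> b))"
        by (simp add: bh_mul[OF _ _ _ p] x eb comp_reduce[OF pe])
      also have "\<dots> = p j \<cdot> x"
        by (rule kernel_retractionD(9)[OF r]) (simp_all add: px gb comp_reduce[OF ap] ax bh_one[OF _ _ _ g])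
      finally show ?thesis .
    qed
  qed (simp_all add: x)
  show ?thesis unfolding kernel_retraction_def using a e ae q aq m sec by simp
qed

text \<open>The kernel of an identity point is trivial, so its retraction is the zero morphism. This
  is the trivial point over \<open>D\<close> needed when a pullback along an arrow from
  \<open>D\<close> is viewed as a limit of points.\<close>

lemma kernel_retraction_id:
  assumes [simp]: "cb D"
  shows "kernel_retraction D D (\<one> (obj D)) (\<one> (obj D)) (one D (coalg_of D))"
proof -
  let ?D = "coalg_of D"
  have o: "\<one> (obj D) \<cdot> one D T = one D T" if "coc_coalg T" for T 
    using ch_simps[OF ch_one[OF assms that]] by simp
  have i: "ch ?D ?D (\<one> (obj D))" using ch_id[of ?D] by simp
  have "one D ?D \<cdot> mul D T x (\<one> (obj D) \<cdot> b) = x"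
    if "coc_coalg T" "ch T ?D x" "ch T ?D b" "\<one> (obj D) \<cdot> x = one D T" for T x b
    using that ch_simps[OF that(2)] ch_simps[OF that(3)] one_comp[OF _ _ _ ch_mul[OF _ that(1-3)], of D] by simp
  then show ?thesis unfolding kernel_retraction_def by (simp add: bh_id ch_one o mul_one i)
qed

end

section \<open>Equalizers of bialgebras and finite completeness\<close>

locale coc_bialgebras = symmetric_monoidal_category C for C :: "('o, 'a, 'z) smc_scheme" (structure) +
  assumes BiAlg_equalizers: "has_equalizers (BiAlg_coc C)"
    and forget_equalizers: "preserves_equalizers (BiAlg_coc C) (CoAlg_coc C) forget_alg"
begin

text \<open>The image of the equalizer under \<open>forget_alg\<close> is an equalizer of
  coalgebras, so the factorization also exists for arrows \<open>h\<close> that do not respect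
  multiplication, such as a retraction \<open>q\<close>.\<close>

lemma equalizer_lift:
  assumes eq: "is_equalizer M (A, f, B) (A, g, B) (E, i, A)"
  shows "cb E" "bh E A i" "f \<cdot> i = g \<cdot> i"
    and "\<lbrakk>coc_coalg T; ch T (coalg_of A) h; f \<cdot> h = g \<cdot> h\<rbrakk> \<Longrightarrow> \<exists>!k. ch T (coalg_of E) k \<and> i \<cdot> k = h"
proof -
  show "cb E" "bh E A i" "f \<cdot> i = g \<cdot> i" using eq by (auto simp: is_equalizer_def)
  have "is_equalizer (CoAlg_coc C) (coalg_of A, f, coalg_of B) (coalg_of A, g, coalg_of B) (coalg_of E, i, coalg_of A)"
    using forget_equalizers eq unfolding preserves_equalizers_def forget_alg_def by fastforce
  note eqC = this
  have *: "\<exists>!k. k \<in> hom (CoAlg_coc C) T (coalg_of E) \<and>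
      (coalg_of E, i, coalg_of A) \<cdot>\<^bsub>CoAlg_coc C\<^esub> k = (T, h, coalg_of A)"
    if "coc_coalg T" "ch T (coalg_of A) h" "f \<cdot> h = g \<cdot> h" for T h
  proof -
    have "cb A" using eq by (simp add: is_equalizer_def)
    then have "coc_coalg (coalg_of A)" by simp
    then have "(T, h, coalg_of A) \<in> hom (CoAlg_coc C) T (Dom (CoAlg_coc C) (coalg_of A, f, coalg_of B))"
      using that by (simp add: hom_CoAlg_coc coc_coalg_def)
    moreover have "(coalg_of A, f, coalg_of B) \<cdot>\<^bsub>CoAlg_coc C\<^esub> (T, h, coalg_of A) =
        (coalg_of A, g, coalg_of B) \<cdot>\<^bsub>CoAlg_coc C\<^esub> (T, h, coalg_of A)"
      using that by simp
    ultimately have "\<exists>!k. k \<in> hom (CoAlg_coc C) T (Dom (CoAlg_coc C) (coalg_of E, i, coalg_of A)) \<and>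
        (coalg_of E, i, coalg_of A) \<cdot>\<^bsub>CoAlg_coc C\<^esub> k = (T, h, coalg_of A)"
      using eqC unfolding is_equalizer_def by blast
    then show ?thesis by simp
  qed
  show "\<exists>!k. ch T (coalg_of E) k \<and> i \<cdot> k = h" if T: "coc_coalg T" and h: "ch T (coalg_of A) h" and fg: "f \<cdot> h = g \<cdot> h"
  proof -
    have cE: "coc_coalg (coalg_of E)" using \<open>cb E\<close> by simp
    note ex1 = *[OF T h fg]
    obtain K where K: "K \<in> hom (CoAlg_coc C) T (coalg_of E)"
      "(coalg_of E, i, coalg_of A) \<cdot>\<^bsub>CoAlg_coc C\<^esub> K = (T, h, coalg_of A)"
      using ex1 by blast
    then obtain k where k: "K = (T, k, coalg_of E)" "ch T (coalg_of E) k"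
      unfolding hom_CoAlg_coc by blast
    have "k' = k" if "ch T (coalg_of E) k'" "i \<cdot> k' = h" for k'
    proof -
      have "(T, k', coalg_of E) \<in> hom (CoAlg_coc C) T (coalg_of E)"
        using that(1) cE T unfolding hom_CoAlg_coc coc_coalg_def by blast
      moreover have "(coalg_of E, i, coalg_of A) \<cdot>\<^bsub>CoAlg_coc C\<^esub> (T, k', coalg_of E) = (T, h, coalg_of A)"
        by (simp add: that(2))
      ultimately have "(T, k', coalg_of E) = K" using ex1 K by blast
      then show ?thesis using k(1) by simp
    qed
    moreover have "i \<cdot> k = h" using K(2) by (simp add: k(1))
    ultimately show ?thesis using k(2) by blast
  qed
qed

lemma equalizer_jointly_monic:
  assumes "is_equalizer M (A, f, B) (A, g, B) (E, i, A)" "cb A" 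
  shows "\<lbrakk>coc_coalg T; ch T (coalg_of E) x; ch T (coalg_of E) y; i \<cdot> x = i \<cdot> y\<rbrakk> \<Longrightarrow> x = y"
proof -
  assume T: "coc_coalg T" "ch T (coalg_of E) x" "ch T (coalg_of E) y" "i \<cdot> x = i \<cdot> y"
  note E = equalizer_lift[OF assms(1)]
  have fg: "bh A B f" "bh A B g" using assms(1) by (auto simp: is_equalizer_def hom_BiAlg_coc)
  have h: "ch T (coalg_of A) (i \<cdot> x)" using ch_bh_comp[OF T(1) E(1) assms(2) T(2) E(2)] .
  have "f \<cdot> (i \<cdot> x) = g \<cdot> (i \<cdot> x)"
    using E(3) comp_ch_assoc[OF T(2) bh_ch[OF E(2)] bh_ch[OF fg(1)]] comp_ch_assoc[OF T(2) bh_ch[OF E(2)] bh_ch[OF fg(2)]]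
    by simp
  then show "x = y" using E(4)[OF T(1) h] T by auto
qed

lemma equalizer_exists:
  assumes "cb A" "cb B" "bh A B f" "bh A B g"
  obtains E i where "is_equalizer M (A, f, B) (A, g, B) (E, i, A)"
proof -
  have "\<exists>i. is_equalizer M (A, f, B) (A, g, B) i"
    using BiAlg_equalizers assms unfolding has_equalizers_def by (auto simp: hom_BiAlg_coc)
  then obtain i where i: "is_equalizer M (A, f, B) (A, g, B) i" by blast
  moreover obtain E j where "i = (E, j, A)" using i by (cases i) (auto simp: is_equalizer_def)
  ultimately show thesis using that by blast
qed

text \<open>Limits from products and equalizers, imposing one relation of \<open>R\<close> at a
  time. Each equalizer arrow \<open>m\<close> is monic on coalgebra morphisms, so composing the legs
  with it keeps them jointly monic.\<close>

lemma universal_cone_exists: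
  assumes S: "finite S" "\<And>j. j \<in> S \<Longrightarrow> cb (B j)"
    and R: "finite R" "\<And>i f k. (i, f, k) \<in> R \<Longrightarrow> i \<in> S \<and> k \<in> S \<and> bh (B i) (B k) f"
  shows "\<exists>V p. universal_cone V S B R p"
  using R
proof (induction R rule: finite_induct)
  case empty
  then show ?case using universal_cone_product[of S B] S by blast
next
  case (insert r R)
  obtain i f k where r: "r = (i, f, k)" by (cases r)
  obtain V p where u: "universal_cone V S B R p" using insert by blast
  note jm = universal_coneD(1)[OF u]
  have ik: "i \<in> S" "k \<in> S" and f: "bh (B i) (B k) f" using insert.prems[of i f k] r by auto
  note [simp] = jointly_monicD(1)[OF jm] S(2)
  have pb: "bh V (B j) (p j)" if "j \<in> S" for j using jointly_monicD(3)[OF jm that] .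
  have "bh V (B k) (f \<cdot> p i)" using bh_comp[OF _ _ _ pb[OF ik(1)] f] ik by simp
  then obtain E m where E: "is_equalizer M (V, f \<cdot> p i, B k) (V, p k, B k) (E, m, V)"
    using equalizer_exists[of V "B k" "f \<cdot> p i" "p k"] ik pb by auto
  note Ed = equalizer_lift[OF E]
  note [simp] = Ed(1)
  note mc = bh_ch[OF Ed(2)]
  have ass: "p j \<cdot> m \<cdot> x = p j \<cdot> (m \<cdot> x)" if "j \<in> S" "ch T (coalg_of E) x" for T x j
    using comp_ch_assoc[OF that(2) mc bh_ch[OF pb[OF that(1)]]] .
  have mass: "g \<cdot> (p i' \<cdot> m) = g \<cdot> p i' \<cdot> m" if "i' \<in> S" "bh (B i') (B k') g" for i' k' g
    using comp_ch_assoc[OF mc bh_ch[OF pb[OF that(1)]] bh_ch[OF that(2)]] by simp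
  have "jointly_monic E S B (\<lambda>j. p j \<cdot> m)"
    unfolding jointly_monic_def
  proof (intro conjI allI impI)
    show "x = y" if T: "coc_coalg T" and x: "ch T (coalg_of E) x" and y: "ch T (coalg_of E) y"
      and eq: "\<forall>j\<in>S. p j \<cdot> m \<cdot> x = p j \<cdot> m \<cdot> y" for T x y
    proof (rule equalizer_jointly_monic[OF E _ T x y])
      have px: "p j \<cdot> (m \<cdot> x) = p j \<cdot> (m \<cdot> y)" if "j \<in> S" for j
        using eq that ass[OF that x] ass[OF that y] by auto
      have c: "ch T (coalg_of V) (m \<cdot> x)" "ch T (coalg_of V) (m \<cdot> y)"
        using ch_bh_comp[OF T _ _ x Ed(2)] ch_bh_comp[OF T _ _ y Ed(2)] by simp_all
      show "m \<cdot> x = m \<cdot> y" by (rule jointly_monicD(4)[OF jm T c px])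
    qed simp
  qed (use bh_comp[OF _ _ _ Ed(2) pb] in auto)
  moreover have "g \<cdot> (p i' \<cdot> m) = p k' \<cdot> m" if "(i', g, k') \<in> insert r R" for i' g k'
  proof -
    have "i' \<in> S" "k' \<in> S" "bh (B i') (B k') g" using insert.prems that by auto
    then show ?thesis using that r mass universal_coneD(2)[OF u, of i' g k'] Ed(3) by auto
  qed
  moreover have "\<exists>h. ch T (coalg_of E) h \<and> (\<forall>j\<in>S. p j \<cdot> m \<cdot> h = t j)"
    if T: "coc_coalg T" and t: "\<forall>j\<in>S. ch T (coalg_of (B j)) (t j)" and c: "\<forall>(i', g, k') \<in> insert r R. g \<cdot> t i' = t k'" for T t
  proof -
    obtain h where h: "ch T (coalg_of V) h" "\<forall>j\<in>S. p j \<cdot> h = t j"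
    proof -
      have "g \<cdot> t i' = t k'" if "(i', g, k') \<in> R" for i' g k' using c that by auto
      then show thesis using universal_coneD(3)[OF u T, of t] t that by blast
    qed
    have "f \<cdot> p i \<cdot> h = p k \<cdot> h"
      using comp_ch_assoc[OF h(1) bh_ch[OF pb[OF ik(1)]] bh_ch[OF f]] h(2) ik c r by auto
    then obtain l where l: "ch T (coalg_of E) l" "m \<cdot> l = h"
      using Ed(4)[OF T h(1)] by blast
    then show ?thesis using h(2) ass by (intro exI[of _ l]) auto
  qed
  ultimately show ?case unfolding universal_cone_def by blast
qed

lemma functor_arrow:
  assumes J: "finite_shape J" and F: "is_functor J M F"
  defines "fa \<equiv> \<lambda>u. fst (snd (FArr F u))"
  shows "j \<in> Ob J \<Longrightarrow> cb (FOb F j)"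
    and "u \<in> Arr J \<Longrightarrow> FArr F u = (FOb F (Dom J u), fa u, FOb F (Cod J u))"
    and "u \<in> Arr J \<Longrightarrow> bh (FOb F (Dom J u)) (FOb F (Cod J u)) (fa u)"
proof -
  show "cb (FOb F j)" if "j \<in> Ob J" using F that by (auto simp: is_functor_def)
  show "FArr F u = (FOb F (Dom J u), fa u, FOb F (Cod J u))"
    "bh (FOb F (Dom J u)) (FOb F (Cod J u)) (fa u)" if "u \<in> Arr J"
    using F that unfolding is_functor_def fa_def by (auto simp: hom_BiAlg_coc)
qed

lemma universal_cone_limit_exists:
  assumes J: "finite_shape J" and F: "is_functor J M F"
  shows "\<exists>V p. universal_cone V (Ob J) (FOb F) ((\<lambda>u. (Dom J u, fst (snd (FArr F u)), Cod J u)) ` Arr J) p"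
proof (rule universal_cone_exists)
  have cat: "category J" using J by (simp add: finite_shape_def)
  show "i \<in> Ob J \<and> k \<in> Ob J \<and> bh (FOb F i) (FOb F k) f"
    if "(i, f, k) \<in> (\<lambda>u. (Dom J u, fst (snd (FArr F u)), Cod J u)) ` Arr J" for i f k
    using that functor_arrow(3)[OF J F] category.Dom_Ob[OF cat] category.Cod_Ob[OF cat] by auto
qed (use J functor_arrow(1)[OF J F] in \<open>auto simp: finite_shape_def\<close>)

text \<open>The universal cone is tested on coalgebras; for a cone of bialgebras the comparison
  arrow respects multiplication by \<open>universal_cone_lift\<close>, and its uniqueness is joint
  monicity.\<close>

lemma finitely_complete_BiAlg: "finitely_complete M"
  unfolding finitely_complete_def
proof (intro allI impI, elim conjE)
  fix J :: "(nat, nat) cat" and F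
  assume J: "finite_shape J" and F: "is_functor J M F"
  let ?f = "\<lambda>u. fst (snd (FArr F u))"
  obtain V p where un: "universal_cone V (Ob J) (FOb F) ((\<lambda>u. (Dom J u, ?f u, Cod J u)) ` Arr J) p"
    using universal_cone_limit_exists[OF J F] by blast
  note jm = universal_coneD(1)[OF un]
  note Fo = functor_arrow[OF J F]
  have "is_limit J M F V (\<lambda>j. (V, p j, FOb F j))"
    unfolding is_limit_def
  proof (intro conjI allI impI)
    show "is_cone J M F V (\<lambda>j. (V, p j, FOb F j))"
    proof -
      have "?f u \<cdot> p (Dom J u) = p (Cod J u)" if "u \<in> Arr J" for u
        using universal_coneD(2)[OF un, of "Dom J u" "?f u" "Cod J u"] that by blast
      then have "FArr F u \<cdot>\<^bsub>M\<^esub> (V, p (Dom J u), FOb F (Dom J u)) = (V, p (Cod J u), FOb F (Cod J u))"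
        if "u \<in> Arr J" for u
        using that Fo(2)[OF that] by (metis BiAlg_coc_sel(6))
      then show ?thesis unfolding is_cone_def using jointly_monicD(1-3)[OF jm] Fo(1) by (simp add: hom_BiAlg_coc)
    qed
    fix w q
    assume cone: "is_cone J M F w q"
    have w: "cb w" and qj: "\<And>j. j \<in> Ob J \<Longrightarrow> q j \<in> hom M w (FOb F j)"
      and qu: "\<And>u. u \<in> Arr J \<Longrightarrow> FArr F u \<cdot>\<^bsub>M\<^esub> q (Dom J u) = q (Cod J u)"
      using cone by (auto simp: is_cone_def)
    define t where "t j = fst (snd (q j))" for j
    have q: "q j = (w, t j, FOb F j)" "bh w (FOb F j) (t j)" if "j \<in> Ob J" for j
      using qj[OF that] by (auto simp: hom_BiAlg_coc t_def)
    have cat: "category J" using J by (simp add: finite_shape_def)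
    have "?f u \<cdot> t (Dom J u) = t (Cod J u)" if "u \<in> Arr J" for u
    proof -
      define f where "f = ?f u"
      have "FArr F u = (FOb F (Dom J u), f, FOb F (Cod J u))" using Fo(2)[OF that] by (simp only: f_def)
      then show ?thesis
        using qu[OF that] q(1)[OF category.Dom_Ob[OF cat that]] q(1)[OF category.Cod_Ob[OF cat that]]
        by (simp flip: f_def)
    qed
    then obtain h where h: "bh w V h" "\<forall>j\<in>Ob J. p j \<cdot> h = t j"
      using universal_cone_lift[OF un w, of t] q(2) by blast
    show "\<exists>!h. h \<in> hom M w V \<and> (\<forall>j\<in>Ob J. (V, p j, FOb F j) \<cdot>\<^bsub>M\<^esub> h = q j)"
    proof (rule ex1I[of _ "(w, h, V)"])
      show "(w, h, V) \<in> hom M w V \<and> (\<forall>j\<in>Ob J. (V, p j, FOb F j) \<cdot>\<^bsub>M\<^esub> (w, h, V) = q j)"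
        using h w q jointly_monicD(1)[OF jm] by (auto simp: hom_BiAlg_coc)
      fix k
      assume k: "k \<in> hom M w V \<and> (\<forall>j\<in>Ob J. (V, p j, FOb F j) \<cdot>\<^bsub>M\<^esub> k = q j)"
      then obtain k' where k': "k = (w, k', V)" "bh w V k'" by (auto simp: hom_BiAlg_coc)
      have "k' = h"
        by (rule jointly_monicD(4)[OF jm cb_cc[OF w] bh_ch[OF k'(2)] bh_ch[OF h(1)]])
          (use k k' h q in auto)
      then show "k = (w, h, V)" using k' by simp
    qed
  qed
  then show "\<exists>v p. is_limit J M F v p" by blast
qed

text \<open>\<open>X\<close> is the kernel of \<open>\<alpha>\<close>, formed as its equalizer with
  the zero morphism, and \<open>l\<close> is the factorization of the coalgebra morphism
  \<open>q\<close> through it. The equations for \<open>l\<close> are checked after composing with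
  the monic \<open>k\<close>, where \<open>k \<cdot> l\<close> becomes \<open>q\<close>.\<close>

lemma kernel_retraction_split_extension:
  assumes r: "kernel_retraction A B \<alpha> e q"
  shows "\<exists>X k l. split_extension C X A B k \<alpha> e l"
proof -
  let ?A = "coalg_of A" and ?B = "coalg_of B"
  note [simp] = kernel_retractionD(1,2)[OF r]
  note a = kernel_retractionD(3)[OF r] and e = kernel_retractionD(4)[OF r] and q = kernel_retractionD(6)[OF r]
  obtain X k where E: "is_equalizer M (A, \<alpha>, B) (A, one B ?A, B) (X, k, A)"
    using equalizer_exists[of A B \<alpha> "one B ?A"] a bh_zero[of A B] by auto
  note Ed = equalizer_lift[OF E]
  note [simp] = Ed(1)
  note k = Ed(2)
  note mono = equalizer_jointly_monic[OF E kernel_retractionD(1)[OF r]]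
  let ?X = "coalg_of X"
  have "\<alpha> \<cdot> q = one B ?A \<cdot> q" using one_comp[OF _ _ _ q, of B] by (simp add: kernel_retractionD(7)[OF r])
  then obtain l where l: "ch ?A ?X l" and kl: "k \<cdot> l = q"
    using Ed(4)[OF _ q] by auto
  note [simp] = bh_simps[OF k] bh_simps[OF a] bh_simps[OF e] ch_simps[OF q, simplified] ch_simps[OF l, simplified]
  have ak: "\<alpha> \<cdot> k = one B ?X" using Ed(3) one_comp[OF _ _ _ bh_ch[OF k], of B] by simp
  have lk: "l \<cdot> k = \<one> (obj X)"
  proof (rule mono[of ?X])
    show "ch ?X ?X (l \<cdot> k)" by (rule ch_comp[OF _ _ _ bh_ch[OF k] l]) simp_all
    show "ch ?X ?X (\<one> (obj X))" using ch_id[of ?X] by simp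
    show "k \<cdot> (l \<cdot> k) = k \<cdot> \<one> (obj X)"
      using kernel_retraction_section[OF r _ bh_ch[OF k] ak] by (simp add: comp_reduce1[OF kl])
  qed simp
  have le: "l \<cdot> e = one X ?B"
  proof (rule mono[of ?B])
    show "ch ?B ?X (l \<cdot> e)" by (rule ch_comp[OF _ _ _ bh_ch[OF e] l]) simp_all
    show "ch ?B ?X (one X ?B)" by (simp add: ch_one)
    \<comment> \<open>The generic element of the image of \<open>e\<close> is written as the unit
      times itself; \<open>q\<close> returns the first factor, the unit.\<close>
    have "q \<cdot> mul A ?B (one A ?B) (e \<cdot> \<one> (obj B)) = one A ?B"
      by (rule kernel_retractionD(9)[OF r]) (use ch_id[of ?B] in \<open>simp_all add: ch_one bh_one[OF _ _ _ a]\<close>)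
    then show "k \<cdot> (l \<cdot> e) = k \<cdot> one X ?B"
      by (simp add: comp_reduce1[OF kl] bh_one[OF _ _ _ k] mul_one bh_ch[OF e])
  qed simp
  have lu: "l \<cdot> unit A = unit X"
  proof (rule mono[of unit_coalg])
    show "ch unit_coalg ?X (l \<cdot> unit A)" by (rule ch_comp[OF _ _ _ ch_unit l]) simp_all
    show "ch unit_coalg ?X (unit X)" by (simp add: ch_unit)
    have "q \<cdot> one A unit_coalg = one A unit_coalg"
      by (rule kernel_retraction_section[OF r]) (simp_all add: ch_one bh_one[OF _ _ _ a])
    then show "k \<cdot> (l \<cdot> unit A) = k \<cdot> unit X"
      using bh_one[OF _ _ _ k, of unit_coalg] by (simp add: comp_reduce1[OF kl] mult_elements)
  qed simp
  \<comment> \<open>The remaining equation for \<open>l\<close> is the last clause of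
    \<open>kernel_retraction\<close> at the generic pair of an element of \<open>X\<close> and an
    element of \<open>B\<close>.\<close>
  let ?T = "tensor_coalg ?X ?B"
  have p1: "ch ?T ?X (pr1 ?X ?B)" and p2: "ch ?T ?B (pr2 ?X ?B)" by (simp_all add: ch_pr1 ch_pr2)
  have kp: "ch ?T ?A (k \<cdot> pr1 ?X ?B)" and ep: "ch ?T ?A (e \<cdot> pr2 ?X ?B)"
    using ch_bh_comp[OF _ _ _ p1 k] ch_bh_comp[OF _ _ _ p2 e] by simp_all
  note [simp] = ch_simps[OF p1, simplified] ch_simps[OF p2, simplified]
  have ke: "mult A \<cdot> (k \<odot> e) = mul A ?T (k \<cdot> pr1 ?X ?B) (e \<cdot> pr2 ?X ?B)"
    by (simp add: mul_def ch_tens(1)[OF _ _ _ _ bh_ch[OF k] bh_ch[OF e]])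
  have m: "ch ?T ?A (mult A \<cdot> (k \<odot> e))" by (simp add: ke ch_mul kp ep)
  have l4: "l \<cdot> (mult A \<cdot> (k \<odot> e)) = pr1 ?X ?B"
  proof (rule mono[of ?T])
    show "ch ?T ?X (l \<cdot> (mult A \<cdot> (k \<odot> e)))" by (rule ch_comp[OF _ _ _ m l]) simp_all
    have "\<alpha> \<cdot> (k \<cdot> pr1 ?X ?B) = one B ?T"
      by (simp add: comp_reduce1[OF ak] one_comp[OF _ _ _ p1])
    then have "q \<cdot> (mult A \<cdot> (k \<odot> e)) = k \<cdot> pr1 ?X ?B"
      using kernel_retractionD(9)[OF r _ kp p2] by (simp add: ke)
    then show "k \<cdot> (l \<cdot> (mult A \<cdot> (k \<odot> e))) = k \<cdot> pr1 ?X ?B"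
      using ch_simps[OF m] by (simp add: comp_reduce1[OF kl])
  qed (simp_all add: p1)
  have "mult A \<cdot> ((k \<cdot> l) \<odot> (e \<cdot> \<alpha>)) \<cdot> comult A = \<one> (obj A)"
    using kernel_retractionD(8)[OF r] by (simp add: kl mul_def pair_def comp_assoc)
  moreover have "l \<cdot> mult A \<cdot> (k \<odot> e) = ru (obj X) \<cdot> (\<one> (obj X) \<odot> counit B)"
    using l4 by (simp add: pr1_def comp_assoc)
  ultimately show ?thesis
    using k a e l lk kernel_retractionD(5)[OF r] le ak lu by (intro exI[of _ X] exI[of _ k] exI[of _ l])
      (simp add: split_extension_def hom_iff one_def)
qed

lemma S_coc_iff: "P \<in> S_coc C \<longleftrightarrow> (\<exists>A B \<alpha> e q. P = ((A, \<alpha>, B), (B, e, A)) \<and> kernel_retraction A B \<alpha> e q)"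
proof
  assume "P \<in> S_coc C"
  then obtain A B \<alpha> e X \<kappa> l where "P = ((A, \<alpha>, B), (B, e, A))" "split_extension C X A B \<kappa> \<alpha> e l"
    by (auto simp: S_coc_def)
  then show "\<exists>A B \<alpha> e q. P = ((A, \<alpha>, B), (B, e, A)) \<and> kernel_retraction A B \<alpha> e q"
    using split_extension_kernel_retraction by blast
next
  assume "\<exists>A B \<alpha> e q. P = ((A, \<alpha>, B), (B, e, A)) \<and> kernel_retraction A B \<alpha> e q"
  then obtain A B \<alpha> e q where "P = ((A, \<alpha>, B), (B, e, A))" "kernel_retraction A B \<alpha> e q" by blast
  then show "P \<in> S_coc C"
    using kernel_retraction_split_extension[of A B \<alpha> e q] by (auto simp: S_coc_def)
qed

section \<open>Points of bialgebras and stability under pullback\<close>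

lemma points_BiAlg: "((A, \<alpha>, B), (B', e, A')) \<in> points M \<longleftrightarrow>
    B' = B \<and> A' = A \<and> cb A \<and> cb B \<and> bh A B \<alpha> \<and> bh B A e \<and> \<alpha> \<cdot> e = \<one> (obj B)"
  by (auto simp: points_def hom_BiAlg_coc)

lemma S_coc_points: "S_coc C \<subseteq> points M"
proof
  fix P assume "P \<in> S_coc C"
  then obtain A B \<alpha> e q where "P = ((A, \<alpha>, B), (B, e, A))" "kernel_retraction A B \<alpha> e q" by (auto simp: S_coc_iff)
  then show "P \<in> points M" using kernel_retractionD[of A B \<alpha> e q] by (simp add: points_BiAlg)
qed

text \<open>The given pullback is universal for bialgebras only. It is recognised as an equalizer on
  \<open>prod_bialg A D\<close>, so that \<open>equalizer_lift\<close> extends its universal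
  property to coalgebra morphisms; on elements the retraction then sends the pair of
  \<open>a\<close> and \<open>d\<close> to the pair of \<open>q a\<close> and the unit.\<close>

lemma pullback_stable_S_coc: "pullback_stable M (S_coc C)"
  unfolding pullback_stable_def
proof (intro allI impI, elim conjE)
  fix \<alpha>0 e0 g0 pA0 pC0 s0
  assume S: "(\<alpha>0, e0) \<in> S_coc C" and pb0: "is_pullback M \<alpha>0 g0 pA0 pC0"
    and s0: "s0 \<in> hom M (Dom M g0) (Dom M pC0)"
    and ps0: "pA0 \<cdot>\<^bsub>M\<^esub> s0 = e0 \<cdot>\<^bsub>M\<^esub> g0" and cs0: "pC0 \<cdot>\<^bsub>M\<^esub> s0 = \<one>\<^bsub>M\<^esub> (Dom M g0)"
  obtain A B \<alpha> e q where ae: "\<alpha>0 = (A, \<alpha>, B)" "e0 = (B, e, A)" and r: "kernel_retraction A B \<alpha> e q"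
    using S by (auto simp: S_coc_iff)
  note [simp] = kernel_retractionD(1,2)[OF r]
  note a = kernel_retractionD(3)[OF r] and e = kernel_retractionD(4)[OF r] and q = kernel_retractionD(6)[OF r]
  obtain D g where g0: "g0 = (D, g, B)" and [simp]: "cb D" and g: "bh D B g"
    using pb0 ae by (cases g0) (auto simp: is_pullback_def)
  obtain P p where p0: "pA0 = (P, p, A)" and [simp]: "cb P" and p: "bh P A p"
    using pb0 ae by (cases pA0) (auto simp: is_pullback_def)
  obtain c where c0: "pC0 = (P, c, D)" and c: "bh P D c"
    using pb0 g0 p0 by (cases pC0) (auto simp: is_pullback_def)
  obtain s where ss: "s0 = (D, s, P)" and s: "bh D P s" using s0 c0 g0 by (auto simp: hom_BiAlg_coc)
  have sq: "\<alpha> \<cdot> p = g \<cdot> c" using pb0 by (auto simp: is_pullback_def ae g0 p0 c0)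
  have ps: "p \<cdot> s = e \<cdot> g" and cs: "c \<cdot> s = \<one> (obj D)" using ps0 cs0 by (auto simp: ae ss g0 p0 c0)
  let ?A = "coalg_of A" and ?D = "coalg_of D" and ?P = "coalg_of P"
  let ?W = "prod_bialg A D" and ?p1 = "pr1 ?A ?D" and ?p2 = "pr2 ?A ?D"
  have W [simp]: "cb ?W" and p1: "bh ?W A ?p1" and p2: "bh ?W D ?p2"
    by (simp_all add: cb_prod_bialg bh_pr1 bh_pr2)
  let ?i = "pair ?P p c"
  have i: "bh P ?W ?i" by (simp add: bh_pair p c)
  have pi: "?p1 \<cdot> ?i = p" "?p2 \<cdot> ?i = c" using pr_pair[OF _ _ _ bh_ch[OF p] bh_ch[OF c]] by simp_all
  note [simp] = bh_simps[OF a] bh_simps[OF e] bh_simps[OF g] bh_simps[OF p] bh_simps[OF c] bh_simps[OF s]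
    bh_simps[OF p1] bh_simps[OF p2] bh_simps[OF i] ch_simps[OF q, simplified]
  have "is_equalizer M (?W, \<alpha> \<cdot> ?p1, B) (?W, g \<cdot> ?p2, B) (P, ?i, ?W)"
    unfolding is_equalizer_def
  proof (intro conjI allI ballI impI)
    show "(?W, \<alpha> \<cdot> ?p1, B) \<cdot>\<^bsub>M\<^esub> (P, ?i, ?W) = (?W, g \<cdot> ?p2, B) \<cdot>\<^bsub>M\<^esub> (P, ?i, ?W)"
      by (simp add: comp_assoc pi sq)
    fix T h
    assume "h \<in> hom M T (Dom M (?W, \<alpha> \<cdot> ?p1, B))"
      and eq: "(?W, \<alpha> \<cdot> ?p1, B) \<cdot>\<^bsub>M\<^esub> h = (?W, g \<cdot> ?p2, B) \<cdot>\<^bsub>M\<^esub> h"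
    then obtain h' where h': "h = (T, h', ?W)" and [simp]: "cb T" and h: "bh T ?W h'"
      by (auto simp: hom_BiAlg_coc)
    note [simp] = bh_simps[OF h]
    have h12: "(T, ?p1 \<cdot> h', A) \<in> hom M T (Dom M \<alpha>0)" "(T, ?p2 \<cdot> h', D) \<in> hom M T (Dom M g0)"
      by (simp_all add: hom_BiAlg_coc ae g0 bh_comp[OF _ _ _ h p1] bh_comp[OF _ _ _ h p2])
    moreover have "\<alpha>0 \<cdot>\<^bsub>M\<^esub> (T, ?p1 \<cdot> h', A) = g0 \<cdot>\<^bsub>M\<^esub> (T, ?p2 \<cdot> h', D)"
      using eq by (simp add: ae g0 h' comp_assoc)
    ultimately have "\<exists>!l. l \<in> hom M T (Dom M pA0) \<and> pA0 \<cdot>\<^bsub>M\<^esub> l = (T, ?p1 \<cdot> h', A) \<and> pC0 \<cdot>\<^bsub>M\<^esub> l = (T, ?p2 \<cdot> h', D)"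
      using pb0 unfolding is_pullback_def by blast
    then have ex: "\<exists>!l. l \<in> hom M T P \<and> pA0 \<cdot>\<^bsub>M\<^esub> l = (T, ?p1 \<cdot> h', A) \<and> pC0 \<cdot>\<^bsub>M\<^esub> l = (T, ?p2 \<cdot> h', D)"
      by (simp add: p0)
    \<comment> \<open>An arrow into the product is determined by its two projections, so factoring
      \<open>h\<close> through \<open>?i\<close> is the same as solving the two equations of the
      pullback; unique existence carries over.\<close>
    have iff: "(P, ?i, ?W) \<cdot>\<^bsub>M\<^esub> l = h \<longleftrightarrow> pA0 \<cdot>\<^bsub>M\<^esub> l = (T, ?p1 \<cdot> h', A) \<and> pC0 \<cdot>\<^bsub>M\<^esub> l = (T, ?p2 \<cdot> h', D)"
      if lh: "l \<in> hom M T P" for l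
    proof -
      obtain l' where l: "l = (T, l', P)" "bh T P l'" using lh by (auto simp: hom_BiAlg_coc)
      note [simp] = bh_simps[OF l(2)]
      have il: "bh T ?W (?i \<cdot> l')" by (rule bh_comp[OF _ _ _ l(2) i]) simp_all
      have "?i \<cdot> l' = h' \<longleftrightarrow> ?p1 \<cdot> (?i \<cdot> l') = ?p1 \<cdot> h' \<and> ?p2 \<cdot> (?i \<cdot> l') = ?p2 \<cdot> h'"
        using pair_ext[OF _ _ _ bh_ch[OF il, simplified] bh_ch[OF h, simplified]] by auto
      then show ?thesis by (simp add: l(1) h' p0 c0 comp_reduce1[OF pi(1)] comp_reduce1[OF pi(2)])
    qed
    show "\<exists>!k. k \<in> hom M T (Dom M (P, ?i, ?W)) \<and> (P, ?i, ?W) \<cdot>\<^bsub>M\<^esub> k = h"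
      using ex iff by (simp cong: conj_cong)
  qed (simp_all add: hom_BiAlg_coc i bh_comp[OF _ _ _ p1 a] bh_comp[OF _ _ _ p2 g])
  note E = this
  note Ed = equalizer_lift[OF E] and mono = equalizer_jointly_monic[OF E W]
  let ?As = "\<lambda>b. if b then A else D" and ?ps = "\<lambda>b. if b then p else c"
  have jm: "jointly_monic P UNIV ?As ?ps"
    unfolding jointly_monic_def
  proof (intro conjI allI impI)
    show "x = y" if T: "coc_coalg T" and x: "ch T ?P x" and y: "ch T ?P y" and eq: "\<forall>b\<in>UNIV. ?ps b \<cdot> x = ?ps b \<cdot> y" for T x y
    proof (rule mono[OF T x y])
      show "?i \<cdot> x = ?i \<cdot> y"
        using eq[THEN bspec, of True] eq[THEN bspec, of False] T x y pair_comp[OF _ _ _ _ bh_ch[OF p] bh_ch[OF c]] by simp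
    qed
  qed (simp_all add: p c)
  have pq: "ch ?P ?A (q \<cdot> p)" by (rule ch_comp[OF _ _ _ bh_ch[OF p] q]) simp_all
  let ?z = "one D ?P"
  have z: "ch ?P ?D ?z" by (simp add: ch_one)
  \<comment> \<open>Both components lie over the unit of \<open>B\<close>, so the pair of
    \<open>q \<cdot> p\<close> and the zero morphism lands in the pullback.\<close>
  have "\<alpha> \<cdot> (q \<cdot> p) = g \<cdot> ?z"
    by (simp add: comp_reduce1[OF kernel_retractionD(7)[OF r]] one_comp[OF _ _ _ bh_ch[OF p]] bh_one[OF _ _ _ g])
  moreover have qz: "ch ?P (coalg_of ?W) (pair ?P (q \<cdot> p) ?z)" by (simp add: ch_pair pq z)
  moreover have pr: "?p1 \<cdot> pair ?P (q \<cdot> p) ?z = q \<cdot> p" "?p2 \<cdot> pair ?P (q \<cdot> p) ?z = ?z"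
    using pr_pair[OF _ _ _ pq z] by simp_all
  ultimately have "\<alpha> \<cdot> ?p1 \<cdot> pair ?P (q \<cdot> p) ?z = g \<cdot> ?p2 \<cdot> pair ?P (q \<cdot> p) ?z"
    by (simp add: comp_ch_assoc[OF qz bh_ch[OF p1] bh_ch[OF a]] comp_ch_assoc[OF qz bh_ch[OF p2] bh_ch[OF g]])
  then obtain t where t: "ch ?P ?P t" and it: "?i \<cdot> t = pair ?P (q \<cdot> p) ?z"
    using Ed(4)[OF _ qz] by auto
  note [simp] = ch_simps[OF t, simplified]
  have point: "p \<cdot> t = q \<cdot> p" "c \<cdot> t = ?z"
    using arg_cong[OF it, of "\<lambda>x. ?p1 \<cdot> x"] arg_cong[OF it, of "\<lambda>x. ?p2 \<cdot> x"]
    by (simp_all add: comp_reduce1[OF pi(1)] comp_reduce1[OF pi(2)] pr)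
  have "kernel_retraction P D c s t"
  proof (rule kernel_retraction_family[OF jm])
    \<comment> \<open>The leg \<open>True\<close> is the given point, the leg \<open>False\<close>
      the identity point of \<open>D\<close> with its zero retraction.\<close>
    show "kernel_retraction (?As b) (if b then B else D) (if b then \<alpha> else \<one> (obj D)) (if b then e else \<one> (obj D))
        (if b then q else one D ?D)" for b
      using r kernel_retraction_id[of D] by simp
    show "bh D (if b then B else D) (if b then g else \<one> (obj D))" for b using g bh_id[of D] by simp
    show "?ps b \<cdot> t = (if b then q else one D ?D) \<cdot> ?ps b" for b
      using point one_comp[OF _ _ _ bh_ch[OF c], of D] by simp
  qed (use c s cs t sq ps in auto)
  then show "(pC0, s0) \<in> S_coc C" by (auto simp: S_coc_iff c0 ss)
qed

text \<open>The kernel in the definition of a strong point is arbitrary. It is compared by an arrow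
  \<open>j\<close> with the kernel \<open>k\<close> obtained as an equalizer, because
  \<open>k\<close> has the universal property for coalgebra morphisms that produces
  \<open>l\<close>.\<close>

lemma strong_point_S_coc:
  assumes "P \<in> S_coc C"
  shows "strong_point M P"
proof -
  obtain A B \<alpha> e q where P: "P = ((A, \<alpha>, B), (B, e, A))" and r: "kernel_retraction A B \<alpha> e q"
    using assms by (auto simp: S_coc_iff)
  let ?A = "coalg_of A" and ?B = "coalg_of B"
  note [simp] = kernel_retractionD(1,2)[OF r]
  note a = kernel_retractionD(3)[OF r] and e = kernel_retractionD(4)[OF r] and q = kernel_retractionD(6)[OF r]
  note [simp] = bh_simps[OF a] bh_simps[OF e] ch_simps[OF q, simplified]
  obtain X k where E: "is_equalizer M (A, \<alpha>, B) (A, one B ?A, B) (X, k, A)"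
    using equalizer_exists[of A B \<alpha> "one B ?A"] a bh_zero[of A B] by auto
  note Ed = equalizer_lift[OF E]
  note [simp] = Ed(1)
  note k = Ed(2)
  note [simp] = bh_simps[OF k]
  let ?X = "coalg_of X"
  \<comment> \<open>The composite with \<open>\<alpha>\<close> is zero exactly when the arrow
    equalizes \<open>\<alpha>\<close> and the zero morphism, so the equalizer is a kernel.\<close>
  have zero: "zero_arrow M ((A, \<alpha>, B) \<cdot>\<^bsub>M\<^esub> (T, h, A)) \<longleftrightarrow> (A, \<alpha>, B) \<cdot>\<^bsub>M\<^esub> (T, h, A) = (A, one B ?A, B) \<cdot>\<^bsub>M\<^esub> (T, h, A)"
    if "cb T" "bh T A h" for T h
    using that by (simp add: zero_arrow_iff one_comp[OF _ _ _ bh_ch[OF that(2)]])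
  have kernel: "is_kernel M (X, k, A) (A, \<alpha>, B)"
    unfolding is_kernel_def
  proof (intro conjI allI ballI impI)
    show "zero_arrow M ((A, \<alpha>, B) \<cdot>\<^bsub>M\<^esub> (X, k, A))" using zero[OF _ k] Ed(3) by simp
    fix t h
    assume h: "h \<in> hom M t (Dom M (A, \<alpha>, B))" and z: "zero_arrow M ((A, \<alpha>, B) \<cdot>\<^bsub>M\<^esub> h)"
    then obtain h' where "h = (t, h', A)" "cb t" "bh t A h'" by (auto simp: hom_BiAlg_coc)
    then have "(A, \<alpha>, B) \<cdot>\<^bsub>M\<^esub> h = (A, one B ?A, B) \<cdot>\<^bsub>M\<^esub> h" using zero z by simp
    then show "\<exists>!l. l \<in> hom M t (Dom M (X, k, A)) \<and> (X, k, A) \<cdot>\<^bsub>M\<^esub> l = h"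
      using E h unfolding is_equalizer_def by simp
  qed (simp_all add: a k)
  have ak: "\<alpha> \<cdot> k = one B ?X" using Ed(3) one_comp[OF _ _ _ bh_ch[OF k], of B] by simp
  obtain l where l: "ch ?A ?X l" and kl: "k \<cdot> l = q"
    using Ed(4)[OF _ q] one_comp[OF _ _ _ q, of B] kernel_retractionD(7)[OF r] by auto
  note [simp] = ch_simps[OF l, simplified]
  have "jointly_strongly_epic M \<kappa>0 (B, e, A)" if k0: "is_kernel M \<kappa>0 (A, \<alpha>, B)" for \<kappa>0
    unfolding jointly_strongly_epic_def
  proof (intro conjI allI impI, goal_cases)
    case (4 \<mu>0)
    obtain K \<kappa> where \<kappa>0: "\<kappa>0 = (K, \<kappa>, A)" and [simp]: "cb K" and \<kappa>: "bh K A \<kappa>"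
      using k0 by (cases \<kappa>0) (auto simp: is_kernel_def)
    have "(X, k, A) \<in> hom M X (Dom M (A, \<alpha>, B))" by (simp add: hom_BiAlg_coc k)
    moreover have "zero_arrow M ((A, \<alpha>, B) \<cdot>\<^bsub>M\<^esub> (X, k, A))" using kernel by (simp add: is_kernel_def)
    ultimately have "\<exists>!j. j \<in> hom M X (Dom M \<kappa>0) \<and> \<kappa>0 \<cdot>\<^bsub>M\<^esub> j = (X, k, A)"
      using k0 unfolding is_kernel_def by blast
    then obtain j0 where j0: "j0 \<in> hom M X (Dom M \<kappa>0)" "\<kappa>0 \<cdot>\<^bsub>M\<^esub> j0 = (X, k, A)" by blast
    then obtain j where "j0 = (X, j, K)" and j: "bh X K j" by (auto simp: \<kappa>0 hom_BiAlg_coc)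
    then have \<kappa>j: "\<kappa> \<cdot> j = k" using j0(2) by (simp add: \<kappa>0)
    obtain N \<mu> where \<mu>0: "\<mu>0 = (N, \<mu>, A)" and [simp]: "cb N" and \<mu>: "bh N A \<mu>" and mono: "is_mono M (N, \<mu>, A)"
      using 4 \<kappa>0 by (cases \<mu>0) (auto simp: is_mono_def)
    obtain v where v: "bh K N v" and \<mu>v: "\<mu> \<cdot> v = \<kappa>"
      using 4 by (auto simp: \<kappa>0 \<mu>0 hom_BiAlg_coc)
    obtain w where w: "bh B N w" and \<mu>w: "\<mu> \<cdot> w = e"
      using 4 by (auto simp: \<kappa>0 \<mu>0 hom_BiAlg_coc)
    note [simp] = bh_simps[OF \<kappa>] bh_simps[OF j] bh_simps[OF \<mu>] bh_simps[OF v] bh_simps[OF w]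
    let ?N = "coalg_of N"
    \<comment> \<open>A monomorphism of bialgebras is monic on coalgebra morphisms, since its kernel pair is an equalizer
      that the forgetful functor preserves.\<close>
    have mono_D: "x = y" if T [simp]: "coc_coalg T" and x: "ch T ?N x" and y: "ch T ?N y" and xy: "\<mu> \<cdot> x = \<mu> \<cdot> y" for T x y
    proof -
      let ?p1 = "pr1 ?N ?N" and ?p2 = "pr2 ?N ?N"
      have W [simp]: "cb (prod_bialg N N)" and p1: "bh (prod_bialg N N) N ?p1" and p2: "bh (prod_bialg N N) N ?p2"
        by (simp_all add: cb_prod_bialg bh_pr1 bh_pr2)
      note [simp] = bh_simps[OF p1] bh_simps[OF p2]
      obtain G i where G: "is_equalizer M (prod_bialg N N, \<mu> \<cdot> ?p1, A) (prod_bialg N N, \<mu> \<cdot> ?p2, A) (G, i, prod_bialg N N)"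
        using equalizer_exists[of "prod_bialg N N" A "\<mu> \<cdot> ?p1" "\<mu> \<cdot> ?p2"]
          bh_comp[OF _ _ _ p1 \<mu>] bh_comp[OF _ _ _ p2 \<mu>] by auto
      note Gd = equalizer_lift[OF G]
      note [simp] = Gd(1) bh_simps[OF Gd(2)]
      have "(G, ?p1 \<cdot> i, N) = (G, ?p2 \<cdot> i, N)"
      proof -
        have "(G, ?p1 \<cdot> i, N) \<in> hom M G (Dom M (N, \<mu>, A))" "(G, ?p2 \<cdot> i, N) \<in> hom M G (Dom M (N, \<mu>, A))"
          by (simp_all add: hom_BiAlg_coc bh_comp[OF _ _ _ Gd(2) p1] bh_comp[OF _ _ _ Gd(2) p2])
        moreover have "(N, \<mu>, A) \<cdot>\<^bsub>M\<^esub> (G, ?p1 \<cdot> i, N) = (N, \<mu>, A) \<cdot>\<^bsub>M\<^esub> (G, ?p2 \<cdot> i, N)"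
          using Gd(3) by (simp add: comp_assoc)
        ultimately show ?thesis using mono unfolding is_mono_def by blast
      qed
      then have pi: "?p1 \<cdot> i = ?p2 \<cdot> i" by simp
      have xy': "ch T (coalg_of (prod_bialg N N)) (pair T x y)" by (simp add: ch_pair x y)
      note [simp] = ch_simps[OF xy', simplified]
      note pr = pr_pair[OF T _ _ x y, simplified]
      have "\<mu> \<cdot> ?p1 \<cdot> pair T x y = \<mu> \<cdot> ?p2 \<cdot> pair T x y"
        by (simp add: comp_ch_assoc[OF xy' bh_ch[OF p1] bh_ch[OF \<mu>]] comp_ch_assoc[OF xy' bh_ch[OF p2] bh_ch[OF \<mu>]] pr xy)
      then obtain d where d: "ch T (coalg_of G) d" "i \<cdot> d = pair T x y"
        using Gd(4)[OF T xy'] by auto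
      note [simp] = ch_simps[OF d(1), simplified]
      have "?p1 \<cdot> (i \<cdot> d) = ?p2 \<cdot> (i \<cdot> d)" by (rule comp_reduce[OF pi]) simp_all
      then show "x = y" by (simp add: d(2) pr)
    qed
    have vj: "bh X N (v \<cdot> j)" by (rule bh_comp[OF _ _ _ j v]) simp_all
    have \<mu>vj: "\<mu> \<cdot> (v \<cdot> j) = k" by (simp add: comp_reduce1[OF \<mu>v] \<kappa>j)
    \<comment> \<open>An element of \<open>A\<close> is split into its kernel part and its section
      part, each part is lifted to \<open>N\<close>, and the lifts are multiplied there;
      \<open>\<mu>\<close> reassembles the element.\<close>
    let ?s = "mul N ?A (v \<cdot> j \<cdot> l) (w \<cdot> \<alpha>)"
    have s1: "ch ?A ?N (v \<cdot> j \<cdot> l)" by (rule ch_bh_comp[OF _ _ _ l vj]) simp_all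
    have s2: "ch ?A ?N (w \<cdot> \<alpha>)" by (rule ch_bh_comp[OF _ _ _ bh_ch[OF a] w]) simp_all
    have s: "ch ?A ?N ?s" by (simp add: ch_mul s1 s2)
    note [simp] = ch_simps[OF s, simplified]
    have \<mu>s: "\<mu> \<cdot> ?s = \<one> (obj A)"
      using kernel_retractionD(8)[OF r]
      by (simp add: bh_mul[OF _ _ _ \<mu> s1 s2] comp_reduce1[OF \<mu>vj] comp_reduce1[OF \<mu>w] kl)
    have s\<mu>: "?s \<cdot> \<mu> = \<one> (obj N)"
    proof (rule mono_D[of ?N])
      show "ch ?N ?N (?s \<cdot> \<mu>)" by (rule ch_comp[OF _ _ _ bh_ch[OF \<mu>] s]) simp_all
      show "ch ?N ?N (\<one> (obj N))" using ch_id[of ?N] by simp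
      show "\<mu> \<cdot> (?s \<cdot> \<mu>) = \<mu> \<cdot> \<one> (obj N)" by (simp add: comp_reduce1[OF \<mu>s])
    qed simp
    \<comment> \<open>So far \<open>?s\<close> is only a coalgebra morphism. Its composite with
      \<open>\<mu>\<close> is an identity, hence a bialgebra morphism, and the one-element family
      \<open>\<mu>\<close> reflects this.\<close>
    have "jointly_monic N (UNIV :: unit set) (\<lambda>_. A) (\<lambda>_. \<mu>)"
      unfolding jointly_monic_def using \<mu> mono_D by auto
    then have "bh A N ?s"
      by (rule jointly_monic_reflects_bh) (simp_all add: s \<mu>s bh_id)
    then have "inverse_arrows M (N, \<mu>, A) (A, ?s, N)"
      unfolding inverse_arrows_def using \<mu> by (simp add: hom_BiAlg_coc \<mu>s s\<mu>)
    then show ?case by (auto simp: is_iso_def \<mu>0)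
  qed (use k0 e in \<open>auto simp: is_kernel_def\<close>)
  then show ?thesis
    unfolding strong_point_def P using kernel S_coc_points assms P by auto
qed

section \<open>The category of points and its finite limits\<close>

definition point where "point A B \<alpha> e = ((A, \<alpha>, B), (B, e, A))"

lemma point_points: "point A B \<alpha> e \<in> points M \<longleftrightarrow> cb A \<and> cb B \<and> bh A B \<alpha> \<and> bh B A e \<and> \<alpha> \<cdot> e = \<one> (obj B)"
  by (simp add: point_def points_BiAlg)

lemma points_cases:
  assumes "P \<in> points M"
  obtains A B \<alpha> e where "P = point A B \<alpha> e"
  using assms by (auto simp: points_def point_def hom_BiAlg_coc Arr_BiAlg_coc)

lemma point_cat_Ob [simp]: "P \<in> Ob (point_cat M) \<longleftrightarrow> P \<in> points M"
  by (simp add: point_cat_def)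

lemma point_cat_comp:
  "(Q', (x', y'), R) \<cdot>\<^bsub>point_cat M\<^esub> (P, (x, y), Q) = (P, (x' \<cdot>\<^bsub>M\<^esub> x, y' \<cdot>\<^bsub>M\<^esub> y), R)"
  by (simp add: point_cat_def)

lemma point_cat_hom:
  assumes "point A B \<alpha> e \<in> points M" "point A' B' \<alpha>' e' \<in> points M"
  shows "h \<in> hom (point_cat M) (point A B \<alpha> e) (point A' B' \<alpha>' e') \<longleftrightarrow>
    (\<exists>x y. h = (point A B \<alpha> e, ((A, x, A'), (B, y, B')), point A' B' \<alpha>' e') \<and>
      bh A A' x \<and> bh B B' y \<and> \<alpha>' \<cdot> x = y \<cdot> \<alpha> \<and> x \<cdot> e = e' \<cdot> y)"
proof -
  have "h \<in> hom (point_cat M) (point A B \<alpha> e) (point A' B' \<alpha>' e') \<longleftrightarrow>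
    (\<exists>p g. h = (point A B \<alpha> e, (p, g), point A' B' \<alpha>' e') \<and> p \<in> hom M A A' \<and> g \<in> hom M B B' \<and>
      (A', \<alpha>', B') \<cdot>\<^bsub>M\<^esub> p = g \<cdot>\<^bsub>M\<^esub> (A, \<alpha>, B) \<and> p \<cdot>\<^bsub>M\<^esub> (B, e, A) = (B', e', A') \<cdot>\<^bsub>M\<^esub> g)"
    using assms by (auto simp: point_cat_def hom_def[of "point_cat M"] hom_def[of "\<lparr>Ob = _, Arr = _, Dom = _, Cod = _, Id = _, Comp = _\<rparr>"] point_def)
  also have "\<dots> \<longleftrightarrow> (\<exists>x y. h = (point A B \<alpha> e, ((A, x, A'), (B, y, B')), point A' B' \<alpha>' e') \<and>
      bh A A' x \<and> bh B B' y \<and> \<alpha>' \<cdot> x = y \<cdot> \<alpha> \<and> x \<cdot> e = e' \<cdot> y)"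
    using assms by (fastforce simp: hom_BiAlg_coc point_points)
  finally show ?thesis .
qed

text \<open>\<open>P\<close> is universal among points only, which says nothing directly about
  coalgebra morphisms into its total object \<open>A\<close>. The limits \<open>L\<close> of the
  total objects and \<open>L'\<close> of the bases are formed separately; \<open>A\<close> turns out
  to be a retract of \<open>L\<close>, so the legs \<open>pa\<close> are jointly monic and the
  retraction of \<open>L\<close> can be transferred.\<close>

lemma closed_under_finite_limits_S_coc: "closed_under_finite_limits M (S_coc C)"
  unfolding closed_under_finite_limits_def
proof (intro allI impI, elim conjE)
  fix J :: "(nat, nat) cat" and F P p
  assume J: "finite_shape J" and F: "is_functor J (point_cat M) F" and S: "\<forall>j\<in>Ob J. FOb F j \<in> S_coc C"
    and lim: "is_limit J (point_cat M) F P p"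
  have cat: "category J" and fin: "finite (Ob J)" "finite (Arr J)" using J by (auto simp: finite_shape_def)
  have DC [simp]: "Dom J u \<in> Ob J" "Cod J u \<in> Ob J" if "u \<in> Arr J" for u
    using category.Dom_Ob[OF cat that] category.Cod_Ob[OF cat that] by auto
  have "\<forall>j\<in>Ob J. \<exists>A B \<alpha> e q. FOb F j = point A B \<alpha> e \<and> kernel_retraction A B \<alpha> e q"
    using S unfolding S_coc_iff point_def by blast
  then obtain As Bs \<alpha>s es qs where *: "\<forall>j\<in>Ob J. FOb F j = point (As j) (Bs j) (\<alpha>s j) (es j) \<and>
      kernel_retraction (As j) (Bs j) (\<alpha>s j) (es j) (qs j)"
    by metis
  then have Fj: "FOb F j = point (As j) (Bs j) (\<alpha>s j) (es j)" and r: "kernel_retraction (As j) (Bs j) (\<alpha>s j) (es j) (qs j)"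
    if "j \<in> Ob J" for j using that by auto
  note [simp] = kernel_retractionD(1,2)[OF r]
  note aj = kernel_retractionD(3)[OF r] and ej = kernel_retractionD(4)[OF r] and qj = kernel_retractionD(6)[OF r]
  have ptj: "point (As j) (Bs j) (\<alpha>s j) (es j) \<in> points M" if "j \<in> Ob J" for j
    using that aj ej kernel_retractionD(5)[OF r] by (simp add: point_points)
  have "\<exists>x y. FArr F u = (FOb F (Dom J u), ((As (Dom J u), x, As (Cod J u)), (Bs (Dom J u), y, Bs (Cod J u))), FOb F (Cod J u)) \<and>
      bh (As (Dom J u)) (As (Cod J u)) x \<and> bh (Bs (Dom J u)) (Bs (Cod J u)) y \<and>
      \<alpha>s (Cod J u) \<cdot> x = y \<cdot> \<alpha>s (Dom J u) \<and> x \<cdot> es (Dom J u) = es (Cod J u) \<cdot> y" if u: "u \<in> Arr J" for u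
  proof -
    have "FArr F u \<in> hom (point_cat M) (FOb F (Dom J u)) (FOb F (Cod J u))"
      using F u by (simp add: is_functor_def)
    then show ?thesis
      unfolding Fj[OF DC(1)[OF u]] Fj[OF DC(2)[OF u]] point_cat_hom[OF ptj[OF DC(1)[OF u]] ptj[OF DC(2)[OF u]]] .
  qed
  then obtain xs ys where **: "\<And>u. u \<in> Arr J \<Longrightarrow>
      FArr F u = (FOb F (Dom J u), ((As (Dom J u), xs u, As (Cod J u)), (Bs (Dom J u), ys u, Bs (Cod J u))), FOb F (Cod J u)) \<and>
      bh (As (Dom J u)) (As (Cod J u)) (xs u) \<and> bh (Bs (Dom J u)) (Bs (Cod J u)) (ys u) \<and>
      \<alpha>s (Cod J u) \<cdot> xs u = ys u \<cdot> \<alpha>s (Dom J u) \<and> xs u \<cdot> es (Dom J u) = es (Cod J u) \<cdot> ys u"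
    by metis
  then have Fu: "FArr F u = (FOb F (Dom J u), ((As (Dom J u), xs u, As (Cod J u)), (Bs (Dom J u), ys u, Bs (Cod J u))), FOb F (Cod J u))"
    and xu: "bh (As (Dom J u)) (As (Cod J u)) (xs u)" and yu: "bh (Bs (Dom J u)) (Bs (Cod J u)) (ys u)"
    and ax: "\<alpha>s (Cod J u) \<cdot> xs u = ys u \<cdot> \<alpha>s (Dom J u)" and xe: "xs u \<cdot> es (Dom J u) = es (Cod J u) \<cdot> ys u"
    if "u \<in> Arr J" for u
    using that by blast+
  note [simp] = bh_simps[OF aj] bh_simps[OF ej] bh_simps[OF xu] bh_simps[OF yu] ch_simps[OF qj, simplified]
  have "\<exists>V l. universal_cone V (Ob J) As ((\<lambda>u. (Dom J u, xs u, Cod J u)) ` Arr J) l"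
    by (rule universal_cone_exists) (use fin xu in auto)
  then obtain L l where ul: "universal_cone L (Ob J) As ((\<lambda>u. (Dom J u, xs u, Cod J u)) ` Arr J) l" by blast
  have "\<exists>V l. universal_cone V (Ob J) Bs ((\<lambda>u. (Dom J u, ys u, Cod J u)) ` Arr J) l"
    by (rule universal_cone_exists) (use fin yu in auto)
  then obtain L' l' where ul': "universal_cone L' (Ob J) Bs ((\<lambda>u. (Dom J u, ys u, Cod J u)) ` Arr J) l'" by blast
  note jm = universal_coneD(1)[OF ul] and jm' = universal_coneD(1)[OF ul']
  note [simp] = jointly_monicD(1)[OF jm] jointly_monicD(1)[OF jm']
  note l = jointly_monicD(3)[OF jm] and l' = jointly_monicD(3)[OF jm']
  note [simp] = bh_simps[OF l] bh_simps[OF l']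
  have xl: "xs u \<cdot> l (Dom J u) = l (Cod J u)" and yl: "ys u \<cdot> l' (Dom J u) = l' (Cod J u)" if "u \<in> Arr J" for u
    using that universal_coneD(2)[OF ul, of "Dom J u" "xs u" "Cod J u"] universal_coneD(2)[OF ul', of "Dom J u" "ys u" "Cod J u"] by blast+
  \<comment> \<open>The arrows of the diagram commute with the projections \<open>\<alpha>s\<close>
    and the sections \<open>es\<close>, so these induce \<open>a\<close> and \<open>e\<close>
    between the two limits and make a point of them.\<close>
  have "\<exists>h. bh L L' h \<and> (\<forall>j\<in>Ob J. l' j \<cdot> h = \<alpha>s j \<cdot> l j)"
  proof (rule universal_cone_lift[OF ul'])
    show "bh L (Bs j) (\<alpha>s j \<cdot> l j)" if "j \<in> Ob J" for j by (rule bh_comp[OF _ _ _ l aj]) (simp_all add: that)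
    show "f \<cdot> (\<alpha>s i \<cdot> l i) = \<alpha>s k \<cdot> l k" if "(i, f, k) \<in> (\<lambda>u. (Dom J u, ys u, Cod J u)) ` Arr J" for i f k
      using that by (auto simp: xl comp_reduce[OF ax[symmetric]])
  qed simp
  then obtain a where a: "bh L L' a" and la: "\<And>j. j \<in> Ob J \<Longrightarrow> l' j \<cdot> a = \<alpha>s j \<cdot> l j" by blast
  have "\<exists>h. bh L' L h \<and> (\<forall>j\<in>Ob J. l j \<cdot> h = es j \<cdot> l' j)"
  proof (rule universal_cone_lift[OF ul])
    show "bh L' (As j) (es j \<cdot> l' j)" if "j \<in> Ob J" for j by (rule bh_comp[OF _ _ _ l' ej]) (simp_all add: that)
    show "f \<cdot> (es i \<cdot> l' i) = es k \<cdot> l' k" if "(i, f, k) \<in> (\<lambda>u. (Dom J u, xs u, Cod J u)) ` Arr J" for i f k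
      using that by (auto simp: yl comp_reduce[OF xe])
  qed simp
  then obtain e where e: "bh L' L e" and le: "\<And>j. j \<in> Ob J \<Longrightarrow> l j \<cdot> e = es j \<cdot> l' j" by blast
  note [simp] = bh_simps[OF a] bh_simps[OF e]
  have ae: "a \<cdot> e = \<one> (obj L')"
  proof (rule jointly_monicD(4)[OF jm'])
    show "ch (coalg_of L') (coalg_of L') (a \<cdot> e)" by (rule bh_ch[OF bh_comp[OF _ _ _ e a]]) simp_all
    show "ch (coalg_of L') (coalg_of L') (\<one> (obj L'))" using ch_id[of "coalg_of L'"] by simp
    show "l' j \<cdot> (a \<cdot> e) = l' j \<cdot> \<one> (obj L')" if "j \<in> Ob J" for j
      using that by (simp add: comp_reduce[OF la] le comp_reduce1[OF kernel_retractionD(5)[OF r]])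
  qed simp
  have ptL: "point L L' a e \<in> points M" by (simp add: point_points a e ae)
  let ?c = "\<lambda>j. (point L L' a e, ((L, l j, As j), (L', l' j, Bs j)), FOb F j)"
  have coneL: "is_cone J (point_cat M) F (point L L' a e) ?c"
    unfolding is_cone_def
  proof (intro conjI ballI)
    show "?c j \<in> hom (point_cat M) (point L L' a e) (FOb F j)" if "j \<in> Ob J" for j
      unfolding Fj[OF that] point_cat_hom[OF ptL ptj[OF that]] using that l l' la le by auto
    show "FArr F u \<cdot>\<^bsub>point_cat M\<^esub> ?c (Dom J u) = ?c (Cod J u)" if "u \<in> Arr J" for u
      using that by (simp add: Fu point_cat_comp xl yl)
  qed (simp add: ptL)
  have cone: "is_cone J (point_cat M) F P p" using lim by (simp add: is_limit_def)
  then have "P \<in> points M" by (simp add: is_cone_def)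
  then obtain A B \<alpha> \<epsilon> where P: "P = point A B \<alpha> \<epsilon>" by (rule points_cases)
  have ptP: "point A B \<alpha> \<epsilon> \<in> points M" using \<open>P \<in> points M\<close> by (simp add: P)
  then have [simp]: "cb A" "cb B" and \<alpha>: "bh A B \<alpha>" and \<epsilon>: "bh B A \<epsilon>" and \<alpha>\<epsilon>: "\<alpha> \<cdot> \<epsilon> = \<one> (obj B)"
    by (auto simp: point_points)
  have "\<exists>x y. p j = (P, ((A, x, As j), (B, y, Bs j)), FOb F j) \<and> bh A (As j) x \<and> bh B (Bs j) y \<and>
      \<alpha>s j \<cdot> x = y \<cdot> \<alpha> \<and> x \<cdot> \<epsilon> = es j \<cdot> y" if "j \<in> Ob J" for j
  proof -
    have "p j \<in> hom (point_cat M) P (FOb F j)" using cone that by (simp add: is_cone_def)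
    then show ?thesis unfolding P Fj[OF that] point_cat_hom[OF ptP ptj[OF that]] .
  qed
  then obtain pa pb where ***: "\<And>j. j \<in> Ob J \<Longrightarrow> p j = (P, ((A, pa j, As j), (B, pb j, Bs j)), FOb F j) \<and>
      bh A (As j) (pa j) \<and> bh B (Bs j) (pb j) \<and> \<alpha>s j \<cdot> pa j = pb j \<cdot> \<alpha> \<and> pa j \<cdot> \<epsilon> = es j \<cdot> pb j"
    by metis
  then have pj: "p j = (P, ((A, pa j, As j), (B, pb j, Bs j)), FOb F j)" and pa: "bh A (As j) (pa j)" and pb: "bh B (Bs j) (pb j)"
    and ap: "\<alpha>s j \<cdot> pa j = pb j \<cdot> \<alpha>" and pe: "pa j \<cdot> \<epsilon> = es j \<cdot> pb j" if "j \<in> Ob J" for j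
    using that by blast+
  note [simp] = bh_simps[OF \<alpha>] bh_simps[OF \<epsilon>] bh_simps[OF pa] bh_simps[OF pb]
  have xp: "xs u \<cdot> pa (Dom J u) = pa (Cod J u)" "ys u \<cdot> pb (Dom J u) = pb (Cod J u)" if u: "u \<in> Arr J" for u
  proof -
    have "FArr F u \<cdot>\<^bsub>point_cat M\<^esub> p (Dom J u) = p (Cod J u)" using cone u by (simp add: is_cone_def)
    then show "xs u \<cdot> pa (Dom J u) = pa (Cod J u)" "ys u \<cdot> pb (Dom J u) = pb (Cod J u)"
      by (simp_all add: Fu[OF u] pj[OF DC(1)[OF u]] pj[OF DC(2)[OF u]] point_cat_comp)
  qed
  obtain \<phi> where \<phi>: "\<phi> \<in> hom (point_cat M) (point L L' a e) P" and p\<phi>: "\<forall>j\<in>Ob J. p j \<cdot>\<^bsub>point_cat M\<^esub> \<phi> = ?c j"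
    using lim coneL unfolding is_limit_def by blast
  obtain f f' where \<phi>f: "\<phi> = (point L L' a e, ((L, f, A), (L', f', B)), P)" and f: "bh L A f" and f': "bh L' B f'"
    and \<alpha>f: "\<alpha> \<cdot> f = f' \<cdot> a" and fe: "f \<cdot> e = \<epsilon> \<cdot> f'"
    using \<phi> unfolding P point_cat_hom[OF ptL ptP] by blast
  note [simp] = bh_simps[OF f] bh_simps[OF f']
  have pf: "pa j \<cdot> f = l j" "pb j \<cdot> f' = l' j" if "j \<in> Ob J" for j
    using p\<phi>[rule_format, OF that] by (simp_all add: pj[OF that] \<phi>f point_cat_comp)
  have "\<exists>h. bh A L h \<and> (\<forall>j\<in>Ob J. l j \<cdot> h = pa j)"
    by (rule universal_cone_lift[OF ul]) (use pa xp in auto)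
  then obtain g where g: "bh A L g" and lg: "\<And>j. j \<in> Ob J \<Longrightarrow> l j \<cdot> g = pa j" by blast
  have "\<exists>h. bh B L' h \<and> (\<forall>j\<in>Ob J. l' j \<cdot> h = pb j)"
    by (rule universal_cone_lift[OF ul']) (use pb xp in auto)
  then obtain g' where g': "bh B L' g'" and lg': "\<And>j. j \<in> Ob J \<Longrightarrow> l' j \<cdot> g' = pb j" by blast
  note [simp] = bh_simps[OF g] bh_simps[OF g']
  have ag: "a \<cdot> g = g' \<cdot> \<alpha>"
  proof (rule jointly_monicD(4)[OF jm'])
    show "ch (coalg_of A) (coalg_of L') (a \<cdot> g)" by (rule bh_ch[OF bh_comp[OF _ _ _ g a]]) simp_all
    show "ch (coalg_of A) (coalg_of L') (g' \<cdot> \<alpha>)" by (rule bh_ch[OF bh_comp[OF _ _ _ \<alpha> g']]) simp_all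
    show "l' j \<cdot> (a \<cdot> g) = l' j \<cdot> (g' \<cdot> \<alpha>)" if "j \<in> Ob J" for j
      using that by (simp add: comp_reduce[OF la] lg comp_reduce1[OF lg'] ap)
  qed simp
  have ge: "g \<cdot> \<epsilon> = e \<cdot> g'"
  proof (rule jointly_monicD(4)[OF jm])
    show "ch (coalg_of B) (coalg_of L) (g \<cdot> \<epsilon>)" by (rule bh_ch[OF bh_comp[OF _ _ _ \<epsilon> g]]) simp_all
    show "ch (coalg_of B) (coalg_of L) (e \<cdot> g')" by (rule bh_ch[OF bh_comp[OF _ _ _ g' e]]) simp_all
    show "l j \<cdot> (g \<cdot> \<epsilon>) = l j \<cdot> (e \<cdot> g')" if "j \<in> Ob J" for j
      using that by (simp add: comp_reduce[OF le] lg' comp_reduce1[OF lg] pe)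
  qed simp
  \<comment> \<open>Two endomorphisms of \<open>P\<close> are compatible with the legs
    \<open>p j\<close>, so uniqueness in the limit of points identifies them. By \<open>ag\<close>
    and \<open>ge\<close> the pair \<open>g\<close>, \<open>g'\<close> is an arrow of points, which
    makes the composite one as well.\<close>
  have fg: "f \<cdot> g = \<one> (obj A)"
  proof -
    let ?k = "\<lambda>x y. (P, ((A, x, A), (B, y, B)), P)"
    have "\<exists>!h. h \<in> hom (point_cat M) P P \<and> (\<forall>j\<in>Ob J. p j \<cdot>\<^bsub>point_cat M\<^esub> h = p j)"
      using lim cone unfolding is_limit_def by blast
    moreover have "?k (f \<cdot> g) (f' \<cdot> g') \<in> hom (point_cat M) P P"
      unfolding P point_cat_hom[OF ptP ptP] using bh_comp[OF _ _ _ g f] bh_comp[OF _ _ _ g' f']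
      by (simp add: comp_reduce[OF \<alpha>f] ag comp_assoc ge comp_reduce[OF fe])
    moreover have "?k (\<one> (obj A)) (\<one> (obj B)) \<in> hom (point_cat M) P P"
      unfolding P point_cat_hom[OF ptP ptP] by (simp add: bh_id)
    moreover have "p j \<cdot>\<^bsub>point_cat M\<^esub> ?k (f \<cdot> g) (f' \<cdot> g') = p j"
      "p j \<cdot>\<^bsub>point_cat M\<^esub> ?k (\<one> (obj A)) (\<one> (obj B)) = p j" if "j \<in> Ob J" for j
      using that by (simp_all add: pj[OF that] point_cat_comp comp_reduce1[OF pf(1)] comp_reduce1[OF pf(2)] lg lg')
    ultimately have "?k (f \<cdot> g) (f' \<cdot> g') = ?k (\<one> (obj A)) (\<one> (obj B))" by blast
    then show ?thesis by simp
  qed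
  have jmA: "jointly_monic A (Ob J) As pa"
    unfolding jointly_monic_def
  proof (intro conjI allI impI)
    show "x = y" if T: "coc_coalg T" and x: "ch T (coalg_of A) x" and y: "ch T (coalg_of A) y"
      and eq: "\<forall>j\<in>Ob J. pa j \<cdot> x = pa j \<cdot> y" for T x y
    proof -
      note [simp] = ch_simps[OF x, simplified] ch_simps[OF y, simplified]
      have "g \<cdot> x = g \<cdot> y"
      proof (rule jointly_monicD(4)[OF jm T])
        show "ch T (coalg_of L) (g \<cdot> x)" "ch T (coalg_of L) (g \<cdot> y)"
          using T by (simp_all add: ch_bh_comp[OF _ _ _ x g] ch_bh_comp[OF _ _ _ y g])
        show "l j \<cdot> (g \<cdot> x) = l j \<cdot> (g \<cdot> y)" if "j \<in> Ob J" for j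
          using eq that T by (simp add: comp_reduce1[OF lg])
      qed
      then have "f \<cdot> (g \<cdot> x) = f \<cdot> (g \<cdot> y)" by simp
      then show "x = y" using T by (simp add: comp_reduce1[OF fg])
    qed
  qed (simp_all add: pa)
  have "\<exists>h. ch (coalg_of L) (coalg_of L) h \<and> (\<forall>j\<in>Ob J. l j \<cdot> h = qs j \<cdot> l j)"
  proof (rule universal_coneD(3)[OF ul])
    show "ch (coalg_of L) (coalg_of (As j)) (qs j \<cdot> l j)" if "j \<in> Ob J" for j
      by (rule ch_comp[OF _ _ _ bh_ch[OF l] qj]) (simp_all add: that)
    \<comment> \<open>Naturality of retractions along the arrows of the diagram makes the maps
      \<open>qs j \<cdot> l j\<close> a cone of coalgebra morphisms, which therefore factors through
      \<open>L\<close>.\<close>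
    have nat: "xs u \<cdot> qs (Dom J u) = qs (Cod J u) \<cdot> xs u" if "u \<in> Arr J" for u
      using kernel_retraction_natural[OF r r xu yu ax xe] that by simp
    show "k \<cdot> (qs i \<cdot> l i) = qs m \<cdot> l m" if "(i, k, m) \<in> (\<lambda>u. (Dom J u, xs u, Cod J u)) ` Arr J" for i k m
      using that by (auto simp: comp_reduce[OF nat] xl)
  qed simp
  then obtain q where q: "ch (coalg_of L) (coalg_of L) q" and lq: "\<And>j. j \<in> Ob J \<Longrightarrow> l j \<cdot> q = qs j \<cdot> l j" by blast
  note [simp] = ch_simps[OF q, simplified]
  \<comment> \<open>The endomorphism induced on \<open>L\<close> is carried to its retract
    \<open>A\<close> by entering through \<open>g\<close> and leaving through
    \<open>f\<close>.\<close>
  have "kernel_retraction A B \<alpha> \<epsilon> (f \<cdot> (q \<cdot> g))"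
  proof (rule kernel_retraction_family[OF jmA _ \<alpha> \<epsilon> \<alpha>\<epsilon> _ r pb ap pe])
    have qg: "ch (coalg_of A) (coalg_of L) (q \<cdot> g)" by (rule ch_comp[OF _ _ _ bh_ch[OF g] q]) simp_all
    show "ch (coalg_of A) (coalg_of A) (f \<cdot> (q \<cdot> g))" by (rule ch_bh_comp[OF _ _ _ qg f]) simp_all
    show "pa j \<cdot> (f \<cdot> (q \<cdot> g)) = qs j \<cdot> pa j" if "j \<in> Ob J" for j
      using that by (simp add: comp_reduce1[OF pf(1)] comp_reduce[OF lq] lg)
  qed simp_all
  then show "P \<in> S_coc C" unfolding S_coc_iff P point_def by blast
qed

lemma S_protomodular_BiAlg: "S_protomodular M (S_coc C)"
  unfolding S_protomodular_def pointed_def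
  using category_BiAlg zero_object_unit_bialg finitely_complete_BiAlg S_coc_points pullback_stable_S_coc
    closed_under_finite_limits_S_coc strong_point_S_coc by blast

end

theorem theorem2p7:
  fixes C :: "('o, 'a) smc"
  assumes "symmetric_monoidal_category C"
    and "has_equalizers C"
    and "has_equalizers (BiAlg_coc C)"
    and "preserves_equalizers (BiAlg_coc C) (CoAlg_coc C) forget_alg"
  shows "S_protomodular (BiAlg_coc C) (S_coc C)"
proof -
  interpret symmetric_monoidal_category C by (rule assms(1))
  interpret coc_bialgebras C by unfold_locales (rule assms(3,4))+
  show ?thesis by (rule S_protomodular_BiAlg)
qed

end
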